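(* Let $\mathcal{F}$ be a (possibly infinite) family of finite nonempty tournaments, let $\mathcal{K}$ be the class of all finite $\mathcal{F}$-free digraphs, and let $M_{\mathcal{F}}$ be the generic countable digraph of the class $\mathcal{K}$. (a) Let $A\in\mathcal{K}$ and let $p_1,\dots,p_n$ be partial isomorphisms on $A$. Then there exist $B\in\mathcal{K}$ containing $A$ as a substructure and automorphisms $f_1,\dots,f_n$ of $B$ such that $f_i$ extends $p_i$ for every $1\le i\le n$. (b) $M_{\mathcal{F}}$ has the Small Index Property. (That is, the Small Index Property holds for all Henson digraphs.)
   Context: A digraph is a set with an irreflexive antisymmetric binary relation $R$ (so $aRb$ and $bRa$ never both hold). A tournament is a digraph $F$ such that for all $a\ne b$ in $F$, $aRb$ or $bRa$. A digraph $A$ is $\mathcal{F}$-free if no $F\in\mathcal{F}$ embeds into $A$. A partial isomorphism on $A$ is an injective map $p$ from a subset $D(p)\subset A$ into $A$ such that for all $a,b\in D(p)$: $aRb\iff p(a)Rp(b)$. The class $\mathcal{K}$ has the free amalgamation property; $M_{\mathcal{F}}$ denotes its Fraïssé limit, i.e. the (unique up to isomorphism) countable homogeneous digraph whose finite substructures are, up to isomorphism, exactly the members of $\mathcal{K}$. The digraphs $M_{\mathcal{F}}$ are called Henson digraphs. A countable structure $M$ has the Small Index Property if every subgroup of $\mathrm{Aut}(M)$ of index less than $2^{\aleph_0}$ contains the pointwise stabilizer in $\mathrm{Aut}(M)$ of some finite subset of $M$. *)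

theory Defs
  imports
    "HOL-Algebra.Bij"
    "HOL-Algebra.Coset"
    "HOL-Library.Equipollence"
    "HOL-Library.Infinite_Typeclass"
begin

record 'a digraph =
  vertices :: "'a set"
  edges :: "'a rel"

text \<open>The empty digraph is allowed.\<close>

definition is_digraph :: "'a digraph \<Rightarrow> bool" where
  "is_digraph A \<longleftrightarrow>
     edges A \<subseteq> vertices A \<times> vertices A \<and> irrefl (edges A) \<and> asym (edges A)"

definition is_tournament :: "'a digraph \<Rightarrow> bool" where
  "is_tournament T \<longleftrightarrow> is_digraph T \<and>
     (\<forall>a\<in>vertices T. \<forall>b\<in>vertices T. a \<noteq> b \<longrightarrow> (a, b) \<in> edges T \<or> (b, a) \<in> edges T)"

definition induced :: "'a digraph \<Rightarrow> 'a set \<Rightarrow> 'a digraph" where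
  "induced A S = \<lparr>vertices = S, edges = edges A \<inter> S \<times> S\<rparr>"

definition substructure :: "'a digraph \<Rightarrow> 'a digraph \<Rightarrow> bool" where
  "substructure A B \<longleftrightarrow> vertices A \<subseteq> vertices B \<and> A = induced B (vertices A)"

definition is_embedding :: "('a \<Rightarrow> 'b) \<Rightarrow> 'a digraph \<Rightarrow> 'b digraph \<Rightarrow> bool" where
  "is_embedding h A B \<longleftrightarrow>
     inj_on h (vertices A) \<and> h ` vertices A \<subseteq> vertices B \<and>
     (\<forall>a\<in>vertices A. \<forall>b\<in>vertices A. (a, b) \<in> edges A \<longleftrightarrow> (h a, h b) \<in> edges B)"

definition embeds :: "'a digraph \<Rightarrow> 'b digraph \<Rightarrow> bool" where
  "embeds A B \<longleftrightarrow> (\<exists>h. is_embedding h A B)"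

definition isomorphic :: "'a digraph \<Rightarrow> 'b digraph \<Rightarrow> bool" where
  "isomorphic A B \<longleftrightarrow> (\<exists>h. is_embedding h A B \<and> h ` vertices A = vertices B)"

text \<open>The members, with vertices in a given type, of the class of all finite
  \<open>\<F>\<close>-free digraphs.\<close>

definition free_class :: "'f digraph set \<Rightarrow> 'a digraph set" where
  "free_class \<F> =
     {A. is_digraph A \<and> finite (vertices A) \<and> (\<forall>T\<in>\<F>. \<not> embeds T A)}"

definition partial_iso :: "'a digraph \<Rightarrow> ('a \<rightharpoonup> 'a) \<Rightarrow> bool" where
  "partial_iso A p \<longleftrightarrow>
     dom p \<subseteq> vertices A \<and> ran p \<subseteq> vertices A \<and> inj_on p (dom p) \<and>
     (\<forall>a\<in>dom p. \<forall>b\<in>dom p. (a, b) \<in> edges A \<longleftrightarrow> (the (p a), the (p b)) \<in> edges A)"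

definition extends :: "('a \<Rightarrow> 'a) \<Rightarrow> ('a \<rightharpoonup> 'a) \<Rightarrow> bool" where
  "extends f p \<longleftrightarrow> (\<forall>a\<in>dom p. p a = Some (f a))"

text \<open>Automorphisms are extensional, as in \<open>BijGroup\<close>, so that each one is
  represented by a single function.\<close>

definition automorphisms :: "'a digraph \<Rightarrow> ('a \<Rightarrow> 'a) set" where
  "automorphisms A = {f \<in> Bij (vertices A). is_embedding f A A}"

definition Aut :: "'a digraph \<Rightarrow> ('a \<Rightarrow> 'a) monoid" where
  "Aut A = BijGroup (vertices A)\<lparr>carrier := automorphisms A\<rparr>"

definition homogeneous :: "'a digraph \<Rightarrow> bool" where
  "homogeneous M \<longleftrightarrow>
     (\<forall>p. partial_iso M p \<and> finite (dom p) \<longrightarrow> (\<exists>f\<in>automorphisms M. extends f p))"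

text \<open>Every finite digraph has an isomorphic copy on natural numbers, so it is enough
  to let the members of the class range over digraphs with vertices in \<open>nat\<close>.\<close>

definition henson_digraph :: "'f digraph set \<Rightarrow> 'm digraph \<Rightarrow> bool" where
  "henson_digraph \<F> M \<longleftrightarrow>
     is_digraph M \<and> countable (vertices M) \<and> homogeneous M \<and>
     (\<forall>S. S \<subseteq> vertices M \<and> finite S \<longrightarrow>
        (\<exists>A \<in> (free_class \<F> :: nat digraph set). isomorphic A (induced M S))) \<and>
     (\<forall>A \<in> (free_class \<F> :: nat digraph set).
        \<exists>S. S \<subseteq> vertices M \<and> finite S \<and> isomorphic A (induced M S))"

definition pointwise_stabilizer :: "'a digraph \<Rightarrow> 'a set \<Rightarrow> ('a \<Rightarrow> 'a) set" where
  "pointwise_stabilizer M S = {f \<in> automorphisms M. \<forall>x\<in>S. f x = x}"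

text \<open>The set \<open>UNIV :: nat set set\<close> has the cardinality of the continuum.\<close>

definition small_index_property :: "'a digraph \<Rightarrow> bool" where
  "small_index_property M \<longleftrightarrow>
     (\<forall>H. subgroup H (Aut M) \<and> rcosets\<^bsub>Aut M\<^esub> H \<prec> (UNIV :: nat set set) \<longrightarrow>
        (\<exists>S. S \<subseteq> vertices M \<and> finite S \<and> pointwise_stabilizer M S \<subseteq> H))"

lemma subgroup_automorphisms: "subgroup (automorphisms A) (BijGroup (vertices A))"
proof (rule subgroup.intro)
  show "automorphisms A \<subseteq> carrier (BijGroup (vertices A))"
    by (auto simp: automorphisms_def BijGroup_def)
next
  fix f g assume "f \<in> automorphisms A" "g \<in> automorphisms A"
  then have bij: "f \<in> Bij (vertices A)" "g \<in> Bij (vertices A)"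
    and emb: "is_embedding f A A" "is_embedding g A A"
    by (auto simp: automorphisms_def)
  have c: "compose (vertices A) f g \<in> Bij (vertices A)" by (rule compose_Bij[OF bij])
  have "(a, b) \<in> edges A \<longleftrightarrow> (f (g a), f (g b)) \<in> edges A"
    if "a \<in> vertices A" "b \<in> vertices A" for a b
    using emb that unfolding is_embedding_def by blast
  then have "is_embedding (compose (vertices A) f g) A A"
    using c unfolding is_embedding_def by (simp add: Bij_def bij_betw_def compose_eq)
  with bij c show "f \<otimes>\<^bsub>BijGroup (vertices A)\<^esub> g \<in> automorphisms A"
    by (simp add: automorphisms_def BijGroup_def)
next
  show "\<one>\<^bsub>BijGroup (vertices A)\<^esub> \<in> automorphisms A"
    by (auto simp: automorphisms_def BijGroup_def is_embedding_def id_Bij)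
next
  fix f assume f: "f \<in> automorphisms A"
  let ?g = "restrict (inv_into (vertices A) f) (vertices A)"
  have bij: "f \<in> Bij (vertices A)" and "bij_betw f (vertices A) (vertices A)"
    using f by (auto simp: automorphisms_def Bij_def)
  have g: "?g \<in> Bij (vertices A)" by (rule restrict_inv_into_Bij[OF bij])
  then have gb: "bij_betw ?g (vertices A) (vertices A)" by (simp add: Bij_def)
  have fg: "f (?g x) = x" and gm: "?g x \<in> vertices A" if "x \<in> vertices A" for x
    using that \<open>bij_betw f _ _\<close> gb
    by (auto simp: bij_betw_inv_into_right dest: bij_betwE)
  have "(a, b) \<in> edges A \<longleftrightarrow> (?g a, ?g b) \<in> edges A"
    if "a \<in> vertices A" "b \<in> vertices A" for a b
  proof -
    have "(?g a, ?g b) \<in> edges A \<longleftrightarrow> (f (?g a), f (?g b)) \<in> edges A"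
      using f gm[OF that(1)] gm[OF that(2)]
      unfolding automorphisms_def is_embedding_def by blast
    then show ?thesis by (simp only: fg[OF that(1)] fg[OF that(2)])
  qed
  then have "is_embedding ?g A A"
    using gb unfolding is_embedding_def bij_betw_def by blast
  with g show "inv\<^bsub>BijGroup (vertices A)\<^esub> f \<in> automorphisms A"
    by (simp add: inv_BijGroup[OF bij] automorphisms_def)
qed

lemma group_Aut: "group (Aut A)"
  unfolding Aut_def
  by (rule subgroup.subgroup_is_group[OF subgroup_automorphisms group_BijGroup])

end

theory Submission
  imports Defs
    "HOL-Library.FuncSet"
    "HOL-Library.Countable_Set"
    "HOL-Library.Numeral_Type"
    "HOL-Combinatorics.Permutations"
begin

text \<open>
  Part (a). Give each vertex \<open>x\<close> of \<open>A\<close> all functions \<open>\<chi>\<close> from \<open>A\<close> to the integers modulo 3 as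
  labels, and put an edge from \<open>(x, \<chi>)\<close> to \<open>(y, \<xi>)\<close> iff \<open>\<xi> x = \<chi> y + 1\<close>. Every partial isomorphism of
  \<open>A\<close> extends to an automorphism of this finite digraph \<open>B\<close>: extend it to a permutation of \<open>A\<close> and
  correct the labels by symmetric constants. New tournaments in \<open>B\<close> are destroyed by a second
  labelling: over each vertex set \<open>M\<close> of \<open>B\<close> that does not embed into \<open>A\<close>, adjacent vertices must
  carry different values below \<open>card M - 1\<close>, which is impossible for a tournament over \<open>M\<close>, but
  possible for the proper subset of \<open>M\<close> that lies in \<open>A\<close>.

  Part (b). By (a) and free amalgamation, generic tuples of automorphisms exist, any two of them
  with the same action on a finite invariant set are conjugate over that set, and they extend
  generically. A subgroup \<open>H\<close> of small index meets every countable intersection of dense open sets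
  near the identity, since otherwise a perfect tree gives continuum many cosets. If \<open>H\<close> were
  not open, one could build a binary tree of generic tuples whose two extensions at each node,
  one inside and one outside \<open>H\<close>, are conjugate by an element commuting with the tuple so far and
  close to the identity. The infinite products of these conjugators along the branches are
  continuum many elements in distinct cosets of \<open>H\<close>.
\<close>

section \<open>Extension of partial isomorphisms\<close>

text \<open>The difference \<open>\<xi> x - \<chi> y\<close> has three possible values because two
  vertices can be related in three ways: by an edge, by the reverse edge, or not at all. Edges are
  read off the labels instead of being copied from \<open>A\<close>, so that every permutation of
  the vertices, not only an automorphism, acts on the labelled digraph. The price is that
  tournaments may appear that \<open>A\<close> omits; hence the second labelling.

  In the second half the obstacle is that a conjugator chosen at a late stage could spoil what
  earlier stages achieved. This is why the tuple gains one coordinate per stage: later conjugators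
  commute with all earlier coordinates, so the product along a whole branch acts on the coordinate
  \<open>n\<close> by conjugation exactly as its partial product at stage \<open>n + 1\<close> does.
  If two branches first part at \<open>n\<close>, the quotient of their products conjugates an
  element outside \<open>H\<close> to an element of \<open>H\<close>, and so cannot lie in
  \<open>H\<close>. This is the method of ample generics.\<close>

text \<open>The prescribed part matches sets of equal size, so their complements also have equal
  size. Three objects come from here: the permutation of the vertices of \<open>A\<close>, the
  permutations of the values in the second labelling, and the renaming that places \<open>A\<close>
  inside the final digraph.\<close>

lemma extend_to_bij_betw:
  assumes "finite S" "finite T" "card S = card T"
    and "inj_on f X" "f ` X \<subseteq> S" "inj_on g X" "g ` X \<subseteq> T"
  shows "\<exists>\<pi>. bij_betw \<pi> S T \<and> (\<forall>x\<in>X. \<pi> (f x) = g x)"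
proof -
  have "card (f ` X) = card (g ` X)" using assms by (simp add: card_image)
  then have "card (S - f ` X) = card (T - g ` X)"
    using assms by (simp add: card_Diff_subset finite_subset)
  then obtain r where r: "bij_betw r (S - f ` X) (T - g ` X)"
    using assms finite_same_card_bij by (metis finite_Diff)
  let ?q = "g \<circ> inv_into X f"
  let ?\<pi> = "\<lambda>y. if y \<in> f ` X then ?q y else r y"
  have "bij_betw ?q (f ` X) (g ` X)"
    by (rule bij_betw_trans[of _ _ X])
      (use assms in \<open>simp_all add: bij_betw_inv_into inj_on_imp_bij_betw\<close>)
  then have "bij_betw ?\<pi> (f ` X) (g ` X)"
    by (rule iffD1[OF bij_betw_cong, rotated]) auto
  moreover have "bij_betw ?\<pi> (S - f ` X) (T - g ` X)"
    by (rule iffD1[OF bij_betw_cong r]) auto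
  ultimately have "bij_betw ?\<pi> (f ` X \<union> (S - f ` X)) (g ` X \<union> (T - g ` X))"
    by (rule bij_betw_combine) auto
  moreover have "f ` X \<union> (S - f ` X) = S" "g ` X \<union> (T - g ` X) = T" using assms by auto
  ultimately have "bij_betw ?\<pi> S T" by simp
  moreover have "\<forall>x\<in>X. ?\<pi> (f x) = g x" using assms by simp
  ultimately show ?thesis by blast
qed

lemma automorphisms_restrictI:
  assumes "finite (vertices A)" "inj_on f (vertices A)" "f ` vertices A \<subseteq> vertices A"
    and "\<And>a b. a \<in> vertices A \<Longrightarrow> b \<in> vertices A \<Longrightarrow> (a, b) \<in> edges A \<longleftrightarrow> (f a, f b) \<in> edges A"
  shows "restrict f (vertices A) \<in> automorphisms A"
proof -
  have "f ` vertices A = vertices A" using assms endo_inj_surj by blast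
  then have "bij_betw f (vertices A) (vertices A)" using assms(2) by (simp add: bij_betw_def)
  then show ?thesis using assms
    by (auto simp: automorphisms_def Bij_def is_embedding_def inj_on_def)
qed

lemma is_digraph_asym: "is_digraph A \<Longrightarrow> (a, b) \<in> edges A \<Longrightarrow> (b, a) \<notin> edges A"
  by (auto simp: is_digraph_def asym_iff)

lemma is_digraph_irrefl: "is_digraph A \<Longrightarrow> (a, a) \<notin> edges A"
  by (auto simp: is_digraph_def irrefl_def)

section \<open>Labels modulo three\<close>

text \<open>As a function of its second argument this is the label that \<open>x\<close> carries in
  the copy of \<open>A\<close> inside the labelled digraph.\<close>

definition orientation :: "'a digraph \<Rightarrow> 'a \<Rightarrow> 'a \<Rightarrow> 3" where
  "orientation A x y = (if (x, y) \<in> edges A then 1 else if (y, x) \<in> edges A then -1 else 0)"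

text \<open>Labels live in the three-element ring. There \<open>-1 - 1 = 1\<close>, so
  \<open>orientation A y x = orientation A x y + 1\<close> holds exactly if \<open>(x, y)\<close> is an edge. Adding to the
  labels of \<open>y\<close> at \<open>x\<close> and of \<open>x\<close> at \<open>y\<close> the same constant preserves all edges of
  \<open>valued A\<close>; this freedom is what extends partial isomorphisms.\<close>

definition valued :: "'a digraph \<Rightarrow> ('a \<times> ('a \<Rightarrow> 3)) digraph" where
  "valued A = \<lparr>vertices = vertices A \<times> (vertices A \<rightarrow>\<^sub>E UNIV),
     edges = {((x, \<chi>), (y, \<xi>)). x \<in> vertices A \<and> y \<in> vertices A \<and>
       \<chi> \<in> vertices A \<rightarrow>\<^sub>E UNIV \<and> \<xi> \<in> vertices A \<rightarrow>\<^sub>E UNIV \<and> \<xi> x = \<chi> y + 1}\<rparr>"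

lemma is_digraph_valued: "is_digraph (valued A)"
proof -
  have "\<xi> = \<chi> + 1 \<Longrightarrow> \<chi> \<noteq> \<xi> + 1" for \<xi> \<chi> :: 3
  proof -
    \<comment> \<open>Opposite edges would give \<open>\<xi> = \<xi> + 1 + 1\<close>, which is why
      two labels would not do.\<close>
    have "(1::3) + 1 \<noteq> 0" by simp
    then show "\<xi> = \<chi> + 1 \<Longrightarrow> \<chi> \<noteq> \<xi> + 1" by (metis add.assoc add_cancel_left_right)
  qed
  then show ?thesis
    by (auto simp: is_digraph_def valued_def irrefl_def asym_iff)
qed

lemma finite_valued: "finite (vertices A) \<Longrightarrow> finite (vertices (valued A))"
  by (auto simp: valued_def intro!: finite_PiE)

lemma is_embedding_valued:
  assumes "is_digraph A"
  shows "is_embedding (\<lambda>x. (x, restrict (orientation A x) (vertices A))) A (valued A)"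
proof -
  have "(x, y) \<in> edges A \<longleftrightarrow> orientation A y x = orientation A x y + 1" for x y
    using is_digraph_asym[OF assms, of x y] by (auto simp: orientation_def)
  then show ?thesis
    by (auto simp: is_embedding_def valued_def inj_on_def)
qed

lemma orientation_partial_iso:
  assumes "partial_iso A p" "x \<in> dom p" "y \<in> dom p"
  shows "orientation A (the (p x)) (the (p y)) = orientation A x y"
  using assms by (simp add: partial_iso_def orientation_def)

text \<open>Reading each label at the preimage of a vertex makes any permutation act on the labelled
  digraph. The added shifts \<open>c\<close> carry the distinguished label of each \<open>a\<close>
  in \<open>dom p\<close> to that of its image, and their symmetry makes them cancel in the edge
  condition.\<close>

lemma valued_extends:
  assumes A: "is_digraph A" "finite (vertices A)" and p: "partial_iso A p"
  shows "\<exists>f \<in> automorphisms (valued A). \<forall>a\<in>dom p.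
     f (a, restrict (orientation A a) (vertices A)) =
     (the (p a), restrict (orientation A (the (p a))) (vertices A))"
proof -
  let ?V = "vertices A"
  have dom: "dom p \<subseteq> ?V" "(\<lambda>a. the (p a)) ` dom p \<subseteq> ?V" "inj_on (\<lambda>a. the (p a)) (dom p)"
    using p by (auto simp: partial_iso_def ran_def inj_on_def dom_def)
  obtain \<phi> where \<phi>: "bij_betw \<phi> ?V ?V" "\<And>a. a \<in> dom p \<Longrightarrow> \<phi> a = the (p a)"
    using extend_to_bij_betw[OF A(2) A(2) refl, of id "dom p" "\<lambda>a. the (p a)"] dom by auto
  define \<psi> where "\<psi> = inv_into ?V \<phi>"
  have \<psi>: "\<phi> (\<psi> x) = x" "\<psi> (\<phi> x) = x" "\<psi> x \<in> ?V" "\<phi> x \<in> ?V" if "x \<in> ?V" for x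
    using \<phi>(1) that unfolding \<psi>_def
    by (auto simp: bij_betw_inv_into_right bij_betw_inv_into_left bij_betwE
        bij_betwE[OF bij_betw_inv_into[OF \<phi>(1)]])
  \<comment> \<open>For \<open>x\<close> in \<open>dom p\<close> the first branch is forced, since
    the label of \<open>x\<close> must become that of \<open>\<phi> x\<close>. The second branch
    mirrors it for the sake of symmetry. A conflict is possible only if both vertices lie in
    \<open>dom p\<close>; there both shifts vanish because \<open>p\<close> preserves the
    relation.\<close>
  define c where "c x y = (if x \<in> dom p then orientation A (\<phi> x) (\<phi> y) - orientation A x y
     else if y \<in> dom p then orientation A (\<phi> y) (\<phi> x) - orientation A y x else 0)" for x y
  have c_sym: "c x y = c y x" for x y
    using orientation_partial_iso[OF p] \<phi>(2) by (auto simp: c_def)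
  define F where "F = (\<lambda>(x, \<chi>). (\<phi> x, \<lambda>z\<in>?V. \<chi> (\<psi> z) + c x (\<psi> z)))"
  have 1: "inj_on F (vertices (valued A))"
  proof (rule inj_onI, clarify)
    fix x \<chi> y \<xi> assume *: "(x, \<chi>) \<in> vertices (valued A)" "(y, \<xi>) \<in> vertices (valued A)"
      "F (x, \<chi>) = F (y, \<xi>)"
    then have V: "x \<in> ?V" "y \<in> ?V" "\<chi> \<in> ?V \<rightarrow>\<^sub>E UNIV" "\<xi> \<in> ?V \<rightarrow>\<^sub>E UNIV" by (auto simp: valued_def)
    have xy: "x = y" using *(3) V bij_betw_imp_inj_on[OF \<phi>(1)] by (simp add: F_def inj_onD)
    have eq: "(\<lambda>z\<in>?V. \<chi> (\<psi> z) + c x (\<psi> z)) = (\<lambda>z\<in>?V. \<xi> (\<psi> z) + c x (\<psi> z))"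
      using *(3) xy by (simp add: F_def)
    have "\<chi> z = \<xi> z" if z: "z \<in> ?V" for z
      using fun_cong[OF eq, of "\<phi> z"] \<psi>[OF z] by simp
    then have "\<chi> = \<xi>" using PiE_ext[OF V(3,4)] by blast
    with xy show "x = y \<and> \<chi> = \<xi>" by simp
  qed
  have 2: "F ` vertices (valued A) \<subseteq> vertices (valued A)"
    using \<psi> by (auto simp: valued_def F_def)
  have 3: "(u, v) \<in> edges (valued A) \<longleftrightarrow> (F u, F v) \<in> edges (valued A)"
    if "u \<in> vertices (valued A)" "v \<in> vertices (valued A)" for u v
  proof -
    obtain x \<chi> y \<xi> where uv: "u = (x, \<chi>)" "v = (y, \<xi>)" by (metis surj_pair)
    with that have V: "x \<in> ?V" "y \<in> ?V" "\<chi> \<in> ?V \<rightarrow>\<^sub>E UNIV" "\<xi> \<in> ?V \<rightarrow>\<^sub>E UNIV"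
      by (auto simp: valued_def)
    have "\<xi> x + c y x = \<chi> y + c x y + 1 \<longleftrightarrow> \<xi> x = \<chi> y + 1"
      by (simp add: c_sym[of x y] algebra_simps)
    then show ?thesis using V \<psi> by (simp add: uv valued_def F_def)
  qed
  let ?f = "restrict F (vertices (valued A))"
  have "?f (a, restrict (orientation A a) ?V) =
     (the (p a), restrict (orientation A (the (p a))) ?V)" if a: "a \<in> dom p" for a
  proof -
    have aV: "a \<in> ?V" using a dom by auto
    have "orientation A a (\<psi> z) + c a (\<psi> z) = orientation A (\<phi> a) z" if "z \<in> ?V" for z
      using a \<psi>[OF that] by (simp add: c_def)
    then show ?thesis using aV a \<psi> \<phi>(2)[OF a]
      by (auto simp: F_def valued_def fun_eq_iff)
  qed
  then show ?thesis
    using automorphisms_restrictI[OF finite_valued[OF A(2)] 1 2 3] by blast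
qed

section \<open>Removing the new tournaments\<close>

lemma vertices_induced [simp]: "vertices (induced A S) = S"
  and edges_induced [simp]: "edges (induced A S) = edges A \<inter> S \<times> S"
  by (simp_all add: induced_def)

lemma embeds_trans: "embeds A B \<Longrightarrow> embeds B C \<Longrightarrow> embeds A C"
proof -
  assume "embeds A B" "embeds B C"
  then obtain f g where "is_embedding f A B" "is_embedding g B C" by (auto simp: embeds_def)
  then have "is_embedding (g \<circ> f) A C"
    unfolding is_embedding_def by (auto simp: image_subset_iff inj_on_def)
  then show "embeds A C" by (auto simp: embeds_def)
qed

lemma embeds_induced_image:
  assumes "is_embedding f A B" "S \<subseteq> vertices A"
  shows "embeds (induced A S) (induced B (f ` S))" "embeds (induced B (f ` S)) (induced A S)"
proof -
  have inj: "inj_on f S" using assms inj_on_subset by (auto simp: is_embedding_def)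
  show "embeds (induced A S) (induced B (f ` S))"
    unfolding embeds_def using assms inj
    by (intro exI[of _ f]) (auto simp: is_embedding_def)
  have "inv_into S f (f a) = a" if "a \<in> S" for a using inj that by simp
  then show "embeds (induced B (f ` S)) (induced A S)"
    unfolding embeds_def using assms inj
    by (intro exI[of _ "inv_into S f"]) (auto simp: is_embedding_def inj_on_inv_into)
qed

lemma embeds_induced: "embeds (induced A (vertices A)) A"
  unfolding embeds_def by (intro exI[of _ id]) (auto simp: is_embedding_def)

text \<open>Sets of vertices of \<open>B\<close> over which no tournament may survive.\<close>

definition bad_sets :: "'a digraph \<Rightarrow> 'b digraph \<Rightarrow> 'b set set" where
  "bad_sets A B = {M. M \<subseteq> vertices B \<and> \<not> embeds (induced B M) A}"

text \<open>One value fewer than a finite \<open>M\<close> has points: too few for an injective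
  labelling of \<open>M\<close>, enough for one of a proper subset. A bad set is never empty,
  because the empty digraph embeds in \<open>A\<close>; so the subtraction does not truncate
  there.\<close>

definition bad_values :: "'a digraph \<Rightarrow> 'b digraph \<Rightarrow> 'b \<Rightarrow> ('b set \<Rightarrow> nat) set" where
  "bad_values A B x = (\<Pi>\<^sub>E M\<in>{M \<in> bad_sets A B. x \<in> M}. {..<card M - 1})"

text \<open>Edges project to edges of \<open>B\<close>, while an edge of \<open>B\<close> may be
  lost between two given vertices above it. Hence a tournament projects injectively if
  \<open>B\<close> is a digraph, and all its pairs must carry different values. The name alludes to
  faithfulness for irreducible structures: a digraph that is not a free amalgam of proper
  substructures is a tournament.\<close>

definition faithful :: "'a digraph \<Rightarrow> 'b digraph \<Rightarrow> ('b \<times> ('b set \<Rightarrow> nat)) digraph" where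
  "faithful A B = \<lparr>vertices = (SIGMA x:vertices B. bad_values A B x),
     edges = {((x, \<chi>), (y, \<xi>)). (x, y) \<in> edges B \<and>
       \<chi> \<in> bad_values A B x \<and> \<xi> \<in> bad_values A B y \<and>
       (\<forall>M\<in>bad_sets A B. x \<in> M \<longrightarrow> y \<in> M \<longrightarrow> \<chi> M \<noteq> \<xi> M)}\<rparr>"

lemma is_digraph_faithful: "is_digraph B \<Longrightarrow> is_digraph (faithful A B)"
  by (auto simp: is_digraph_def faithful_def irrefl_def asym_iff)

lemma finite_bad_sets: "finite (vertices B) \<Longrightarrow> finite (bad_sets A B)"
  by (auto simp: bad_sets_def intro: finite_subset[of _ "Pow (vertices B)"])

lemma finite_faithful: "finite (vertices B) \<Longrightarrow> finite (vertices (faithful A B))"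
  by (auto simp: faithful_def bad_values_def finite_bad_sets intro!: finite_SigmaI finite_PiE)

text \<open>A tournament in \<open>faithful A B\<close> over a bad set \<open>M\<close> would need \<open>card M\<close> distinct values
  below \<open>card M - 1\<close>.\<close>

lemma tournament_embeds_faithful:
  assumes A: "is_digraph B" "finite (vertices B)" and T: "is_tournament T" "embeds T (faithful A B)"
  shows "embeds T A"
proof -
  let ?V = "vertices T"
  obtain h where h: "is_embedding h T (faithful A B)" using T by (auto simp: embeds_def)
  define x where "x t = fst (h t)" for t
  define \<chi> where "\<chi> t = snd (h t)" for t
  have h_eq: "h t = (x t, \<chi> t)" for t by (simp add: x_def \<chi>_def)
  have mem: "x t \<in> vertices B" "\<chi> t \<in> bad_values A B (x t)" if "t \<in> ?V" for t
    using h that by (auto simp: is_embedding_def faithful_def h_eq image_subset_iff)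
  have edge: "(x s, x t) \<in> edges B"
    and neq: "\<And>M. M \<in> bad_sets A B \<Longrightarrow> x s \<in> M \<Longrightarrow> x t \<in> M \<Longrightarrow> \<chi> s M \<noteq> \<chi> t M" if "(s, t) \<in> edges T" for s t
  proof -
    have "(h s, h t) \<in> edges (faithful A B)" using h that T(1)
      unfolding is_embedding_def is_tournament_def is_digraph_def by blast
    then show "(x s, x t) \<in> edges B"
      "\<And>M. M \<in> bad_sets A B \<Longrightarrow> x s \<in> M \<Longrightarrow> x t \<in> M \<Longrightarrow> \<chi> s M \<noteq> \<chi> t M" by (auto simp: faithful_def h_eq)
  qed
  have tour: "(s, t) \<in> edges T \<or> (t, s) \<in> edges T" if "s \<in> ?V" "t \<in> ?V" "s \<noteq> t" for s t
    using T(1) that by (auto simp: is_tournament_def)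
  have inj: "inj_on x ?V"
    using tour edge is_digraph_irrefl[OF A(1)] by (metis inj_onI)
  have emb: "is_embedding x T B"
    unfolding is_embedding_def
  proof (intro conjI ballI)
    fix s t assume st: "s \<in> ?V" "t \<in> ?V"
    show "(s, t) \<in> edges T \<longleftrightarrow> (x s, x t) \<in> edges B"
      using edge tour[OF st] is_digraph_asym[OF A(1)] is_digraph_irrefl[OF A(1)] by metis
  qed (use inj mem in auto)
  let ?M = "x ` ?V"
  have TM: "embeds T (induced B ?M)"
    unfolding embeds_def using emb by (intro exI[of _ x]) (auto simp: is_embedding_def)
  show ?thesis
  proof (cases "?M \<in> bad_sets A B")
    case False
    then have "embeds (induced B ?M) A" using mem by (auto simp: bad_sets_def)
    with TM show ?thesis by (rule embeds_trans)
  next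
    case True
    have fin: "finite ?V" using inj mem A(2) by (metis finite_imageD finite_subset image_subsetI)
    have "inj_on (\<lambda>t. \<chi> t ?M) ?V"
    proof (rule inj_onI, rule ccontr)
      fix s t assume *: "s \<in> ?V" "t \<in> ?V" "\<chi> s ?M = \<chi> t ?M" "s \<noteq> t"
      from tour[OF *(1,2,4)] show False
        using neq[OF _ True, of s t] neq[OF _ True, of t s] * by auto
    qed
    moreover have "(\<lambda>t. \<chi> t ?M) ` ?V \<subseteq> {..<card ?M - 1}"
      using mem(2) True unfolding bad_values_def by (fastforce dest: PiE_mem)
    ultimately have "card ?V \<le> card ?M - 1"
      by (metis card_inj_on_le card_lessThan finite_lessThan)
    \<comment> \<open>A number that is at most its truncated predecessor is zero; the empty
      tournament embeds trivially.\<close>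
    then have "card ?V = 0" using inj by (simp add: card_image)
    then have "?V = {}" using fin by simp
    then show ?thesis by (simp add: embeds_def is_embedding_def)
  qed
qed

text \<open>A bad set \<open>M\<close> is not contained in the copy of \<open>A\<close>, or it would
  embed into \<open>A\<close>. So the part of \<open>M\<close> in the copy is proper, and
  \<open>\<iota> M\<close> can give its points distinct values below \<open>card M - 1\<close>. An
  automorphism of \<open>B\<close> permutes the bad sets and preserves their sizes; it lifts once
  the values over \<open>M\<close> are carried bijectively to those over its image.\<close>

lemma faithful_embedding:
  assumes A: "is_digraph A" "finite (vertices A)" "finite (vertices B)" and e: "is_embedding e A B"
  shows "\<exists>k. is_embedding k A (faithful A B) \<and>
     (\<forall>p \<phi>. partial_iso A p \<longrightarrow> \<phi> \<in> automorphisms B \<longrightarrow> (\<forall>a\<in>dom p. \<phi> (e a) = e (the (p a))) \<longrightarrow>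
        (\<exists>f\<in>automorphisms (faithful A B). \<forall>a\<in>dom p. f (k a) = k (the (p a))))"
proof -
  let ?\<B> = "bad_sets A B" and ?A = "e ` vertices A"
  have eA: "?A \<subseteq> vertices B" and e_inj: "inj_on e (vertices A)" using e by (auto simp: is_embedding_def)
  have "\<exists>r. inj_on r (M \<inter> ?A) \<and> r ` (M \<inter> ?A) \<subseteq> {..<card M - 1}" if M: "M \<in> ?\<B>" for M
  proof -
    have finM: "finite M" using M A(3) finite_subset by (auto simp: bad_sets_def)
    have "\<not> M \<subseteq> ?A"
    proof
      assume "M \<subseteq> ?A"
      then obtain S where S: "S \<subseteq> vertices A" "M = e ` S" by (auto simp: subset_image_iff)
      have "embeds (induced A S) A" using S
        unfolding embeds_def by (intro exI[of _ id]) (auto simp: is_embedding_def)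
      then have "embeds (induced B M) A" using embeds_induced_image(2)[OF e S(1)] S(2) embeds_trans by blast
      then show False using M by (simp add: bad_sets_def)
    qed
    then have "card (M \<inter> ?A) < card M" using finM by (intro psubset_card_mono) auto
    then have "card (M \<inter> ?A) \<le> card {..<card M - 1}" by simp
    then show ?thesis using finM by (metis card_le_inj finite_Int finite_lessThan)
  qed
  then obtain \<iota> where \<iota>: "\<And>M. M \<in> ?\<B> \<Longrightarrow> inj_on (\<iota> M) (M \<inter> ?A)"
      "\<And>M. M \<in> ?\<B> \<Longrightarrow> \<iota> M ` (M \<inter> ?A) \<subseteq> {..<card M - 1}" by metis
  define k where "k a = (e a, \<lambda>M\<in>{M \<in> ?\<B>. e a \<in> M}. \<iota> M (e a))" for a
  have k_val: "snd (k a) \<in> bad_values A B (e a)" if "a \<in> vertices A" for a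
    using \<iota>(2) that by (auto simp: k_def bad_values_def image_subset_iff)
  have "is_embedding k A (faithful A B)"
    unfolding is_embedding_def
  proof (intro conjI ballI)
    show "inj_on k (vertices A)" using e_inj by (auto simp: k_def inj_on_def)
    show "k ` vertices A \<subseteq> vertices (faithful A B)"
      using eA k_val by (auto simp: faithful_def k_def)
    fix a b assume ab: "a \<in> vertices A" "b \<in> vertices A"
    have *: "(a, b) \<in> edges A \<longleftrightarrow> (e a, e b) \<in> edges B" using e ab by (auto simp: is_embedding_def)
    have "\<iota> M (e a) \<noteq> \<iota> M (e b)" if "(a, b) \<in> edges A" "M \<in> ?\<B>" "e a \<in> M" "e b \<in> M" for M
    proof -
      have "a \<noteq> b" using that is_digraph_irrefl[OF A(1)] by blast
      then have "e a \<noteq> e b" using e_inj ab by (meson inj_onD)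
      then show ?thesis using \<iota>(1)[OF that(2)] that ab by (auto dest: inj_onD)
    qed
    then show "(a, b) \<in> edges A \<longleftrightarrow> (k a, k b) \<in> edges (faithful A B)"
      using * k_val ab by (auto simp: faithful_def k_def)
  qed
  moreover have "\<exists>f\<in>automorphisms (faithful A B). \<forall>a\<in>dom p. f (k a) = k (the (p a))"
    if p: "partial_iso A p" and \<phi>: "\<phi> \<in> automorphisms B"
      and ext: "\<forall>a\<in>dom p. \<phi> (e a) = e (the (p a))" for p \<phi>
  proof -
    let ?V = "vertices B" and ?pre = "\<lambda>N. {x \<in> vertices B. \<phi> x \<in> N}"
    have dom: "dom p \<subseteq> vertices A" "\<And>a. a \<in> dom p \<Longrightarrow> the (p a) \<in> vertices A"
      using p by (auto simp: partial_iso_def ran_def)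
    have bij: "bij_betw \<phi> ?V ?V" and emb: "is_embedding \<phi> B B"
      using \<phi> by (auto simp: automorphisms_def Bij_def)
    have inj: "inj_on \<phi> ?V" and \<phi>V: "\<And>x. x \<in> ?V \<Longrightarrow> \<phi> x \<in> ?V"
      using bij by (auto simp: bij_betw_def)
    have image: "\<phi> ` M \<in> ?\<B>" "card (\<phi> ` M) = card M" if "M \<in> ?\<B>" for M
    proof -
      have M: "M \<subseteq> ?V" using that by (simp add: bad_sets_def)
      show "\<phi> ` M \<in> ?\<B>" using that \<phi>V embeds_trans[OF embeds_induced_image(1)[OF emb M]]
        unfolding bad_sets_def by blast
      show "card (\<phi> ` M) = card M" using inj M by (meson card_image inj_on_subset)
    qed
    have pre: "?pre N \<in> ?\<B>" "\<phi> ` ?pre N = N" if "N \<in> ?\<B>" for N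
    proof -
      have "N \<subseteq> \<phi> ` ?V" using that bij by (auto simp: bad_sets_def bij_betw_def)
      then show im: "\<phi> ` ?pre N = N" by auto
      show "?pre N \<in> ?\<B>" using that embeds_trans[OF embeds_induced_image(2)[OF emb, of "?pre N"], of A] im
        by (auto simp: bad_sets_def)
    qed
    have pre_image: "?pre (\<phi> ` M) = M" if "M \<subseteq> ?V" for M
      using that inj by (auto dest: inj_onD)
    \<comment> \<open>One permutation per bad set, shared by all vertices over it, preserves whether
      two values are equal. It is prescribed only on the values that \<open>\<iota>\<close> gives to
      the copy of \<open>dom p\<close>; injectivity of \<open>\<iota>\<close> on \<open>M\<close>
      and on its image makes the prescription consistent.\<close>
    have "\<exists>\<pi>. bij_betw \<pi> {..<card M - 1} {..<card M - 1} \<and>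
        (\<forall>m\<in>M \<inter> e ` dom p. \<pi> (\<iota> M m) = \<iota> (\<phi> ` M) (\<phi> m))" if M: "M \<in> ?\<B>" for M
    proof (rule extend_to_bij_betw)
      let ?X = "M \<inter> e ` dom p"
      have X: "?X \<subseteq> M \<inter> ?A" using dom by auto
      have \<phi>X: "\<phi> ` ?X \<subseteq> \<phi> ` M \<inter> ?A" using dom(2) ext by (auto intro!: imageI simp del: not_None_eq)
      show "inj_on (\<iota> M) ?X" using \<iota>(1)[OF M] X by (rule inj_on_subset)
      show "\<iota> M ` ?X \<subseteq> {..<card M - 1}" using \<iota>(2)[OF M] X by blast
      have "inj_on (\<iota> (\<phi> ` M)) (\<phi> ` ?X)" using \<iota>(1)[OF image(1)[OF M]] \<phi>X by (rule inj_on_subset)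
      moreover have "inj_on \<phi> ?X" using M by (intro inj_on_subset[OF inj]) (auto simp: bad_sets_def)
      ultimately show "inj_on (\<lambda>m. \<iota> (\<phi> ` M) (\<phi> m)) ?X" using comp_inj_on[of \<phi> ?X "\<iota> (\<phi> ` M)"] by (simp add: comp_def)
      show "(\<lambda>m. \<iota> (\<phi> ` M) (\<phi> m)) ` ?X \<subseteq> {..<card M - 1}"
        using \<iota>(2)[OF image(1)[OF M]] \<phi>X image(2)[OF M] by (auto simp: image_subset_iff)
    qed auto
    then obtain \<pi> where \<pi>: "\<And>M. M \<in> ?\<B> \<Longrightarrow> bij_betw (\<pi> M) {..<card M - 1} {..<card M - 1}"
      "\<And>M m. M \<in> ?\<B> \<Longrightarrow> m \<in> M \<Longrightarrow> m \<in> e ` dom p \<Longrightarrow> \<pi> M (\<iota> M m) = \<iota> (\<phi> ` M) (\<phi> m)"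
      by (metis (mono_tags, lifting) IntI)
    have \<pi>_inj: "\<pi> M u = \<pi> M v \<longleftrightarrow> u = v" and \<pi>_mem: "\<pi> M u < card M - 1"
      if "M \<in> ?\<B>" "u < card M - 1" "v < card M - 1" for M u v
      using \<pi>(1)[OF that(1)] that by (auto simp: bij_betw_def inj_on_def image_def)
    \<comment> \<open>Each bad set \<open>N\<close> is the image of the bad set
      \<open>?pre N\<close>, so the value stored at \<open>N\<close> is the permuted old value at
      \<open>?pre N\<close>.\<close>
    define F where "F = (\<lambda>(x, \<chi>). (\<phi> x, \<lambda>N\<in>{N \<in> ?\<B>. \<phi> x \<in> N}. \<pi> (?pre N) (\<chi> (?pre N))))"
    let ?W = "vertices (faithful A B)"
    have val: "\<chi> M < card M - 1" if "\<chi> \<in> bad_values A B x" "M \<in> ?\<B>" "x \<in> M" for \<chi> x M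
      using that by (auto simp: bad_values_def dest!: PiE_mem)
    have F_val: "(\<lambda>N\<in>{N \<in> ?\<B>. \<phi> x \<in> N}. \<pi> (?pre N) (\<chi> (?pre N))) \<in> bad_values A B (\<phi> x)"
      if "x \<in> ?V" "\<chi> \<in> bad_values A B x" for x \<chi>
    proof -
      have "\<pi> (?pre N) (\<chi> (?pre N)) < card N - 1" if N: "N \<in> ?\<B>" "\<phi> x \<in> N" for N
      proof -
        have "\<chi> (?pre N) < card (?pre N) - 1"
          using val[OF \<open>\<chi> \<in> _\<close> pre(1)[OF N(1)]] \<open>x \<in> ?V\<close> N by auto
        moreover have "card (?pre N) = card N" using image(2)[OF pre(1)[OF N(1)]] pre(2)[OF N(1)] by simp
        ultimately show ?thesis using \<pi>_mem[OF pre(1)[OF N(1)]] by metis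
      qed
      then show ?thesis by (auto simp: bad_values_def)
    qed
    have 1: "F ` ?W \<subseteq> ?W"
      using F_val \<phi>V by (auto simp: F_def faithful_def)
    have F_at: "(\<lambda>N\<in>{N \<in> ?\<B>. \<phi> x \<in> N}. \<pi> (?pre N) (\<chi> (?pre N))) (\<phi> ` M) = \<pi> M (\<chi> M)"
      if "M \<in> ?\<B>" "x \<in> M" for x \<chi> M
      using image(1)[OF that(1)] that pre_image[of M] by (simp add: bad_sets_def)
    have 2: "inj_on F ?W"
    proof (rule inj_onI, clarify)
      fix x \<chi> y \<xi> assume *: "(x, \<chi>) \<in> ?W" "(y, \<xi>) \<in> ?W" "F (x, \<chi>) = F (y, \<xi>)"
      then have V: "x \<in> ?V" "y \<in> ?V" and B: "\<chi> \<in> bad_values A B x" "\<xi> \<in> bad_values A B y"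
        by (auto simp: faithful_def)
      have xy: "x = y" using *(3) V inj by (simp add: F_def inj_onD)
      have eq: "(\<lambda>N\<in>{N \<in> ?\<B>. \<phi> x \<in> N}. \<pi> (?pre N) (\<chi> (?pre N))) = (\<lambda>N\<in>{N \<in> ?\<B>. \<phi> x \<in> N}. \<pi> (?pre N) (\<xi> (?pre N)))"
        using *(3) xy by (simp add: F_def)
      have "\<chi> M = \<xi> M" if M: "M \<in> {M \<in> ?\<B>. x \<in> M}" for M
        using fun_cong[OF eq, of "\<phi> ` M"] F_at[of M x] M \<pi>_inj val B xy by auto
      then have "\<chi> = \<xi>" using B xy unfolding bad_values_def by (metis (no_types, lifting) PiE_ext)
      with xy show "x = y \<and> \<chi> = \<xi>" by simp
    qed
    have 3: "(u, v) \<in> edges (faithful A B) \<longleftrightarrow> (F u, F v) \<in> edges (faithful A B)"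
      if "u \<in> ?W" "v \<in> ?W" for u v
    proof -
      obtain x \<chi> y \<xi> where uv: "u = (x, \<chi>)" "v = (y, \<xi>)" by (metis surj_pair)
      with that have V: "x \<in> ?V" "y \<in> ?V" and B: "\<chi> \<in> bad_values A B x" "\<xi> \<in> bad_values A B y"
        by (auto simp: faithful_def)
      let ?\<chi> = "\<lambda>N\<in>{N \<in> ?\<B>. \<phi> x \<in> N}. \<pi> (?pre N) (\<chi> (?pre N))"
      let ?\<xi> = "\<lambda>N\<in>{N \<in> ?\<B>. \<phi> y \<in> N}. \<pi> (?pre N) (\<xi> (?pre N))"
      have "(\<forall>M\<in>?\<B>. x \<in> M \<longrightarrow> y \<in> M \<longrightarrow> \<chi> M \<noteq> \<xi> M) \<longleftrightarrow>
          (\<forall>N\<in>?\<B>. \<phi> x \<in> N \<longrightarrow> \<phi> y \<in> N \<longrightarrow> ?\<chi> N \<noteq> ?\<xi> N)"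
      proof (intro iffI ballI impI)
        fix N assume *: "\<forall>M\<in>?\<B>. x \<in> M \<longrightarrow> y \<in> M \<longrightarrow> \<chi> M \<noteq> \<xi> M" and N: "N \<in> ?\<B>" "\<phi> x \<in> N" "\<phi> y \<in> N"
        have P: "?pre N \<in> ?\<B>" "x \<in> ?pre N" "y \<in> ?pre N" using pre N V by auto
        have "\<chi> (?pre N) \<noteq> \<xi> (?pre N)" by (rule *[rule_format, OF P])
        then have "\<pi> (?pre N) (\<chi> (?pre N)) \<noteq> \<pi> (?pre N) (\<xi> (?pre N))"
          by (simp only: \<pi>_inj[OF P(1) val[OF B(1) P(1,2)] val[OF B(2) P(1,3)]] not_False_eq_True)
        then show "?\<chi> N \<noteq> ?\<xi> N" using N by simp
      next
        fix M assume *: "\<forall>N\<in>?\<B>. \<phi> x \<in> N \<longrightarrow> \<phi> y \<in> N \<longrightarrow> ?\<chi> N \<noteq> ?\<xi> N" and M: "M \<in> ?\<B>" "x \<in> M" "y \<in> M"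
        have "?\<chi> (\<phi> ` M) \<noteq> ?\<xi> (\<phi> ` M)"
          by (rule *[rule_format, OF image(1)[OF M(1)]]) (use M in auto)
        then show "\<chi> M \<noteq> \<xi> M" using F_at[OF M(1,2), of \<chi>] F_at[OF M(1,3), of \<xi>] by metis
      qed
      moreover have "(x, y) \<in> edges B \<longleftrightarrow> (\<phi> x, \<phi> y) \<in> edges B"
        using emb V by (auto simp: is_embedding_def)
      ultimately show ?thesis using B F_val V by (simp add: uv F_def faithful_def)
    qed
    have "F (k a) = k (the (p a))" if a: "a \<in> dom p" for a
    proof -
      have aV: "e a \<in> ?V" using a dom eA by auto
      have "\<pi> (?pre N) (\<iota> (?pre N) (e a)) = \<iota> N (\<phi> (e a))" if N: "N \<in> ?\<B>" "\<phi> (e a) \<in> N" for N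
        using \<pi>(2)[OF pre(1)[OF N(1)], of "e a"] pre(2)[OF N(1)] N aV a by simp
      then show ?thesis using ext a pre aV by (auto simp: F_def k_def fun_eq_iff)
    qed
    moreover have "k a \<in> ?W" if "a \<in> dom p" for a
      using that dom eA k_val by (auto simp: faithful_def k_def)
    ultimately show ?thesis
      using automorphisms_restrictI[OF finite_faithful[OF A(3)] 2 1 3]
      by (intro bexI[of _ "restrict F ?W"]) auto
  qed
  ultimately show ?thesis by blast
qed

section \<open>Transport of structure and the extension property\<close>

definition map_digraph :: "('a \<Rightarrow> 'b) \<Rightarrow> 'a digraph \<Rightarrow> 'b digraph" where
  "map_digraph h A = \<lparr>vertices = h ` vertices A, edges = map_prod h h ` edges A\<rparr>"

lemma vertices_map_digraph [simp]: "vertices (map_digraph h A) = h ` vertices A"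
  by (simp add: map_digraph_def)

lemma edges_map_digraph:
  assumes "is_digraph A" "inj_on h (vertices A)" "a \<in> vertices A" "b \<in> vertices A"
  shows "(h a, h b) \<in> edges (map_digraph h A) \<longleftrightarrow> (a, b) \<in> edges A"
proof
  assume "(h a, h b) \<in> edges (map_digraph h A)"
  then obtain c d where cd: "(c, d) \<in> edges A" "h a = h c" "h b = h d"
    by (auto simp: map_digraph_def)
  then have "c \<in> vertices A" "d \<in> vertices A" using assms(1) by (auto simp: is_digraph_def)
  then have "a = c" "b = d" using cd assms by (auto dest: inj_onD)
  then show "(a, b) \<in> edges A" using cd by simp
qed (auto simp: map_digraph_def intro!: image_eqI[of _ _ "(a, b)"])

lemma is_embedding_map_digraph:
  assumes "is_digraph A" "inj_on h (vertices A)"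
  shows "is_embedding h A (map_digraph h A)"
  using assms by (simp add: is_embedding_def edges_map_digraph)

lemma is_digraph_map_digraph:
  assumes "is_digraph A" "inj_on h (vertices A)"
  shows "is_digraph (map_digraph h A)"
proof -
  have "edges (map_digraph h A) \<subseteq> h ` vertices A \<times> h ` vertices A"
    using assms(1) by (auto simp: map_digraph_def is_digraph_def)
  moreover from this have "(u, v) \<notin> edges (map_digraph h A)" if "(v, u) \<in> edges (map_digraph h A)" for u v
    using that edges_map_digraph[OF assms] is_digraph_asym[OF assms(1)]
    by (smt (verit) imageE mem_Sigma_iff subsetD)
  ultimately show ?thesis unfolding is_digraph_def by (auto simp: irrefl_def asym_iff)
qed

lemma map_digraph_embeds:
  assumes "is_digraph A" "inj_on h (vertices A)"
  shows "embeds (map_digraph h A) A"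
  unfolding embeds_def is_embedding_def
proof (intro exI[of _ "inv_into (vertices A) h"] conjI ballI)
  fix u v assume uv: "u \<in> vertices (map_digraph h A)" "v \<in> vertices (map_digraph h A)"
  then obtain a b where "a \<in> vertices A" "b \<in> vertices A" "u = h a" "v = h b" by auto
  then show "(u, v) \<in> edges (map_digraph h A) \<longleftrightarrow>
      (inv_into (vertices A) h u, inv_into (vertices A) h v) \<in> edges A"
    using edges_map_digraph[OF assms] assms(2) by simp
qed (use assms in \<open>auto simp: inj_on_inv_into\<close>)

lemma automorphism_map_digraph:
  assumes A: "is_digraph A" "finite (vertices A)" "inj_on h (vertices A)" and f: "f \<in> automorphisms A"
  shows "\<exists>f' \<in> automorphisms (map_digraph h A). \<forall>a\<in>vertices A. f' (h a) = h (f a)"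
proof -
  let ?F = "h \<circ> f \<circ> inv_into (vertices A) h"
  have F: "?F (h a) = h (f a)" if "a \<in> vertices A" for a using that A(3) by simp
  have f': "f a \<in> vertices A" if "a \<in> vertices A" for a
    using f that by (auto simp: automorphisms_def is_embedding_def)
  have inj: "inj_on f (vertices A)" and edge: "\<And>a b. a \<in> vertices A \<Longrightarrow> b \<in> vertices A \<Longrightarrow>
      (a, b) \<in> edges A \<longleftrightarrow> (f a, f b) \<in> edges A"
    using f by (auto simp: automorphisms_def is_embedding_def)
  have "restrict ?F (vertices (map_digraph h A)) \<in> automorphisms (map_digraph h A)"
  proof (rule automorphisms_restrictI)
    show "inj_on ?F (vertices (map_digraph h A))"
    proof (rule inj_onI)
      fix u v assume uv: "u \<in> vertices (map_digraph h A)" "v \<in> vertices (map_digraph h A)" "?F u = ?F v"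
      then obtain a b where ab: "a \<in> vertices A" "b \<in> vertices A" "u = h a" "v = h b" by auto
      then have "h (f a) = h (f b)" using uv F by metis
      then have "a = b" using ab f' inj A(3) by (meson inj_onD)
      then show "u = v" using ab by simp
    qed
    fix u v assume uv: "u \<in> vertices (map_digraph h A)" "v \<in> vertices (map_digraph h A)"
    then obtain a b where ab: "a \<in> vertices A" "b \<in> vertices A" "u = h a" "v = h b" by auto
    then show "(u, v) \<in> edges (map_digraph h A) \<longleftrightarrow> (?F u, ?F v) \<in> edges (map_digraph h A)"
      by (simp only: F edges_map_digraph[OF A(1,3)] f' edge)
  qed (use A f' in auto)
  then show ?thesis using F by (intro bexI) auto
qed

text \<open>A single \<open>B\<close> serves all partial isomorphisms of \<open>A\<close>, hence any
  finite list of them. The injection \<open>j\<close> decouples the type of \<open>B\<close> from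
  that of \<open>A\<close>: the identity gives a superstructure of \<open>A\<close> itself, and an
  injection into \<open>nat\<close> is used for substructures of the generic digraph.\<close>

theorem eppa:
  fixes j :: "'a \<Rightarrow> 'c::infinite"
  assumes A: "is_digraph A" "finite (vertices A)" and j: "inj_on j (vertices A)"
  shows "\<exists>B. is_digraph B \<and> finite (vertices B) \<and> is_embedding j A B \<and>
     (\<forall>T::'t digraph. is_tournament T \<longrightarrow> embeds T B \<longrightarrow> embeds T A) \<and>
     (\<forall>p. partial_iso A p \<longrightarrow> (\<exists>f\<in>automorphisms B. \<forall>a\<in>dom p. f (j a) = j (the (p a))))"
proof -
  let ?e = "\<lambda>x. (x, restrict (orientation A x) (vertices A))" and ?B = "faithful A (valued A)"
  note V = is_digraph_valued[of A] finite_valued[OF A(2)]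
  obtain k where k: "is_embedding k A ?B"
    "\<And>p \<phi>. partial_iso A p \<Longrightarrow> \<phi> \<in> automorphisms (valued A) \<Longrightarrow> \<forall>a\<in>dom p. \<phi> (?e a) = ?e (the (p a)) \<Longrightarrow>
        \<exists>f\<in>automorphisms ?B. \<forall>a\<in>dom p. f (k a) = k (the (p a))"
    using faithful_embedding[OF A V(2) is_embedding_valued[OF A(1)]] by metis
  have B: "is_digraph ?B" "finite (vertices ?B)"
    using is_digraph_faithful[OF V(1)] finite_faithful[OF V(2)] by blast+
  have kA: "inj_on k (vertices A)" "k ` vertices A \<subseteq> vertices ?B" using k by (auto simp: is_embedding_def)
  have fin: "finite (j ` vertices A)" using A by simp
  then have "infinite (UNIV - j ` vertices A :: 'c set)" using infinite_UNIV by (rule Diff_infinite_finite)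
  \<comment> \<open>Fresh points for the vertices of \<open>?B\<close> outside the copy of
    \<open>A\<close>. The renaming \<open>h\<close> can then send \<open>k a\<close> to
    \<open>j a\<close>.\<close>
  then obtain T where T: "finite T" "card T = card (vertices ?B) - card (vertices A)" "T \<subseteq> UNIV - j ` vertices A"
    using infinite_arbitrarily_large by metis
  have "card (vertices A) \<le> card (vertices ?B)" using card_inj_on_le[OF kA B(2)] .
  then have card: "card (j ` vertices A \<union> T) = card (vertices ?B)"
    using T fin j by (subst card_Un_disjoint) (auto simp: card_image)
  then obtain h where h: "bij_betw h (vertices ?B) (j ` vertices A \<union> T)" "\<forall>a\<in>vertices A. h (k a) = j a"
    using extend_to_bij_betw[OF B(2) _ card[symmetric] kA j] T(1) fin by auto
  have hi: "inj_on h (vertices ?B)" using h by (simp add: bij_betw_def)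
  let ?C = "map_digraph h ?B"
  have "is_embedding j A ?C"
    unfolding is_embedding_def
  proof (intro conjI ballI)
    show "j ` vertices A \<subseteq> vertices ?C" using h by (simp add: bij_betw_def)
    fix a b assume ab: "a \<in> vertices A" "b \<in> vertices A"
    then have "(a, b) \<in> edges A \<longleftrightarrow> (k a, k b) \<in> edges ?B" using k(1) by (auto simp: is_embedding_def)
    also have "\<dots> \<longleftrightarrow> (h (k a), h (k b)) \<in> edges ?C"
      using ab kA(2) by (intro edges_map_digraph[OF B(1) hi, symmetric]) auto
    finally show "(a, b) \<in> edges A \<longleftrightarrow> (j a, j b) \<in> edges ?C" using h(2) ab by simp
  qed (rule j)
  moreover have "embeds T A" if "is_tournament T" "embeds T ?C" for T :: "'t digraph"
    using tournament_embeds_faithful[OF V that(1)] embeds_trans[OF that(2) map_digraph_embeds[OF B(1) hi]] by blast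
  moreover have "\<exists>f\<in>automorphisms ?C. \<forall>a\<in>dom p. f (j a) = j (the (p a))" if p: "partial_iso A p" for p
  proof -
    have dom: "a \<in> vertices A" "the (p a) \<in> vertices A" if "a \<in> dom p" for a
      using p that by (auto simp: partial_iso_def ran_def)
    obtain f where f: "f \<in> automorphisms ?B" "\<forall>a\<in>dom p. f (k a) = k (the (p a))"
      using valued_extends[OF A p] k(2)[OF p] by metis
    obtain f' where f': "f' \<in> automorphisms ?C" "\<forall>b\<in>vertices ?B. f' (h b) = h (f b)"
      using automorphism_map_digraph[OF B hi f(1)] by blast
    have "f' (j a) = j (the (p a))" if "a \<in> dom p" for a
      using that f f' dom h(2) kA by (metis image_subset_iff)
    then show ?thesis using f' by blast
  qed
  ultimately show ?thesis
    using is_digraph_map_digraph[OF B(1) hi] B(2) by (intro exI[of _ ?C]) auto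
qed

lemma free_class_eppa:
  fixes A :: "'a::infinite digraph" and \<F> :: "'f digraph set"
  assumes tour: "\<And>T. T \<in> \<F> \<Longrightarrow> is_tournament T" and A: "A \<in> free_class \<F>"
  shows "\<exists>B \<in> free_class \<F>. substructure A B \<and>
     (\<forall>p. partial_iso A p \<longrightarrow> (\<exists>f \<in> automorphisms B. extends f p))"
proof -
  have dig: "is_digraph A" "finite (vertices A)" using A by (auto simp: free_class_def)
  obtain B where B: "is_digraph B" "finite (vertices B)" "is_embedding id A B"
    "\<And>T::'f digraph. is_tournament T \<Longrightarrow> embeds T B \<Longrightarrow> embeds T A"
    "\<And>p. partial_iso A p \<Longrightarrow> \<exists>f\<in>automorphisms B. \<forall>a\<in>dom p. f (id a) = id (the (p a))"
    using eppa[OF dig, of id, where ?'t = 'f] by auto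
  have "B \<in> free_class \<F>" using A B tour by (auto simp: free_class_def)
  moreover have "substructure A B"
    using B(3) dig(1) by (auto simp: substructure_def is_embedding_def is_digraph_def induced_def
        intro!: digraph.equality)
  moreover have "\<exists>f \<in> automorphisms B. extends f p" if "partial_iso A p" for p
  proof -
    obtain f where f: "f \<in> automorphisms B" "\<forall>a\<in>dom p. f (id a) = id (the (p a))"
      using B(5)[OF \<open>partial_iso A p\<close>] by blast
    then have "extends f p" by (simp add: extends_def domIff)
    with f(1) show ?thesis by blast
  qed
  ultimately show ?thesis by blast
qed

section \<open>Subgroups of small index in groups with generic tuples\<close>

text \<open>From here on, \<open>inv\<close> is the inverse of a function.\<close>

unbundle no m_inv_syntax

text \<open>\<open>extension\<close> is the extension property for partial automorphisms and \<open>amalgamation\<close> the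
  free amalgamation property, both transferred from the finite structures to the automorphism
  group of their homogeneous limit.\<close>

locale generic_perm_group =
  fixes V :: "'m set" and G :: "('m \<Rightarrow> 'm) set"
  assumes countable_V: "countable V"
    and permutes: "g \<in> G \<Longrightarrow> g permutes V"
    and id_mem: "id \<in> G"
    and comp_mem: "g \<in> G \<Longrightarrow> h \<in> G \<Longrightarrow> g \<circ> h \<in> G"
    and inv_mem: "g \<in> G \<Longrightarrow> inv g \<in> G"
    and closed: "f permutes V \<Longrightarrow>
      (\<And>E. finite E \<Longrightarrow> E \<subseteq> V \<Longrightarrow> \<exists>g\<in>G. \<forall>x\<in>E. g x = f x) \<Longrightarrow> f \<in> G"
    and extension: "finite C \<Longrightarrow> C \<subseteq> V \<Longrightarrow> (\<And>i::nat. i < n \<Longrightarrow> X i \<in> G) \<Longrightarrow>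
      \<exists>D Y. finite D \<and> C \<subseteq> D \<and> D \<subseteq> V \<and>
        (\<forall>i<n. Y i \<in> G \<and> Y i ` D = D \<and> (\<forall>a\<in>C. X i a \<in> C \<longrightarrow> Y i a = X i a))"
    and amalgamation: "finite C' \<Longrightarrow> finite D \<Longrightarrow> C' \<subseteq> V \<Longrightarrow> D \<subseteq> V \<Longrightarrow> C \<subseteq> C' \<Longrightarrow> C \<subseteq> D \<Longrightarrow>
      \<exists>g\<in>G. (\<forall>x\<in>C. g x = x) \<and>
        (\<forall>u\<in>G. \<forall>v\<in>G. u ` C' = C' \<longrightarrow> v ` g ` D = g ` D \<longrightarrow> u ` C = C \<longrightarrow> (\<forall>x\<in>C. u x = v x) \<longrightarrow>
          (\<exists>w\<in>G. (\<forall>x\<in>C'. w x = u x) \<and> (\<forall>x\<in>g ` D. w x = v x)))"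
begin

lemma G_simps:
  assumes "g \<in> G"
  shows "inv g (g x) = x" "g (inv g x) = x" "g x = g y \<longleftrightarrow> x = y" "g x \<in> V \<longleftrightarrow> x \<in> V"
    "inv g x \<in> V \<longleftrightarrow> x \<in> V" "inv g ` g ` A = A" "g ` inv g ` A = A" "inv (inv g) = g"
proof -
  have p: "g permutes V" and b: "bij g" using permutes[OF assms] permutes_bij by auto
  show "inv g (g x) = x" "g (inv g x) = x" "g x = g y \<longleftrightarrow> x = y"
    using p by (auto simp: permutes_inverses dest: permutes_inj injD)
  show "inv g ` g ` A = A" "g ` inv g ` A = A" "inv (inv g) = g"
    using b p by (simp_all add: image_comp bij_is_inj inv_inv_eq permutes_inv_o)
  show "g x \<in> V \<longleftrightarrow> x \<in> V" "inv g x \<in> V \<longleftrightarrow> x \<in> V"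
    using p permutes_inv[OF p] by (auto simp: permutes_in_image)
qed

lemma outside: "g \<in> G \<Longrightarrow> x \<notin> V \<Longrightarrow> g x = x"
  using permutes by (auto simp: permutes_def)

lemma image_mem: "g \<in> G \<Longrightarrow> E \<subseteq> V \<Longrightarrow> g ` E \<subseteq> V"
  using G_simps(4) by blast

text \<open>The maps agree along the chain, so they have a common extension. A pointwise limit of
  permutations need not be onto; covering \<open>V\<close> by the images as well as by the sets
  rules this out. Membership in the group holds because every finite part of the limit already
  occurs in one \<open>w n\<close>.\<close>

lemma chain_limit:
  assumes w: "\<And>n. w n \<in> G" and E: "\<And>n. E n \<subseteq> E (Suc n)" "\<And>n. E n \<subseteq> V"
    and agree: "\<And>n x. x \<in> E n \<Longrightarrow> w (Suc n) x = w n x"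
    and cov: "V \<subseteq> (\<Union>n. E n)" "V \<subseteq> (\<Union>n. w n ` E n)"
  shows "\<exists>g\<in>G. \<forall>n. \<forall>x\<in>E n. g x = w n x"
proof -
  have E_mono: "E m \<subseteq> E n" if "m \<le> n" for m n
    using lift_Suc_mono_le[of E, OF E(1) that] .
  have w_agree: "w n x = w m x" if "m \<le> n" "x \<in> E m" for m n x
    using that
  proof (induction n rule: dec_induct)
    case (step n)
    then have "x \<in> E n" using E_mono by blast
    then show ?case using agree step by simp
  qed simp
  \<comment> \<open>The least stage is an arbitrary choice: by \<open>w_agree\<close> every stage
    containing \<open>x\<close> gives the same value.\<close>
  define g where "g x = (if x \<in> V then w (LEAST n. x \<in> E n) x else x)" for x
  have g: "g x = w n x" if "x \<in> E n" for n x
  proof -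
    have "x \<in> E (LEAST n. x \<in> E n)" using that by (rule LeastI)
    moreover have "(LEAST n. x \<in> E n) \<le> n" using that by (rule Least_le)
    moreover have "x \<in> V" using that E(2) by blast
    ultimately show ?thesis using w_agree by (simp add: g_def)
  qed
  have fin_cov: "\<exists>n. F \<subseteq> E n" if "finite F" "F \<subseteq> V" for F
    using that
  proof (induction F rule: finite_induct)
    case (insert x F)
    then obtain m n where "F \<subseteq> E m" "x \<in> E n" using cov(1) by blast
    then have "insert x F \<subseteq> E (max m n)" using E_mono[of m "max m n"] E_mono[of n "max m n"] by auto
    then show ?case ..
  qed simp
  have "bij_betw g V V"
  proof (rule bij_betw_imageI)
    show "inj_on g V"
    proof (rule inj_onI)
      fix x y assume *: "x \<in> V" "y \<in> V" "g x = g y"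
      obtain n where "{x, y} \<subseteq> E n" using fin_cov[of "{x, y}"] * by blast
      then have "w n x = w n y" using *(3) g[of x n] g[of y n] by simp
      then show "x = y" using G_simps(3)[OF w] by simp
    qed
    show "g ` V = V"
    proof
      show "g ` V \<subseteq> V" using G_simps(4)[OF w] by (auto simp: g_def)
      show "V \<subseteq> g ` V"
      proof
        fix y assume "y \<in> V"
        then obtain n x where x: "x \<in> E n" "y = w n x" using cov(2) by blast
        then have "y = g x" "x \<in> V" using g[OF x(1)] E(2) by auto
        then show "y \<in> g ` V" by blast
      qed
    qed
  qed
  then have "g permutes V" by (rule bij_imp_permutes) (simp add: g_def)
  moreover have "\<exists>h\<in>G. \<forall>x\<in>F. h x = g x" if "finite F" "F \<subseteq> V" for F
    using fin_cov[OF that] g w by (metis subsetD)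
  ultimately have "g \<in> G" by (rule closed)
  then show ?thesis using g by blast
qed

section \<open>Dense open sets and trees of conditions\<close>

text \<open>The topology is that of pointwise convergence with \<open>V\<close> discrete, so
  agreement on a finite set is the basic notion of closeness.\<close>

definition dense_open :: "('m \<Rightarrow> 'm) set \<Rightarrow> bool" where
  "dense_open D \<longleftrightarrow> D \<subseteq> G \<and>
     (\<forall>g\<in>D. \<exists>E. finite E \<and> E \<subseteq> V \<and> (\<forall>h\<in>G. (\<forall>x\<in>E. h x = g x) \<longrightarrow> h \<in> D)) \<and>
     (\<forall>g\<in>G. \<forall>E. finite E \<longrightarrow> E \<subseteq> V \<longrightarrow> (\<exists>h\<in>D. \<forall>x\<in>E. h x = g x))"

lemma dense_open_translate:
  assumes "dense_open D" "g \<in> G"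
  shows "dense_open {h \<in> G. g \<circ> h \<in> D}"
  unfolding dense_open_def
proof (intro conjI ballI allI impI)
  fix h assume "h \<in> {h \<in> G. g \<circ> h \<in> D}"
  then obtain E where "finite E" "E \<subseteq> V" and E: "\<forall>k\<in>G. (\<forall>x\<in>E. k x = (g \<circ> h) x) \<longrightarrow> k \<in> D"
    using assms(1) unfolding dense_open_def by blast
  moreover have "g \<circ> k \<in> D" if "k \<in> G" "\<forall>x\<in>E. k x = h x" for k
    using E comp_mem[OF assms(2)] that by auto
  ultimately show "\<exists>E. finite E \<and> E \<subseteq> V \<and> (\<forall>k\<in>G. (\<forall>x\<in>E. k x = h x) \<longrightarrow> k \<in> {h \<in> G. g \<circ> h \<in> D})"
    by blast
next
  fix h E assume "h \<in> G" "finite E" "E \<subseteq> V"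
  moreover have "g \<circ> h \<in> G" using assms(2) \<open>h \<in> G\<close> by (rule comp_mem)
  ultimately obtain k where k: "k \<in> D" "\<forall>x\<in>E. k x = (g \<circ> h) x"
    using assms(1) unfolding dense_open_def by blast
  have "k \<in> G" using k assms(1) by (auto simp: dense_open_def)
  then have "inv g \<circ> k \<in> {h \<in> G. g \<circ> h \<in> D}" "\<forall>x\<in>E. (inv g \<circ> k) x = h x"
    using k assms(2) inv_mem comp_mem by (auto simp: o_def G_simps[OF assms(2)])
  then show "\<exists>k\<in>{h \<in> G. g \<circ> h \<in> D}. \<forall>x\<in>E. k x = h x" by blast
qed auto

text \<open>A condition \<open>(w, E)\<close> stands for the basic open set of all \<open>g \<in> G\<close> that agree
  with \<open>w\<close> on \<open>E\<close>.\<close>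

definition cond :: "('m \<Rightarrow> 'm) \<times> 'm set \<Rightarrow> bool" where
  "cond c \<longleftrightarrow> fst c \<in> G \<and> finite (snd c) \<and> snd c \<subseteq> V"

definition refines :: "('m \<Rightarrow> 'm) \<times> 'm set \<Rightarrow> ('m \<Rightarrow> 'm) \<times> 'm set \<Rightarrow> bool" where
  "refines c d \<longleftrightarrow> snd d \<subseteq> snd c \<and> (\<forall>x\<in>snd d. fst c x = fst d x)"

definition nbhd :: "('m \<Rightarrow> 'm) \<times> 'm set \<Rightarrow> ('m \<Rightarrow> 'm) set" where
  "nbhd c = {g \<in> G. \<forall>x\<in>snd c. g x = fst c x}"

lemma refines_refl: "refines c c" and refines_trans: "refines c d \<Longrightarrow> refines d e \<Longrightarrow> refines c e"
  by (auto simp: refines_def subset_iff)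

lemma refines_nbhd: "refines c d \<Longrightarrow> nbhd c \<subseteq> nbhd d"
  by (auto simp: refines_def nbhd_def)

text \<open>Density gives \<open>q\<close> in \<open>D\<close> that agrees with
  \<open>inv w \<circ> w'\<close> on \<open>E'\<close>, and openness gives a finite \<open>F\<close>
  that keeps elements agreeing with \<open>q\<close> in \<open>D\<close>. Fixing \<open>b\<close> as
  \<open>w \<circ> q\<close> on \<open>F\<close> and \<open>a\<close> as \<open>w\<close> on the
  image of \<open>F\<close> under \<open>q\<close> forces the quotient to agree with
  \<open>q\<close> on \<open>F\<close>.\<close>

lemma separate_pair:
  assumes D: "dense_open D" and c: "cond (c i)" "cond (c j)" and ij: "i \<noteq> j"
  shows "\<exists>c'. (\<forall>s. refines (c' s) (c s)) \<and> (\<forall>s. cond (c s) \<longrightarrow> cond (c' s)) \<and>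
     (\<forall>a\<in>nbhd (c' i). \<forall>b\<in>nbhd (c' j). inv a \<circ> b \<in> D)"
proof -
  obtain w E where wE: "c i = (w, E)" by (metis surj_pair)
  obtain w' E' where wE': "c j = (w', E')" by (metis surj_pair)
  have w: "w \<in> G" "finite E" "E \<subseteq> V" "w' \<in> G" "finite E'" "E' \<subseteq> V" using c by (auto simp: cond_def wE wE')
  have "inv w \<circ> w' \<in> G" using w inv_mem comp_mem by blast
  then obtain q where q: "q \<in> D" "\<forall>x\<in>E'. q x = (inv w \<circ> w') x"
    using D w(5,6) unfolding dense_open_def by blast
  then have "\<exists>F. finite F \<and> F \<subseteq> V \<and> (\<forall>h\<in>G. (\<forall>x\<in>F. h x = q x) \<longrightarrow> h \<in> D)"
    using D unfolding dense_open_def by blast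
  then obtain F where F: "finite F" "F \<subseteq> V" "\<And>h. h \<in> G \<Longrightarrow> (\<forall>x\<in>F. h x = q x) \<Longrightarrow> h \<in> D" by blast
  have qG: "q \<in> G" using q D by (auto simp: dense_open_def)
  let ?c = "c(i := (w, E \<union> q ` F), j := (w \<circ> q, E' \<union> F))"
  have "\<forall>s. refines (?c s) (c s)" using ij q by (auto simp: refines_def wE wE' G_simps[OF w(1)])
  moreover have "\<forall>s. cond (c s) \<longrightarrow> cond (?c s)"
    using ij w qG F comp_mem image_mem[OF qG F(2)] by (auto simp: cond_def)
  moreover have "inv a \<circ> b \<in> D" if a: "a \<in> nbhd (?c i)" and b: "b \<in> nbhd (?c j)" for a b
  proof (rule F(3))
    have aG: "a \<in> G" "b \<in> G" using a b by (auto simp: nbhd_def)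
    then show "inv a \<circ> b \<in> G" using comp_mem inv_mem by blast
    have "inv a (b x) = q x" if "x \<in> F" for x
    proof -
      have "b x = w (q x)" "a (q x) = w (q x)" using a b that ij by (auto simp: nbhd_def)
      then have "inv a (b x) = inv a (a (q x))" by simp
      then show ?thesis by (simp add: G_simps[OF aG(1)])
    qed
    then show "\<forall>x\<in>F. (inv a \<circ> b) x = q x" by simp
  qed
  ultimately show ?thesis by blast
qed

text \<open>The requests can be met one after another, because refining only shrinks the
  neighbourhoods and so keeps the quotients obtained before.\<close>

lemma separate_finite:
  assumes "finite R" "\<And>i j D. (i, j, D) \<in> R \<Longrightarrow> dense_open D \<and> i \<noteq> j \<and> cond (c i) \<and> cond (c j)"
  shows "\<exists>c'. (\<forall>s. refines (c' s) (c s)) \<and> (\<forall>s. cond (c s) \<longrightarrow> cond (c' s)) \<and>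
     (\<forall>(i, j, D)\<in>R. \<forall>a\<in>nbhd (c' i). \<forall>b\<in>nbhd (c' j). inv a \<circ> b \<in> D)"
  using assms
proof (induction R rule: finite_induct)
  case empty
  show ?case by (rule exI[of _ c]) (simp add: refines_refl)
next
  case (insert r R)
  obtain i j D where r: "r = (i, j, D)" by (metis surj_pair)
  have "\<And>i j D. (i, j, D) \<in> R \<Longrightarrow> dense_open D \<and> i \<noteq> j \<and> cond (c i) \<and> cond (c j)"
    using insert.prems by blast
  from insert.IH[OF this] obtain c' where c': "\<forall>s. refines (c' s) (c s)" "\<forall>s. cond (c s) \<longrightarrow> cond (c' s)"
    "\<forall>(i, j, D)\<in>R. \<forall>a\<in>nbhd (c' i). \<forall>b\<in>nbhd (c' j). inv a \<circ> b \<in> D"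
    by blast
  have "dense_open D" "i \<noteq> j" "cond (c' i)" "cond (c' j)" using insert.prems[of i j D] r c'(2) by auto
  then obtain c'' where c'': "\<forall>s. refines (c'' s) (c' s)" "\<forall>s. cond (c' s) \<longrightarrow> cond (c'' s)"
    "\<forall>a\<in>nbhd (c'' i). \<forall>b\<in>nbhd (c'' j). inv a \<circ> b \<in> D"
    using separate_pair[of D c' i j] by blast
  have "\<forall>(i, j, D)\<in>insert r R. \<forall>a\<in>nbhd (c'' i). \<forall>b\<in>nbhd (c'' j). inv a \<circ> b \<in> D"
    using c'(3) c''(3) refines_nbhd[OF c''(1)[rule_format]] r by fast
  moreover have "\<forall>s. refines (c'' s) (c s)" using c'(1) c''(1) refines_trans by metis
  moreover have "\<forall>s. cond (c s) \<longrightarrow> cond (c'' s)" using c'(2) c''(2) by blast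
  ultimately show ?case by blast
qed

lemma enumeration: "\<exists>v :: nat \<Rightarrow> 'm. V \<subseteq> range v"
proof (cases "V = {}")
  case False
  then have "range (from_nat_into V) = V" using countable_V by (rule range_from_nat_into)
  then show ?thesis by blast
qed simp

text \<open>Conditions indexed by the subsets of \<open>{..<n}\<close> form the levels of a binary tree; at level
  \<open>n\<close> any two of them are refined so that the quotients of their elements lie in the first
  \<open>n\<close> dense open sets (Mycielski's argument).\<close>

lemma continuum_tree:
  assumes D: "\<And>k::nat. dense_open (D k)" and C: "finite C" "C \<subseteq> V"
  shows "\<exists>g :: nat set \<Rightarrow> 'm \<Rightarrow> 'm. (\<forall>\<sigma>. g \<sigma> \<in> G \<and> (\<forall>x\<in>C. g \<sigma> x = x)) \<and>
     (\<forall>\<sigma> \<tau> k. \<sigma> \<noteq> \<tau> \<longrightarrow> inv (g \<sigma>) \<circ> g \<tau> \<in> D k)"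
proof -
  from enumeration obtain v :: "nat \<Rightarrow> 'm" where v: "V \<subseteq> range v" ..
  \<comment> \<open>The clause for \<open>n = 0\<close> makes dependent choice remember the root, so
    that every branch fixes \<open>C\<close>.\<close>
  define P :: "nat \<Rightarrow> (nat set \<Rightarrow> ('m \<Rightarrow> 'm) \<times> 'm set) \<Rightarrow> bool" where
    "P n c \<longleftrightarrow> (\<forall>s. cond (c s)) \<and> (n = 0 \<longrightarrow> c = (\<lambda>s. (id, C)))" for n c
  \<comment> \<open>\<open>s \<inter> {..<n}\<close> is the parent of the node
    \<open>s\<close>.\<close>
  define Q :: "nat \<Rightarrow> (nat set \<Rightarrow> ('m \<Rightarrow> 'm) \<times> 'm set) \<Rightarrow>
      (nat set \<Rightarrow> ('m \<Rightarrow> 'm) \<times> 'm set) \<Rightarrow> bool" where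
    "Q n c c' \<longleftrightarrow> (\<forall>s. refines (c' s) (c (s \<inter> {..<n}))) \<and>
      (\<forall>s \<subseteq> {..n}. v n \<in> V \<longrightarrow> v n \<in> snd (c' s) \<and> v n \<in> fst (c' s) ` snd (c' s)) \<and>
      (\<forall>s \<subseteq> {..n}. \<forall>t \<subseteq> {..n}. \<forall>k\<le>n. s \<noteq> t \<longrightarrow>
        (\<forall>a\<in>nbhd (c' s). \<forall>b\<in>nbhd (c' t). inv a \<circ> b \<in> D k))" for n c c'
  have "\<exists>c :: nat \<Rightarrow> nat set \<Rightarrow> ('m \<Rightarrow> 'm) \<times> 'm set. \<forall>n. P n (c n) \<and> Q n (c n) (c (Suc n))"
  proof (rule dependent_nat_choice[of P Q])
    show "\<exists>c. P 0 c" using C id_mem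
      by (intro exI[of _ "\<lambda>s. (id, C)"]) (simp add: cond_def P_def)
  next
    fix c :: "nat set \<Rightarrow> ('m \<Rightarrow> 'm) \<times> 'm set" and n
    assume c: "P n c"
    \<comment> \<open>Adding the preimage of \<open>v n\<close> puts \<open>v n\<close> into the
      range as well, as the limit along a branch must be surjective.\<close>
    define c1 where "c1 s = (let (w, E) = c (s \<inter> {..<n}) in (w, E \<union> ({v n, inv w (v n)} \<inter> V)))" for s
    have c1: "cond (c1 s)" "refines (c1 s) (c (s \<inter> {..<n}))"
      "v n \<in> V \<Longrightarrow> v n \<in> snd (c1 s) \<and> v n \<in> fst (c1 s) ` snd (c1 s)" for s
    proof -
      obtain w E where wE: "c (s \<inter> {..<n}) = (w, E)" by (metis surj_pair)
      have w: "w \<in> G" "finite E" "E \<subseteq> V" using c wE unfolding P_def cond_def by (metis fst_conv snd_conv)+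
      show "cond (c1 s)" "refines (c1 s) (c (s \<inter> {..<n}))"
        using w by (auto simp: c1_def wE cond_def refines_def)
      assume "v n \<in> V"
      moreover have "v n = w (inv w (v n))" by (simp add: G_simps[OF w(1)])
      ultimately show "v n \<in> snd (c1 s) \<and> v n \<in> fst (c1 s) ` snd (c1 s)"
        by (auto simp: c1_def wE image_iff G_simps[OF w(1)])
    qed
    let ?R = "{(s, t, X). s \<in> Pow {..n} \<and> t \<in> Pow {..n} \<and> X \<in> D ` {..n} \<and> s \<noteq> t}"
    have "?R \<subseteq> Pow {..n} \<times> Pow {..n} \<times> D ` {..n}" by auto
    then have "finite ?R" by (rule finite_subset) auto
    then obtain c2 where c2: "\<forall>s. refines (c2 s) (c1 s)" "\<forall>s. cond (c1 s) \<longrightarrow> cond (c2 s)"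
      "\<forall>(i, j, D)\<in>?R. \<forall>a\<in>nbhd (c2 i). \<forall>b\<in>nbhd (c2 j). inv a \<circ> b \<in> D"
      using separate_finite[of ?R c1] D c1(1) by blast
    have "P (Suc n) c2" using c2(2) c1(1) by (simp add: P_def)
    moreover have "Q n c c2"
      unfolding Q_def
    proof (intro conjI allI impI)
      fix s
      show "refines (c2 s) (c (s \<inter> {..<n}))" using c1(2) c2(1) refines_trans by blast
      assume "v n \<in> V"
      then have m: "v n \<in> snd (c1 s)" "v n \<in> fst (c1 s) ` snd (c1 s)" using c1(3) by auto
      have r: "snd (c1 s) \<subseteq> snd (c2 s)" "\<forall>x\<in>snd (c1 s). fst (c2 s) x = fst (c1 s) x"
        using c2(1) by (auto simp: refines_def)
      show "v n \<in> snd (c2 s)" using m r by blast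
      show "v n \<in> fst (c2 s) ` snd (c2 s)"
        using m(2) r(1) image_cong[OF refl, of "snd (c1 s)" "fst (c2 s)" "fst (c1 s)"] r(2) by blast
    next
      fix s t k assume "s \<subseteq> {..n}" "t \<subseteq> {..n}" "k \<le> n" "s \<noteq> t"
      then have "(s, t, D k) \<in> ?R" by auto
      then show "\<forall>a\<in>nbhd (c2 s). \<forall>b\<in>nbhd (c2 t). inv a \<circ> b \<in> D k" using c2(3) by blast
    qed
    ultimately show "\<exists>c'. P (Suc n) c' \<and> Q n c c'" by blast
  qed
  then obtain c where PQ: "\<forall>n. P n (c n) \<and> Q n (c n) (c (Suc n))" ..
  have P: "cond (c n s)" "c 0 = (\<lambda>s. (id, C))" for n s using PQ unfolding P_def by blast+
  have Qn: "Q n (c n) (c (Suc n))" for n using PQ by simp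
  have Q1: "refines (c (Suc n) s) (c n (s \<inter> {..<n}))" for n s
    by (rule Qn[unfolded Q_def, THEN conjunct1, rule_format])
  have Q2: "v n \<in> snd (c (Suc n) s)" "v n \<in> fst (c (Suc n) s) ` snd (c (Suc n) s)"
    if "s \<subseteq> {..n}" "v n \<in> V" for n s
    using Qn[unfolded Q_def, THEN conjunct2, THEN conjunct1, rule_format, OF that] by simp_all
  have Q3: "inv a \<circ> b \<in> D k" if "s \<subseteq> {..n}" "t \<subseteq> {..n}" "k \<le> n" "s \<noteq> t"
      "a \<in> nbhd (c (Suc n) s)" "b \<in> nbhd (c (Suc n) t)" for n s t k a b
    by (rule Qn[unfolded Q_def, THEN conjunct2, THEN conjunct2, rule_format, OF that])
  define w where "w \<sigma> n = fst (c n (\<sigma> \<inter> {..<n}))" for \<sigma> n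
  define E where "E \<sigma> n = snd (c n (\<sigma> \<inter> {..<n}))" for \<sigma> n
  have step: "refines (w \<sigma> (Suc n), E \<sigma> (Suc n)) (w \<sigma> n, E \<sigma> n)" for \<sigma> n
  proof -
    have "\<sigma> \<inter> {..<Suc n} \<inter> {..<n} = \<sigma> \<inter> {..<n}" by auto
    then show ?thesis using Q1[of n "\<sigma> \<inter> {..<Suc n}"] by (simp add: w_def E_def)
  qed
  have hit: "v n \<in> E \<sigma> (Suc n)" "v n \<in> w \<sigma> (Suc n) ` E \<sigma> (Suc n)" if "v n \<in> V" for \<sigma> n
  proof -
    have "\<sigma> \<inter> {..<Suc n} \<subseteq> {..n}" by auto
    then show "v n \<in> E \<sigma> (Suc n)" "v n \<in> w \<sigma> (Suc n) ` E \<sigma> (Suc n)"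
      using Q2[OF _ that] unfolding w_def E_def by blast+
  qed
  have "\<exists>g\<in>G. \<forall>n. \<forall>x\<in>E \<sigma> n. g x = w \<sigma> n x" for \<sigma>
  proof (rule chain_limit)
    show "w \<sigma> n \<in> G" "E \<sigma> n \<subseteq> V" for n using P(1) by (auto simp: cond_def w_def E_def)
    show "E \<sigma> n \<subseteq> E \<sigma> (Suc n)" "\<And>x. x \<in> E \<sigma> n \<Longrightarrow> w \<sigma> (Suc n) x = w \<sigma> n x" for n
      using step[of \<sigma> n] by (auto simp: refines_def)
    have "y \<in> (\<Union>n. E \<sigma> n)" "y \<in> (\<Union>n. w \<sigma> n ` E \<sigma> n)" if "y \<in> V" for y
    proof -
      obtain n where y: "y = v n" using v \<open>y \<in> V\<close> by auto
      show "y \<in> (\<Union>n. E \<sigma> n)" "y \<in> (\<Union>n. w \<sigma> n ` E \<sigma> n)"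
        by (rule UN_I[of "Suc n"]; use hit[of n] y \<open>y \<in> V\<close> in simp)+
    qed
    then show "V \<subseteq> (\<Union>n. E \<sigma> n)" "V \<subseteq> (\<Union>n. w \<sigma> n ` E \<sigma> n)" by auto
  qed
  then have "\<forall>\<sigma>. \<exists>g. g \<in> G \<and> (\<forall>n. \<forall>x\<in>E \<sigma> n. g x = w \<sigma> n x)" by (simp add: Bex_def)
  from choice[OF this] obtain g where
    g': "\<forall>\<sigma>. g \<sigma> \<in> G \<and> (\<forall>n. \<forall>x\<in>E \<sigma> n. g \<sigma> x = w \<sigma> n x)" ..
  have g: "g \<sigma> \<in> G" "x \<in> E \<sigma> n \<Longrightarrow> g \<sigma> x = w \<sigma> n x" for \<sigma> n x using g' by simp_all
  have nb: "g \<sigma> \<in> nbhd (c n (\<sigma> \<inter> {..<n}))" for \<sigma> n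
    using g by (simp add: nbhd_def E_def w_def)
  have "inv (g \<sigma>) \<circ> g \<tau> \<in> D k" if "\<sigma> \<noteq> \<tau>" for \<sigma> \<tau> k
  proof -
    obtain m where m: "m \<in> \<sigma> \<longleftrightarrow> m \<notin> \<tau>" using \<open>\<sigma> \<noteq> \<tau>\<close> by blast
    \<comment> \<open>Beyond \<open>m\<close> the branches run through different nodes, and from
      \<open>k\<close> on the set \<open>D k\<close> is among those treated.\<close>
    let ?n = "max m k"
    have neq: "\<sigma> \<inter> {..<Suc ?n} \<noteq> \<tau> \<inter> {..<Suc ?n}"
    proof
      assume "\<sigma> \<inter> {..<Suc ?n} = \<tau> \<inter> {..<Suc ?n}"
      then have "m \<in> \<sigma> \<inter> {..<Suc ?n} \<longleftrightarrow> m \<in> \<tau> \<inter> {..<Suc ?n}" by simp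
      then show False using m by auto
    qed
    have sub: "\<sigma> \<inter> {..<Suc ?n} \<subseteq> {..?n}" "\<tau> \<inter> {..<Suc ?n} \<subseteq> {..?n}" "k \<le> ?n" by auto
    show ?thesis by (rule Q3[OF sub neq nb nb])
  qed
  moreover have "\<forall>x\<in>C. g \<sigma> x = x" for \<sigma> using nb[of \<sigma> 0] P(2) by (auto simp: nbhd_def)
  ultimately show ?thesis using g(1) by (intro exI[of _ g]) simp
qed

text \<open>Encodes index less than the continuum.\<close>

definition small :: "('m \<Rightarrow> 'm) set \<Rightarrow> bool" where
  "small H \<longleftrightarrow> H \<subseteq> G \<and> id \<in> H \<and> (\<forall>g\<in>H. \<forall>h\<in>H. g \<circ> h \<in> H) \<and> (\<forall>g\<in>H. inv g \<in> H) \<and>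
     \<not> (\<exists>g :: nat set \<Rightarrow> 'm \<Rightarrow> 'm. (\<forall>\<sigma>. g \<sigma> \<in> G) \<and> (\<forall>\<sigma> \<tau>. \<sigma> \<noteq> \<tau> \<longrightarrow> inv (g \<sigma>) \<circ> g \<tau> \<notin> H))"

text \<open>Two of the continuum many branches share a left coset of \<open>H\<close>. Since the
  quotient of every pair of branches lies in all the dense open sets, so does the quotient of these
  two.\<close>

lemma small_meets_dense_open:
  assumes "small H" "\<And>k::nat. dense_open (D k)" "finite C" "C \<subseteq> V"
  shows "\<exists>h\<in>H. (\<forall>x\<in>C. h x = x) \<and> (\<forall>k. h \<in> D k)"
proof -
  obtain g :: "nat set \<Rightarrow> 'm \<Rightarrow> 'm" where g': "(\<forall>\<sigma>. g \<sigma> \<in> G \<and> (\<forall>x\<in>C. g \<sigma> x = x)) \<and>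
     (\<forall>\<sigma> \<tau> k. \<sigma> \<noteq> \<tau> \<longrightarrow> inv (g \<sigma>) \<circ> g \<tau> \<in> D k)"
    by (rule exE[OF continuum_tree[OF assms(2-4)]])
  have g: "g \<sigma> \<in> G" "x \<in> C \<Longrightarrow> g \<sigma> x = x" "\<sigma> \<noteq> \<tau> \<Longrightarrow> inv (g \<sigma>) \<circ> g \<tau> \<in> D k" for \<sigma> \<tau> x k
    using g' by simp_all
  have "\<not> (\<forall>\<sigma> \<tau>. \<sigma> \<noteq> \<tau> \<longrightarrow> inv (g \<sigma>) \<circ> g \<tau> \<notin> H)"
    using assms(1) g(1) unfolding small_def by blast
  then obtain \<sigma> \<tau> where \<sigma>: "\<sigma> \<noteq> \<tau>" "inv (g \<sigma>) \<circ> g \<tau> \<in> H" by blast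
  have "inv (g \<sigma>) x = x" if "x \<in> C" for x using G_simps(1)[OF g(1), of \<sigma> x] g(2)[OF that] by simp
  then show ?thesis using \<sigma> g by (intro bexI[of _ "inv (g \<sigma>) \<circ> g \<tau>"]) auto
qed

section \<open>Generic tuples\<close>

definition invariant :: "nat \<Rightarrow> (nat \<Rightarrow> 'm \<Rightarrow> 'm) \<Rightarrow> 'm set \<Rightarrow> bool" where
  "invariant n X C \<longleftrightarrow> finite C \<and> C \<subseteq> V \<and> (\<forall>i<n. X i ` C = C)"

text \<open>An extension of finite systems, a system being a finite structure with \<open>n\<close>
  automorphisms. The automorphisms are given by elements acting on all of \<open>V\<close>, but only
  their action on \<open>C\<close> and \<open>D\<close> matters.\<close>

definition extends_on :: "nat \<Rightarrow> (nat \<Rightarrow> 'm \<Rightarrow> 'm) \<Rightarrow> 'm set \<Rightarrow> 'm set \<Rightarrow> (nat \<Rightarrow> 'm \<Rightarrow> 'm) \<Rightarrow> bool" where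
  "extends_on n X C D Y \<longleftrightarrow> invariant n X C \<and> invariant n Y D \<and> C \<subseteq> D \<and> (\<forall>i<n. \<forall>x\<in>C. Y i x = X i x)"

text \<open>The finite system given by \<open>D\<close> and \<open>Y\<close> embeds over
  \<open>C\<close> into the structure expanded by \<open>X\<close>. A group element stands for the
  embedding, as homogeneity permits.\<close>

definition realized :: "nat \<Rightarrow> (nat \<Rightarrow> 'm \<Rightarrow> 'm) \<Rightarrow> 'm set \<Rightarrow> 'm set \<Rightarrow> (nat \<Rightarrow> 'm \<Rightarrow> 'm) \<Rightarrow> bool" where
  "realized n X C D Y \<longleftrightarrow> (\<exists>e\<in>G. (\<forall>x\<in>C. e x = x) \<and> (\<forall>i<n. \<forall>x\<in>D. e (Y i x) = X i (e x)))"

text \<open>The tuple \<open>X 0, \<dots>, X (n - 1)\<close> is generic: the structure expanded by it is the limit of the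
  finite structures equipped with \<open>n\<close> automorphisms.\<close>

definition generic :: "nat \<Rightarrow> (nat \<Rightarrow> 'm \<Rightarrow> 'm) \<Rightarrow> bool" where
  "generic n X \<longleftrightarrow> (\<forall>i<n. X i \<in> G) \<and>
     (\<forall>F. finite F \<longrightarrow> F \<subseteq> V \<longrightarrow> (\<exists>C. F \<subseteq> C \<and> invariant n X C)) \<and>
     (\<forall>C D Y. (\<forall>i<n. Y i \<in> G) \<longrightarrow> extends_on n X C D Y \<longrightarrow> realized n X C D Y)"

lemma generic_0: "generic 0 X"
  using id_mem by (auto simp: generic_def invariant_def realized_def intro!: bexI[of _ id])

lemma generic_mem: "generic n X \<Longrightarrow> i < n \<Longrightarrow> X i \<in> G"
  and generic_cofinal: "generic n X \<Longrightarrow> finite F \<Longrightarrow> F \<subseteq> V \<Longrightarrow> \<exists>C. F \<subseteq> C \<and> invariant n X C"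
  and generic_realized: "generic n X \<Longrightarrow> (\<And>i. i < n \<Longrightarrow> Y i \<in> G) \<Longrightarrow> extends_on n X C D Y \<Longrightarrow> realized n X C D Y"
  unfolding generic_def by simp_all

lemma invariant_image: "invariant n X C \<Longrightarrow> i < n \<Longrightarrow> X i ` C = C"
  and invariant_mem: "invariant n X C \<Longrightarrow> i < n \<Longrightarrow> x \<in> C \<Longrightarrow> X i x \<in> C"
  unfolding invariant_def by blast+

lemma extends_onD:
  assumes "extends_on n X C D Y"
  shows "invariant n X C" "invariant n Y D" "C \<subseteq> D" "i < n \<Longrightarrow> x \<in> C \<Longrightarrow> Y i x = X i x"
  using assms by (auto simp: extends_on_def)

text \<open>A finite partial isomorphism between the expansions by \<open>X\<close> and
  \<open>X'\<close>. Only the values of \<open>h\<close> on \<open>C\<close> count, but a total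
  \<open>h\<close> can be composed and inverted freely.\<close>

definition match :: "nat \<Rightarrow> (nat \<Rightarrow> 'm \<Rightarrow> 'm) \<Rightarrow> (nat \<Rightarrow> 'm \<Rightarrow> 'm) \<Rightarrow> ('m \<Rightarrow> 'm) \<Rightarrow> 'm set \<Rightarrow> bool" where
  "match n X X' h C \<longleftrightarrow> h \<in> G \<and> invariant n X C \<and> (\<forall>i<n. \<forall>x\<in>C. h (X i x) = X' i (h x))"

lemma match_image:
  assumes "match n X X' h C"
  shows "invariant n X' (h ` C)"
proof -
  have "X' i ` h ` C = h ` C" if "i < n" for i
  proof -
    have "X' i ` h ` C = h ` X i ` C" using assms that by (auto simp: match_def image_comp intro!: image_cong)
    then show ?thesis using assms that by (simp add: match_def invariant_def)
  qed
  then show ?thesis using assms image_mem by (simp add: match_def invariant_def)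
qed

lemma match_sym:
  assumes "match n X X' h C"
  shows "match n X' X (inv h) (h ` C)"
proof -
  have h: "h \<in> G" using assms by (simp add: match_def)
  have "inv h (X' i (h x)) = X i (inv h (h x))" if "i < n" "x \<in> C" for i x
  proof -
    have "X' i (h x) = h (X i x)" using assms that by (simp add: match_def)
    then show ?thesis by (simp add: G_simps[OF h])
  qed
  then show ?thesis using match_image[OF assms] inv_mem[OF h] by (simp add: match_def)
qed

text \<open>Conjugating \<open>X\<close> by \<open>h\<close> turns an invariant set \<open>D\<close>
  around \<open>v\<close> into a system on the image of \<open>D\<close> that extends
  \<open>X'\<close> on the image of \<open>C\<close>. Genericity of \<open>X'\<close> realizes this
  extension by some \<open>e\<close> over the image of \<open>C\<close>, and
  \<open>e \<circ> h\<close> is the larger match.\<close>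

lemma match_forth:
  assumes X: "generic n X" and X': "generic n X'" and m: "match n X X' h C" and v: "v \<in> V"
  shows "\<exists>h' C'. match n X X' h' C' \<and> C \<subseteq> C' \<and> v \<in> C' \<and> (\<forall>x\<in>C. h' x = h x)"
proof -
  have h: "h \<in> G" and C: "finite C" "C \<subseteq> V" using m by (auto simp: match_def invariant_def)
  obtain D where D: "insert v C \<subseteq> D" "invariant n X D"
    using generic_cofinal[OF X, of "insert v C"] C v by auto
  let ?Y = "\<lambda>i. h \<circ> X i \<circ> inv h"
  have Yh: "?Y i (h x) = h (X i x)" for i x by (simp add: G_simps[OF h])
  have "?Y i ` h ` D = h ` D" if "i < n" for i
  proof -
    have "?Y i ` h ` D = h ` X i ` D" unfolding image_image Yh ..
    then show ?thesis using D that by (simp add: invariant_def)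
  qed
  then have YD: "invariant n ?Y (h ` D)"
    using D image_mem[OF h] by (simp add: invariant_def)
  have "extends_on n X' (h ` C) (h ` D) ?Y"
    using match_image[OF m] YD D m by (auto simp: extends_on_def Yh match_def G_simps[OF h])
  moreover have "?Y i \<in> G" if "i < n" for i
    using generic_mem[OF X that] h by (intro comp_mem inv_mem)
  ultimately have "realized n X' (h ` C) (h ` D) ?Y" by (intro generic_realized[OF X'])
  then obtain e where e: "e \<in> G" "\<forall>x\<in>h ` C. e x = x" "\<forall>i<n. \<forall>x\<in>h ` D. e (?Y i x) = X' i (e x)"
    unfolding realized_def by blast
  have "match n X X' (e \<circ> h) D"
    unfolding match_def
  proof (intro conjI allI impI ballI)
    fix i x assume "i < n" "x \<in> D"
    then have "e (?Y i (h x)) = X' i (e (h x))" using e(3) by blast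
    then show "(e \<circ> h) (X i x) = X' i ((e \<circ> h) x)" unfolding Yh by simp
  qed (use D comp_mem[OF e(1) h] in auto)
  then show ?thesis using D e(2) by (intro exI[of _ "e \<circ> h"] exI[of _ D]) auto
qed

text \<open>Going forth with the inverse match.\<close>

lemma match_back:
  assumes X: "generic n X" and X': "generic n X'" and m: "match n X X' h C" and v: "v \<in> V"
  shows "\<exists>h' C'. match n X X' h' C' \<and> C \<subseteq> C' \<and> v \<in> h' ` C' \<and> (\<forall>x\<in>C. h' x = h x)"
proof -
  have h: "h \<in> G" using m by (simp add: match_def)
  obtain k D where k: "match n X' X k D" "h ` C \<subseteq> D" "v \<in> D" "\<forall>x\<in>h ` C. k x = inv h x"
    using match_forth[OF X' X match_sym[OF m] v] by blast
  have kG: "k \<in> G" using k by (simp add: match_def)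
  have kh: "k (h x) = x" if "x \<in> C" for x using k(4) that by (simp add: G_simps[OF h])
  show ?thesis
  proof (intro exI conjI ballI)
    show "match n X X' (inv k) (k ` D)" by (rule match_sym[OF k(1)])
    show "C \<subseteq> k ` D" using kh k(2) by force
    show "v \<in> inv k ` k ` D" using k(3) by (simp add: G_simps[OF kG])
    fix x assume "x \<in> C"
    then have "inv k (k (h x)) = inv k x" by (simp add: kh)
    then show "inv k x = h x" by (simp add: G_simps[OF kG])
  qed
qed

text \<open>Back and forth along an enumeration of \<open>V\<close>, starting from \<open>h\<close>
  on \<open>C\<close>. The limit intertwines the tuples because each point lies, together with its
  images under \<open>X\<close>, in one of the invariant stages.\<close>

lemma generic_conjugate:
  assumes X: "generic n X" and X': "generic n X'" and m: "match n X X' h C"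
  shows "\<exists>g\<in>G. (\<forall>x\<in>C. g x = h x) \<and> (\<forall>i<n. g \<circ> X i = X' i \<circ> g)"
proof -
  from enumeration obtain v :: "nat \<Rightarrow> 'm" where v: "V \<subseteq> range v" ..
  define P :: "nat \<Rightarrow> ('m \<Rightarrow> 'm) \<times> 'm set \<Rightarrow> bool" where
    "P k s \<longleftrightarrow> match n X X' (fst s) (snd s) \<and> (k = 0 \<longrightarrow> s = (h, C))" for k s
  define Q :: "nat \<Rightarrow> ('m \<Rightarrow> 'm) \<times> 'm set \<Rightarrow> ('m \<Rightarrow> 'm) \<times> 'm set \<Rightarrow> bool" where
    "Q k s t \<longleftrightarrow> refines t s \<and> (v k \<in> V \<longrightarrow> v k \<in> snd t \<and> v k \<in> fst t ` snd t)" for k s t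
  have "\<exists>s. \<forall>k. P k (s k) \<and> Q k (s k) (s (Suc k))"
  proof (rule dependent_nat_choice[of P Q])
    show "\<exists>s. P 0 s" using m by (intro exI[of _ "(h, C)"]) (simp add: P_def)
  next
    fix s k assume "P k s"
    then have s: "match n X X' (fst s) (snd s)" by (simp add: P_def)
    show "\<exists>t. P (Suc k) t \<and> Q k s t"
    proof (cases "v k \<in> V")
      case False
      then show ?thesis using s by (intro exI[of _ s]) (simp add: P_def Q_def refines_refl)
    next
      case True
      obtain h1 C1 where 1: "match n X X' h1 C1" "snd s \<subseteq> C1" "v k \<in> C1" "\<forall>x\<in>snd s. h1 x = fst s x"
        using match_forth[OF X X' s True] by blast
      obtain h2 C2 where 2: "match n X X' h2 C2" "C1 \<subseteq> C2" "v k \<in> h2 ` C2" "\<forall>x\<in>C1. h2 x = h1 x"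
        using match_back[OF X X' 1(1) True] by blast
      have "P (Suc k) (h2, C2)" using 2 by (simp add: P_def)
      moreover have "Q k s (h2, C2)" using 1 2 by (auto simp: Q_def refines_def)
      ultimately show ?thesis by blast
    qed
  qed
  then obtain s where s: "\<forall>k. P k (s k) \<and> Q k (s k) (s (Suc k))" ..
  have M: "match n X X' (fst (s k)) (snd (s k))" and s0: "s 0 = (h, C)"
    and R: "refines (s (Suc k)) (s k)" for k
    using s by (simp_all add: P_def Q_def)
  have hit: "v k \<in> snd (s (Suc k))" "v k \<in> fst (s (Suc k)) ` snd (s (Suc k))" if "v k \<in> V" for k
    using s that by (simp_all add: Q_def)
  have inG: "fst (s k) \<in> G" and inv: "invariant n X (snd (s k))"
    and eq: "i < n \<Longrightarrow> x \<in> snd (s k) \<Longrightarrow> fst (s k) (X i x) = X' i (fst (s k) x)" for k i x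
    using M[of k] by (simp_all add: match_def)
  have cov: "y \<in> (\<Union>k. snd (s k))" "y \<in> (\<Union>k. fst (s k) ` snd (s k))" if "y \<in> V" for y
  proof -
    obtain k where y: "y = v k" using v \<open>y \<in> V\<close> by auto
    show "y \<in> (\<Union>k. snd (s k))" "y \<in> (\<Union>k. fst (s k) ` snd (s k))"
      by (rule UN_I[of "Suc k"]; use hit[of k] y \<open>y \<in> V\<close> in simp)+
  qed
  have "\<exists>g\<in>G. \<forall>k. \<forall>x\<in>snd (s k). g x = fst (s k) x"
  proof (rule chain_limit)
    show "snd (s k) \<subseteq> V" for k using inv by (simp add: invariant_def)
    show "snd (s k) \<subseteq> snd (s (Suc k))" "\<And>x. x \<in> snd (s k) \<Longrightarrow> fst (s (Suc k)) x = fst (s k) x" for k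
      using R[of k] by (auto simp: refines_def)
    show "V \<subseteq> (\<Union>k. snd (s k))" "V \<subseteq> (\<Union>k. fst (s k) ` snd (s k))" using cov by auto
  qed (rule inG)
  then obtain g where g: "g \<in> G" "\<forall>k. \<forall>x\<in>snd (s k). g x = fst (s k) x" ..
  have "g (X i x) = X' i (g x)" if i: "i < n" for i x
  proof (cases "x \<in> V")
    case True
    then obtain k where k: "x \<in> snd (s k)" using cov(1)[of x] by auto
    then have "X i x \<in> snd (s k)" using inv[of k] i by (auto simp: invariant_def)
    then show ?thesis using g(2) k eq[OF i k] by simp
  next
    case False
    then show ?thesis
      using outside[OF g(1)] outside[OF generic_mem[OF X i]] outside[OF generic_mem[OF X' i]] by simp
  qed
  moreover have "\<forall>x\<in>C. g x = h x" using g(2)[rule_format, of _ 0] by (simp add: s0)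
  ultimately show ?thesis using g(1) by (intro bexI[of _ g]) auto
qed

text \<open>A witness \<open>C\<close> depends only on the values of \<open>y\<close> on
  \<open>C\<close>, whence openness. For density, the extension property turns \<open>X\<close> and
  \<open>g\<close>, restricted to a large \<open>C\<close>, into permutations \<open>Y\<close> of a
  finite \<open>D\<close>. The first \<open>n\<close> of them form an extension of the system on
  \<open>C\<close>, which \<open>X\<close> realizes through some \<open>f\<close>; conjugating the
  last one by \<open>f\<close> gives \<open>y\<close>.\<close>

lemma dense_open_invariant:
  assumes X: "generic n X" and F: "finite F" "F \<subseteq> V"
  shows "dense_open {y \<in> G. \<exists>C. F \<subseteq> C \<and> invariant (Suc n) (X(n := y)) C}"
    (is "dense_open ?D")
  unfolding dense_open_def
proof (intro conjI ballI allI impI)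
  fix g assume "g \<in> ?D"
  then obtain C where C: "F \<subseteq> C" "invariant (Suc n) (X(n := g)) C" by blast
  have "h \<in> ?D" if "h \<in> G" "\<forall>x\<in>C. h x = g x" for h
  proof -
    have "h ` C = g ` C" using that by auto
    then have "invariant (Suc n) (X(n := h)) C" using C by (auto simp: invariant_def less_Suc_eq)
    then show ?thesis using that C by blast
  qed
  then show "\<exists>E. finite E \<and> E \<subseteq> V \<and> (\<forall>h\<in>G. (\<forall>x\<in>E. h x = g x) \<longrightarrow> h \<in> ?D)"
    using C by (intro exI[of _ C]) (simp add: invariant_def)
next
  fix g E assume g: "g \<in> G" and E: "finite E" "E \<subseteq> V"
  \<comment> \<open>With \<open>E\<close> and its image under \<open>g\<close> inside
    \<open>C\<close>, the requested values are kept by \<open>Y n\<close> and then fixed by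
    \<open>f\<close>.\<close>
  obtain C where C: "F \<union> E \<union> g ` E \<subseteq> C" "invariant n X C"
    using generic_cofinal[OF X, of "F \<union> E \<union> g ` E"] F E image_mem[OF g E(2)] by auto
  let ?Z = "X(n := g)"
  have Z: "?Z i \<in> G" if "i < Suc n" for i using generic_mem[OF X] g that by (auto simp: less_Suc_eq)
  obtain D Y where D: "finite D" "C \<subseteq> D" "D \<subseteq> V"
    and Y: "\<forall>i<Suc n. Y i \<in> G \<and> Y i ` D = D \<and> (\<forall>a\<in>C. ?Z i a \<in> C \<longrightarrow> Y i a = ?Z i a)"
    using extension[of C "Suc n" ?Z] C Z by (auto simp: invariant_def)
  have "X i x \<in> C" if "i < n" "x \<in> C" for i x using C(2) that by (auto simp: invariant_def)
  then have YX: "\<forall>i<n. \<forall>x\<in>C. Y i x = X i x" using Y by (auto simp: less_Suc_eq)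
  then have "extends_on n X C D Y" using C(2) D Y by (simp add: extends_on_def invariant_def)
  then have "realized n X C D Y" using Y by (intro generic_realized[OF X]) simp
  then obtain f where f: "f \<in> G" "\<forall>x\<in>C. f x = x" "\<forall>i<n. \<forall>x\<in>D. f (Y i x) = X i (f x)"
    unfolding realized_def by blast
  let ?y = "f \<circ> Y n \<circ> inv f"
  have y: "?y (f x) = f (Y n x)" for x by (simp add: G_simps[OF f(1)])
  have YG: "Y n \<in> G" "Y n ` D = D" using Y by simp_all
  have "X i ` f ` D = f ` D" if "i < n" for i
  proof -
    have "X i ` f ` D = f ` Y i ` D" using f(3) that by (auto simp: image_image)
    then show ?thesis using Y that by simp
  qed
  moreover have "?y ` f ` D = f ` D"
  proof -
    have "?y ` f ` D = f ` Y n ` D" unfolding image_image y ..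
    then show ?thesis using YG by simp
  qed
  ultimately have "invariant (Suc n) (X(n := ?y)) (f ` D)"
    using D image_mem[OF f(1)] by (auto simp: invariant_def less_Suc_eq)
  moreover have "F \<subseteq> f ` D"
  proof
    fix x assume "x \<in> F"
    then have "x \<in> C" "x \<in> D" using C D by auto
    then show "x \<in> f ` D" using f(2) by force
  qed
  moreover have "?y \<in> G" using f(1) YG by (intro comp_mem inv_mem)
  moreover have "?y x = g x" if "x \<in> E" for x
  proof -
    have "x \<in> C" "g x \<in> C" using C that by auto
    then have "f x = x" "f (g x) = g x" "Y n x = g x" using f(2) Y by auto
    then show ?thesis using y[of x] by simp
  qed
  ultimately show "\<exists>h\<in>?D. \<forall>x\<in>E. h x = g x" by (intro bexI[of _ ?y]) auto
qed auto

text \<open>Openness: a realization by \<open>e\<close> depends on \<open>y\<close> only on the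
  image of \<open>D\<close>, and failure of the premise only on \<open>C\<close>. Density: near
  \<open>g\<close> there is \<open>y\<close> with a finite invariant set \<open>C'\<close>; the
  system on \<open>C'\<close> is freely amalgamated with \<open>D\<close> over \<open>C\<close>, the
  first \<open>n\<close> coordinates of the amalgam are realized by some \<open>f\<close> over
  \<open>C'\<close>, and the last coordinate is conjugated by \<open>f\<close>.\<close>

lemma dense_open_realized:
  assumes X: "generic n X" and Y: "\<And>i. i < Suc n \<Longrightarrow> Y i \<in> G"
  shows "dense_open {y \<in> G. extends_on (Suc n) (X(n := y)) C D Y \<longrightarrow> realized (Suc n) (X(n := y)) C D Y}"
    (is "dense_open ?D")
  unfolding dense_open_def
proof (intro conjI ballI allI impI)
  fix g assume "g \<in> ?D"
  then have g: "g \<in> G" "extends_on (Suc n) (X(n := g)) C D Y \<Longrightarrow> realized (Suc n) (X(n := g)) C D Y" by auto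
  show "\<exists>E. finite E \<and> E \<subseteq> V \<and> (\<forall>h\<in>G. (\<forall>x\<in>E. h x = g x) \<longrightarrow> h \<in> ?D)"
  proof (cases "extends_on (Suc n) (X(n := g)) C D Y")
    case True
    then obtain e where e: "e \<in> G" "\<forall>x\<in>C. e x = x"
      "\<And>i x. i < Suc n \<Longrightarrow> x \<in> D \<Longrightarrow> e (Y i x) = (X(n := g)) i (e x)"
      using g(2) unfolding realized_def by blast
    have D: "finite D" "D \<subseteq> V" using True by (auto simp: extends_on_def invariant_def)
    have "h \<in> ?D" if h: "h \<in> G" "\<forall>x\<in>e ` D. h x = g x" for h
    proof -
      have "e (Y i x) = (X(n := h)) i (e x)" if "i < Suc n" "x \<in> D" for i x
        using e(3)[OF that] h(2) that by (simp split: if_splits)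
      then have "realized (Suc n) (X(n := h)) C D Y" using e unfolding realized_def by blast
      then show ?thesis using h by simp
    qed
    then show ?thesis using D image_mem[OF e(1)] by (intro exI[of _ "e ` D"]) simp
  next
    case False
    show ?thesis
    proof (cases "finite C \<and> C \<subseteq> V")
      case True
      have "h \<in> ?D" if h: "h \<in> G" "\<forall>x\<in>C. h x = g x" for h
      proof -
        have "h ` C = g ` C" using h by auto
        then have "\<not> extends_on (Suc n) (X(n := h)) C D Y"
          using False h(2) by (auto simp: extends_on_def invariant_def less_Suc_eq)
        then show ?thesis using h by simp
      qed
      then show ?thesis using True by (intro exI[of _ C]) simp
    next
      case False
      then show ?thesis by (intro exI[of _ "{}"]) (auto simp: extends_on_def invariant_def)
    qed
  qed
next
  fix g E assume g: "g \<in> G" and E: "finite E" "E \<subseteq> V"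
  show "\<exists>h\<in>?D. \<forall>x\<in>E. h x = g x"
  proof (cases "extends_on (Suc n) (X(n := g)) C D Y")
    case False
    then show ?thesis using g by (intro bexI[of _ g]) auto
  next
    case ext: True
    then have C: "finite C" "C \<subseteq> V" "C \<subseteq> D" and D: "finite D" "D \<subseteq> V"
      by (auto simp: extends_on_def invariant_def intro: finite_subset)
    \<comment> \<open>Amalgamation needs finite systems, so \<open>g\<close> is first replaced by a
      nearby element that leaves a finite set around \<open>C\<close> and \<open>E\<close>
      invariant.\<close>
    obtain y where y: "y \<in> {y \<in> G. \<exists>C'. C \<union> E \<subseteq> C' \<and> invariant (Suc n) (X(n := y)) C'}" "\<forall>x\<in>C \<union> E. y x = g x"
      using dense_open_invariant[OF X, of "C \<union> E"] C E g unfolding dense_open_def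
      by (metis (no_types, lifting) finite_UnI le_sup_iff)
    then obtain C' where C': "C \<union> E \<subseteq> C'" "invariant (Suc n) (X(n := y)) C'" and yG: "y \<in> G" by blast
    let ?X = "X(n := y)"
    have "y ` C = g ` C" using y(2) by auto
    then have ext: "extends_on (Suc n) ?X C D Y"
      using ext y(2) by (auto simp: extends_on_def invariant_def less_Suc_eq)
    have XG: "?X i \<in> G" if "i < Suc n" for i using that generic_mem[OF X] yG by (auto simp: less_Suc_eq)
    have fC': "finite C'" "C' \<subseteq> V" using C' by (auto simp: invariant_def)
    \<comment> \<open>\<open>k\<close> moves \<open>D\<close> over \<open>C\<close> into free
      position with respect to \<open>C'\<close>; \<open>?Y\<close> below is the system moved
      along.\<close>
    obtain k where k: "k \<in> G" "\<forall>x\<in>C. k x = x"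
      and am: "\<And>u v. u \<in> G \<Longrightarrow> v \<in> G \<Longrightarrow> u ` C' = C' \<Longrightarrow> v ` k ` D = k ` D \<Longrightarrow> u ` C = C \<Longrightarrow> \<forall>x\<in>C. u x = v x \<Longrightarrow>
          \<exists>w\<in>G. (\<forall>x\<in>C'. w x = u x) \<and> (\<forall>x\<in>k ` D. w x = v x)"
      using amalgamation[OF fC'(1) D(1) fC'(2) D(2) _ C(3)] C' by auto
    let ?Y = "\<lambda>i. k \<circ> Y i \<circ> inv k"
    have Yk: "?Y i (k x) = k (Y i x)" for i x by (simp add: G_simps[OF k(1)])
    have YD: "?Y i ` k ` D = k ` D" if "i < Suc n" for i
    proof -
      have "?Y i ` k ` D = k ` Y i ` D" unfolding image_image Yk ..
      then show ?thesis using ext that by (simp add: extends_on_def invariant_def)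
    qed
    have "\<exists>w\<in>G. (\<forall>x\<in>C'. w x = ?X i x) \<and> (\<forall>x\<in>k ` D. w x = ?Y i x)" if i: "i < Suc n" for i
    proof (rule am)
      show "?X i \<in> G" by (rule XG[OF i])
      show "?Y i \<in> G" using Y[OF i] k(1) by (intro comp_mem inv_mem)
      show "?X i ` C' = C'" "?X i ` C = C"
        using invariant_image[OF C'(2) i] invariant_image[OF extends_onD(1)[OF ext] i] .
      show "?Y i ` k ` D = k ` D" by (rule YD[OF i])
      show "\<forall>x\<in>C. ?X i x = ?Y i x"
      proof
        fix x assume x: "x \<in> C"
        have Yx: "Y i x = ?X i x" by (rule extends_onD(4)[OF ext i x])
        have "?X i x \<in> C" by (rule invariant_mem[OF extends_onD(1)[OF ext] i x])
        then have "k (?X i x) = ?X i x" using k(2) by blast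
        then show "?X i x = ?Y i x" using Yk[of i x] k(2) x Yx by simp
      qed
    qed
    then have "\<forall>i\<in>{..<Suc n}. \<exists>w. w \<in> G \<and> (\<forall>x\<in>C'. w x = ?X i x) \<and> (\<forall>x\<in>k ` D. w x = ?Y i x)"
      unfolding Bex_def lessThan_iff by simp
    from bchoice[OF this] obtain W where
      "\<forall>i\<in>{..<Suc n}. W i \<in> G \<and> (\<forall>x\<in>C'. W i x = ?X i x) \<and> (\<forall>x\<in>k ` D. W i x = ?Y i x)" ..
    then have W: "W i \<in> G" "\<forall>x\<in>C'. W i x = ?X i x" "\<forall>x\<in>k ` D. W i x = ?Y i x" if "i < Suc n" for i
      using that by simp_all
    let ?D' = "C' \<union> k ` D"
    have WD: "W i ` ?D' = ?D'" if "i < Suc n" for i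
    proof -
      have "W i ` C' = ?X i ` C'" using W(2)[OF that] by (intro image_cong) simp_all
      moreover have "W i ` k ` D = ?Y i ` k ` D"
        by (rule image_cong[OF refl]) (rule W(3)[OF that, rule_format])
      ultimately show ?thesis using YD[OF that] invariant_image[OF C'(2) that] by (simp add: image_Un)
    qed
    have "extends_on n X C' ?D' W"
      unfolding extends_on_def
    proof (intro conjI allI impI ballI)
      have "X i ` C' = C'" if "i < n" for i using invariant_image[OF C'(2), of i] that by simp
      then show "invariant n X C'" using fC' by (simp add: invariant_def)
      show "invariant n W ?D'" using fC' D WD image_mem[OF k(1) D(2)] by (simp add: invariant_def)
      fix i x assume "i < n" "x \<in> C'"
      then show "W i x = X i x" using W(2)[of i] by simp
    qed simp
    then have "realized n X C' ?D' W" using W(1) by (intro generic_realized[OF X]) simp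
    then obtain f where f: "f \<in> G" "\<forall>x\<in>C'. f x = x" "\<forall>i<n. \<forall>x\<in>?D'. f (W i x) = X i (f x)"
      unfolding realized_def by blast
    let ?y = "f \<circ> W n \<circ> inv f"
    have yf: "?y (f x) = f (W n x)" for x by (simp add: G_simps[OF f(1)])
    have "(f \<circ> k) (Y i x) = (X(n := ?y)) i ((f \<circ> k) x)" if i: "i < Suc n" and x: "x \<in> D" for i x
    proof -
      have "f (W i (k x)) = (X(n := ?y)) i (f (k x))"
        using f(3) yf[of "k x"] i x by (cases "i = n") simp_all
      moreover have "W i (k x) = k (Y i x)" using W(3)[OF i] x Yk[of i x] by simp
      ultimately show ?thesis by simp
    qed
    moreover have "(f \<circ> k) x = x" if "x \<in> C" for x using k(2) f(2) C' that by auto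
    ultimately have "realized (Suc n) (X(n := ?y)) C D Y"
      unfolding realized_def using comp_mem[OF f(1) k(1)] by blast
    moreover have "?y \<in> G" using W(1)[of n] f(1) by (intro comp_mem inv_mem) simp_all
    moreover have "?y x = g x" if "x \<in> E" for x
    proof -
      have x: "x \<in> C'" using C' that by auto
      have "W n x = y x" using W(2)[of n] x by simp
      moreover have "y x \<in> C'" using invariant_mem[OF C'(2), of n x] x by simp
      ultimately have "?y (f x) = y x" using yf[of x] f(2) by simp
      then show ?thesis using f(2) x y(2) that by simp
    qed
    ultimately show ?thesis by (intro bexI[of _ ?y]) auto
  qed
qed auto

lemma generic_Suc:
  assumes X: "generic n X" and y: "y \<in> G"
    and inv: "\<And>F. finite F \<Longrightarrow> F \<subseteq> V \<Longrightarrow> \<exists>C. F \<subseteq> C \<and> invariant (Suc n) (X(n := y)) C"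
    and real: "\<And>C D Y. (\<And>i. i < Suc n \<Longrightarrow> Y i \<in> G) \<Longrightarrow> extends_on (Suc n) (X(n := y)) C D Y \<Longrightarrow>
      realized (Suc n) (X(n := y)) C D Y"
  shows "generic (Suc n) (X(n := y))"
  unfolding generic_def
proof (intro conjI allI impI)
  show "(X(n := y)) i \<in> G" if "i < Suc n" for i using generic_mem[OF X, of i] y that by (cases "i = n") simp_all
qed (use inv real in auto)

text \<open>Whether a finite extension is realized only depends on the finitely many values that are
  tabulated here, so countably many dense open sets suffice for genericity.\<close>

definition table :: "nat \<Rightarrow> 'm set \<Rightarrow> (nat \<Rightarrow> 'm \<Rightarrow> 'm) \<Rightarrow> nat \<Rightarrow> 'm \<Rightarrow> 'm" where
  "table n D Y = (\<lambda>i\<in>{..<n}. restrict (Y i) D)"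

lemma extends_on_table: "extends_on n X C D (table n D Y) \<longleftrightarrow> extends_on n X C D Y"
  by (auto simp: extends_on_def invariant_def table_def subset_iff)

lemma realized_table: "realized n X C D (table n D Y) \<longleftrightarrow> realized n X C D Y"
  by (auto simp: realized_def table_def)

lemma countable_tables:
  "countable {(C, D, table n D Y) |C D Y. finite D \<and> D \<subseteq> V \<and> C \<subseteq> D \<and> (\<forall>i<n. Y i ` D = D)}"
    (is "countable ?T")
proof -
  have cF: "countable {D. finite D \<and> D \<subseteq> V}" by (rule countable_Collect_finite_subset[OF countable_V])
  have "table n D Y \<in> {..<n} \<rightarrow>\<^sub>E D \<rightarrow>\<^sub>E D" if "\<forall>i<n. Y i ` D = D" for D Y
  proof -
    have "Y i x \<in> D" if "i < n" "x \<in> D" for i x using \<open>\<forall>i<n. Y i ` D = D\<close> that by blast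
    then show ?thesis by (auto simp: table_def)
  qed
  then have "?T \<subseteq> (SIGMA C:{D. finite D \<and> D \<subseteq> V}. SIGMA D:{D. finite D \<and> D \<subseteq> V}. {..<n} \<rightarrow>\<^sub>E D \<rightarrow>\<^sub>E D)"
    by (auto dest: finite_subset)
  moreover have "countable \<dots>"
    by (intro countable_SIGMA cF countable_finite finite_PiE) auto
  ultimately show ?thesis by (rule countable_subset)
qed

section \<open>Small subgroups are open\<close>

text \<open>The elements that extend \<open>X\<close> generically contain a countable intersection
  of dense open sets, and a translate by \<open>g\<close> is again of this kind. The factor
  \<open>g\<close> allows the new coordinate to be sought in any prescribed left coset of
  \<open>H\<close>.\<close>

lemma small_generic:
  assumes H: "small H" and X: "generic n X" and C: "finite C" "C \<subseteq> V" and g: "g \<in> G"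
  shows "\<exists>h\<in>H. (\<forall>x\<in>C. h x = x) \<and> generic (Suc n) (X(n := g \<circ> h))"
proof -
  define I where "I F = {y \<in> G. \<exists>C. F \<subseteq> C \<and> invariant (Suc n) (X(n := y)) C}" for F
  define E where "E t = (case t of (C, D, Y) \<Rightarrow> {y \<in> G. extends_on (Suc n) (X(n := y)) C D Y \<longrightarrow>
      realized (Suc n) (X(n := y)) C D Y})" for t
  let ?T = "{(C, D, table (Suc n) D Y) |C D Y. (finite D \<and> D \<subseteq> V \<and> C \<subseteq> D \<and> (\<forall>i<Suc n. Y i ` D = D)) \<and>
      (\<forall>i<Suc n. Y i \<in> G)}"
  define \<D> where "\<D> = I ` {F. finite F \<and> F \<subseteq> V} \<union> E ` ?T"
  have "countable ?T" by (rule countable_subset[OF _ countable_tables[of "Suc n"]]) blast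
  then have cD: "countable \<D>"
    unfolding \<D>_def using countable_Collect_finite_subset[OF countable_V] by simp
  have D: "dense_open A" if "A \<in> \<D>" for A
    using that unfolding \<D>_def
  proof
    assume "A \<in> I ` {F. finite F \<and> F \<subseteq> V}"
    then show ?thesis using dense_open_invariant[OF X] by (auto simp: I_def)
  next
    assume "A \<in> E ` ?T"
    then obtain C D Y where "A = E (C, D, table (Suc n) D Y)" "\<forall>i<Suc n. Y i \<in> G" by auto
    then show ?thesis using dense_open_realized[OF X, of Y C D]
      by (simp add: E_def extends_on_table realized_table)
  qed
  have ne: "\<D> \<noteq> {}" by (auto simp: \<D>_def)
  have "dense_open {h \<in> G. g \<circ> h \<in> from_nat_into \<D> k}" for k
    using D[OF from_nat_into[OF ne]] g by (rule dense_open_translate)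
  from small_meets_dense_open[where D = "\<lambda>k. {h \<in> G. g \<circ> h \<in> from_nat_into \<D> k}", OF H this C]
  obtain h where h: "h \<in> H" "\<forall>x\<in>C. h x = x" "\<forall>k. h \<in> {h \<in> G. g \<circ> h \<in> from_nat_into \<D> k}" by blast
  let ?y = "g \<circ> h"
  have y: "?y \<in> A" if "A \<in> \<D>" for A
  proof -
    from from_nat_into_surj[OF cD that] obtain k where "from_nat_into \<D> k = A" ..
    then show ?thesis using h(3) by blast
  qed
  have "generic (Suc n) (X(n := ?y))"
  proof (rule generic_Suc[OF X])
    show "?y \<in> G" using h(3) g comp_mem by blast
    show "\<exists>C. F \<subseteq> C \<and> invariant (Suc n) (X(n := ?y)) C" if "finite F" "F \<subseteq> V" for F
      using y[of "I F"] that by (simp add: I_def \<D>_def)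
    fix C D Y assume Y: "\<And>i. i < Suc n \<Longrightarrow> Y i \<in> G" and ext: "extends_on (Suc n) (X(n := ?y)) C D Y"
    have "(C, D, table (Suc n) D Y) \<in> ?T"
      using Y extends_onD[OF ext] by (auto simp: invariant_def)
    then have "E (C, D, table (Suc n) D Y) \<in> \<D>" unfolding \<D>_def by (intro UnI2 imageI)
    then have "?y \<in> E (C, D, table (Suc n) D Y)" by (rule y)
    then show "realized (Suc n) (X(n := ?y)) C D Y"
      using ext by (simp add: E_def extends_on_table realized_table)
  qed
  then show ?thesis using h(1,2) by (intro bexI[of _ h] conjI)
qed

lemma smallD:
  assumes "small H"
  shows "h \<in> H \<Longrightarrow> h \<in> G" "id \<in> H" "g \<in> H \<Longrightarrow> h \<in> H \<Longrightarrow> g \<circ> h \<in> H" "h \<in> H \<Longrightarrow> inv h \<in> H"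
  using assms by (auto simp: small_def)

lemma mem_cancel:
  assumes H: "small H" and "g \<in> G"
  shows "h \<in> H \<Longrightarrow> h \<circ> g \<in> H \<longleftrightarrow> g \<in> H" "h \<in> H \<Longrightarrow> g \<circ> h \<in> H \<longleftrightarrow> g \<in> H"
proof -
  assume h: "h \<in> H"
  have 1: "inv h \<circ> (h \<circ> g) = g" and 2: "(g \<circ> h) \<circ> inv h = g"
    by (simp_all add: fun_eq_iff G_simps[OF smallD(1)[OF H h]])
  show "h \<circ> g \<in> H \<longleftrightarrow> g \<in> H" using smallD(3)[OF H smallD(4)[OF H h], of "h \<circ> g"] smallD(3)[OF H h, of g] 1 by metis
  show "g \<circ> h \<in> H \<longleftrightarrow> g \<in> H" using smallD(3)[OF H _ smallD(4)[OF H h], of "g \<circ> h"] smallD(3)[OF H _ h, of g] 2 by metis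
qed

text \<open>Take a generic \<open>y0\<close> in \<open>H\<close>, a finite set \<open>C\<close>
  around \<open>E\<close> invariant under the extended tuple, and \<open>k\<close> outside
  \<open>H\<close> that fixes \<open>C\<close>. A correction \<open>h'\<close> in \<open>H\<close>
  fixing \<open>C\<close> makes \<open>y0 \<circ> k \<circ> h'\<close> generic without leaving the
  complement of \<open>H\<close>. Both extended tuples act alike on \<open>C\<close>, so some
  \<open>h\<close> fixing \<open>C\<close> conjugates one to the other; having the same first
  \<open>n\<close> coordinates, they force \<open>h\<close> to commute with these.\<close>

lemma split_generic:
  assumes H: "small H" and not_open: "\<And>S. finite S \<Longrightarrow> S \<subseteq> V \<Longrightarrow> \<exists>g\<in>G - H. \<forall>x\<in>S. g x = x"
    and X: "generic n X" and E: "finite E" "E \<subseteq> V"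
  shows "\<exists>y0 y1 h. y0 \<in> H \<and> y1 \<in> G - H \<and> h \<in> G \<and> (\<forall>x\<in>E. h x = x) \<and>
     generic (Suc n) (X(n := y0)) \<and> generic (Suc n) (X(n := y1)) \<and>
     (\<forall>i<n. h \<circ> X i = X i \<circ> h) \<and> h \<circ> y1 = y0 \<circ> h"
proof -
  obtain y0 where y0: "y0 \<in> H" "generic (Suc n) (X(n := y0))"
    using small_generic[OF H X, of "{}" id] id_mem by (auto simp: o_def)
  have y0G: "y0 \<in> G" using y0 smallD(1)[OF H] by blast
  obtain C where C: "E \<subseteq> C" "invariant (Suc n) (X(n := y0)) C"
    using generic_cofinal[OF y0(2) E] by blast
  have fC: "finite C" "C \<subseteq> V" using C by (auto simp: invariant_def)
  obtain k where k: "k \<in> G - H" "\<forall>x\<in>C. k x = x" using not_open[OF fC] by blast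
  have yk: "y0 \<circ> k \<in> G" using y0G k by (intro comp_mem) auto
  obtain h' where h': "h' \<in> H" "\<forall>x\<in>C. h' x = x" "generic (Suc n) (X(n := y0 \<circ> k \<circ> h'))"
    using small_generic[OF H X fC yk] by blast
  let ?y1 = "y0 \<circ> k \<circ> h'"
  have y1G: "?y1 \<in> G" using yk smallD(1)[OF H h'(1)] by (rule comp_mem)
  have "?y1 \<notin> H" using mem_cancel(2)[OF H yk h'(1)] mem_cancel(1)[OF H _ y0(1), of k] k(1) by blast
  have agree: "?y1 x = y0 x" if "x \<in> C" for x using k(2) h'(2) that by simp
  have "match (Suc n) (X(n := ?y1)) (X(n := y0)) id C"
    unfolding match_def invariant_def
  proof (intro conjI allI impI ballI fC id_mem)
    fix i assume i: "i < Suc n"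
    have "(X(n := ?y1)) i x = (X(n := y0)) i x" if "x \<in> C" for x using agree[OF that] by simp
    then have "(X(n := ?y1)) i ` C = (X(n := y0)) i ` C" by (rule image_cong[OF refl])
    then show "(X(n := ?y1)) i ` C = C" using invariant_image[OF C(2) i] by simp
    show "id ((X(n := ?y1)) i x) = (X(n := y0)) i (id x)" if "x \<in> C" for x using agree[OF that] by simp
  qed
  from generic_conjugate[OF h'(3) y0(2) this] obtain h where
    h: "h \<in> G" "\<forall>x\<in>C. h x = id x" "\<forall>i<Suc n. h \<circ> (X(n := ?y1)) i = (X(n := y0)) i \<circ> h" by blast
  have "\<forall>x\<in>E. h x = x" using C(1) h(2) by auto
  moreover have "\<forall>i<n. h \<circ> X i = X i \<circ> h"
  proof (intro allI impI)
    fix i assume "i < n"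
    then show "h \<circ> X i = X i \<circ> h" using h(3)[rule_format, of i] by simp
  qed
  moreover have "h \<circ> ?y1 = y0 \<circ> h" using h(3)[rule_format, of n] by simp
  ultimately show ?thesis using y0 h'(3) h(1) y1G \<open>?y1 \<notin> H\<close> by blast
qed

theorem small_is_open:
  assumes H: "small H"
  shows "\<exists>S. finite S \<and> S \<subseteq> V \<and> (\<forall>g\<in>G. (\<forall>x\<in>S. g x = x) \<longrightarrow> g \<in> H)"
proof (rule ccontr)
  assume no: "\<not> ?thesis"
  have not_open: "\<exists>g\<in>G - H. \<forall>x\<in>S. g x = x" if "finite S" "S \<subseteq> V" for S
    using no that by blast
  from enumeration obtain v :: "nat \<Rightarrow> 'm" where v: "V \<subseteq> range v" ..
  define good where "good n X E z \<longleftrightarrow> (case z of (y0, y1, h) \<Rightarrow> y0 \<in> H \<and> y1 \<in> G - H \<and> h \<in> G \<and> (\<forall>x\<in>E. h x = x) \<and>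
     generic (Suc n) (X(n := y0)) \<and> generic (Suc n) (X(n := y1)) \<and>
     (\<forall>i<n. h \<circ> X i = X i \<circ> h) \<and> h \<circ> y1 = y0 \<circ> h)" for n X E z
  \<comment> \<open>The choice is a function of the stage, the tuple and the set alone; branches
    with a common past therefore make the same choice.\<close>
  define pick where "pick n X E = (SOME z. good n X E z)" for n X E
  have pick: "good n X E (pick n X E)" if "generic n X" "finite E" "E \<subseteq> V" for n X E
  proof -
    have "\<exists>z. good n X E z" using split_generic[OF H not_open that] by (simp add: good_def)
    then show ?thesis unfolding pick_def by (rule someI_ex)
  qed
  \<comment> \<open>On these points \<open>w\<close> is frozen: they include the first
    \<open>n\<close> points of the enumeration and, through the preimages, put these points into the
    range.\<close>
  define fix_set where "fix_set n w = ({v i |i. i < n} \<union> {inv w (v i) |i. i < n}) \<inter> V" for n w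
  have fix_set: "finite (fix_set n w)" "fix_set n w \<subseteq> V" for n w
  proof -
    have "fix_set n w \<subseteq> v ` {..<n} \<union> (\<lambda>i. inv w (v i)) ` {..<n}" by (auto simp: fix_set_def)
    then show "finite (fix_set n w)" by (rule finite_subset) simp
  qed (simp add: fix_set_def)
  \<comment> \<open>A state is the tuple chosen so far and the partial product of conjugators. A
    branch through \<open>n\<close> takes the coordinate outside \<open>H\<close> and multiplies by
    the conjugator; other branches take the coordinate in \<open>H\<close> and leave the product
    alone.\<close>
  define st where "st \<sigma> = rec_nat (\<lambda>_. id, id)
     (\<lambda>n (X, w). case pick n X (fix_set n w) of (y0, y1, h) \<Rightarrow>
        if n \<in> \<sigma> then (X(n := y1), w \<circ> h) else (X(n := y0), w))" for \<sigma> :: "nat set"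
  define X where "X \<sigma> n = fst (st \<sigma> n)" for \<sigma> n
  define w where "w \<sigma> n = snd (st \<sigma> n)" for \<sigma> n
  define y0 where "y0 \<sigma> n = fst (pick n (X \<sigma> n) (fix_set n (w \<sigma> n)))" for \<sigma> n
  define y1 where "y1 \<sigma> n = fst (snd (pick n (X \<sigma> n) (fix_set n (w \<sigma> n))))" for \<sigma> n
  define h where "h \<sigma> n = snd (snd (pick n (X \<sigma> n) (fix_set n (w \<sigma> n))))" for \<sigma> n
  have st_0: "X \<sigma> 0 = (\<lambda>_. id)" "w \<sigma> 0 = id" for \<sigma> by (simp_all add: X_def w_def st_def)
  have X_Suc: "X \<sigma> (Suc n) = (X \<sigma> n)(n := if n \<in> \<sigma> then y1 \<sigma> n else y0 \<sigma> n)"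
    and w_Suc: "w \<sigma> (Suc n) = (if n \<in> \<sigma> then w \<sigma> n \<circ> h \<sigma> n else w \<sigma> n)" for \<sigma> n
    by (simp_all add: X_def w_def y0_def y1_def h_def st_def split: prod.splits)
  have pick': "generic n (X \<sigma> n) \<Longrightarrow> good n (X \<sigma> n) (fix_set n (w \<sigma> n)) (y0 \<sigma> n, y1 \<sigma> n, h \<sigma> n)" for \<sigma> n
    using pick[OF _ fix_set] by (simp add: y0_def y1_def h_def)
  have gen: "generic n (X \<sigma> n) \<and> w \<sigma> n \<in> G" for \<sigma> n
  proof (induction n)
    case 0
    show ?case unfolding st_0 using generic_0 id_mem by blast
  next
    case (Suc n)
    then have G: "w \<sigma> n \<in> G" and p: "good n (X \<sigma> n) (fix_set n (w \<sigma> n)) (y0 \<sigma> n, y1 \<sigma> n, h \<sigma> n)"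
      using pick' by blast+
    have "h \<sigma> n \<in> G" and gs: "generic (Suc n) ((X \<sigma> n)(n := y0 \<sigma> n))" "generic (Suc n) ((X \<sigma> n)(n := y1 \<sigma> n))"
      using p unfolding good_def prod.case by blast+
    then have "w \<sigma> n \<circ> h \<sigma> n \<in> G" using G comp_mem by blast
    then show ?case using G gs unfolding X_Suc w_Suc
      by (cases "n \<in> \<sigma>") (simp_all only: if_True if_False not_False_eq_True simp_thms)
  qed
  have wG: "w \<sigma> n \<in> G" for \<sigma> n using gen by blast
  have good: "y0 \<sigma> n \<in> H" "y1 \<sigma> n \<in> G - H" "h \<sigma> n \<in> G" "\<And>x. x \<in> fix_set n (w \<sigma> n) \<Longrightarrow> h \<sigma> n x = x"
    "\<And>i. i < n \<Longrightarrow> h \<sigma> n \<circ> X \<sigma> n i = X \<sigma> n i \<circ> h \<sigma> n" "h \<sigma> n \<circ> y1 \<sigma> n = y0 \<sigma> n \<circ> h \<sigma> n" for \<sigma> n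
    using pick'[of n \<sigma>] gen[of n \<sigma>] unfolding good_def prod.case by blast+
  have w_fix: "w \<sigma> (Suc n) x = w \<sigma> n x" if "x \<in> fix_set n (w \<sigma> n)" for \<sigma> n x
    using good(4)[OF that] by (simp add: w_Suc)
  have fix_Suc: "fix_set n (w \<sigma> n) \<subseteq> fix_set (Suc n) (w \<sigma> (Suc n))" for \<sigma> n
  proof
    fix x assume x: "x \<in> fix_set n (w \<sigma> n)"
    show "x \<in> fix_set (Suc n) (w \<sigma> (Suc n))"
    proof (cases "\<exists>i<n. x = v i")
      case True
      then show ?thesis using x by (auto simp: fix_set_def less_Suc_eq)
    next
      case False
      then obtain i where i: "i < n" "x = inv (w \<sigma> n) (v i)" using x by (auto simp: fix_set_def)
      have "w \<sigma> (Suc n) x = v i" using w_fix[OF x] i by (simp add: G_simps[OF wG])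
      then have "inv (w \<sigma> (Suc n)) (v i) = x" using G_simps(1)[OF wG] by metis
      then show ?thesis using i x by (auto simp: fix_set_def intro!: exI[of _ i])
    qed
  qed
  have "\<exists>g\<in>G. \<forall>n. \<forall>x\<in>fix_set n (w \<sigma> n). g x = w \<sigma> n x" for \<sigma>
  proof (rule chain_limit)
    have "x \<in> (\<Union>n. fix_set n (w \<sigma> n))" "x \<in> (\<Union>n. w \<sigma> n ` fix_set n (w \<sigma> n))" if "x \<in> V" for x
    proof -
      obtain i where i: "x = v i" using v \<open>x \<in> V\<close> by auto
      have "v i \<in> fix_set (Suc i) (w \<sigma> (Suc i))" using i \<open>x \<in> V\<close> by (auto simp: fix_set_def)
      then show "x \<in> (\<Union>n. fix_set n (w \<sigma> n))" using i by blast
      have "inv (w \<sigma> (Suc i)) (v i) \<in> fix_set (Suc i) (w \<sigma> (Suc i))"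
        using i \<open>x \<in> V\<close> G_simps(5)[OF wG] by (auto simp: fix_set_def)
      then have "w \<sigma> (Suc i) (inv (w \<sigma> (Suc i)) (v i)) \<in> w \<sigma> (Suc i) ` fix_set (Suc i) (w \<sigma> (Suc i))" by (rule imageI)
      then show "x \<in> (\<Union>n. w \<sigma> n ` fix_set n (w \<sigma> n))" unfolding G_simps(2)[OF wG] using i by blast
    qed
    then show "V \<subseteq> (\<Union>n. fix_set n (w \<sigma> n))" "V \<subseteq> (\<Union>n. w \<sigma> n ` fix_set n (w \<sigma> n))" by auto
  qed (use wG fix_Suc fix_set w_fix in auto)
  then have "\<forall>\<sigma>. \<exists>g. g \<in> G \<and> (\<forall>n. \<forall>x\<in>fix_set n (w \<sigma> n). g x = w \<sigma> n x)" by (simp add: Bex_def)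
  from choice[OF this] obtain g where
    g': "\<forall>\<sigma>. g \<sigma> \<in> G \<and> (\<forall>n. \<forall>x\<in>fix_set n (w \<sigma> n). g \<sigma> x = w \<sigma> n x)" ..
  then have gG: "g \<sigma> \<in> G" and g: "x \<in> fix_set n (w \<sigma> n) \<Longrightarrow> g \<sigma> x = w \<sigma> n x" for \<sigma> n x by simp_all
  have fix_mono: "fix_set m (w \<sigma> m) \<subseteq> fix_set n (w \<sigma> n)" if "m \<le> n" for \<sigma> m n
    using lift_Suc_mono_le[of "\<lambda>n. fix_set n (w \<sigma> n)", OF fix_Suc that] .
  have X_stable: "X \<sigma> m n = X \<sigma> (Suc n) n" if "Suc n \<le> m" for \<sigma> m n
    using that by (induction m rule: dec_induct) (auto simp: X_Suc)
  text \<open>From stage \<open>Suc n\<close> on, \<open>w\<close> is only changed by elements that commute with the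
    \<open>n\<close>-th coordinate.\<close>
  have conj_stable: "w \<sigma> m (X \<sigma> (Suc n) n (inv (w \<sigma> m) x)) = w \<sigma> (Suc n) (X \<sigma> (Suc n) n (inv (w \<sigma> (Suc n)) x))"
    if "Suc n \<le> m" for \<sigma> m n x
    using that
  proof (induction m rule: dec_induct)
    case (step m)
    show ?case
    proof (cases "m \<in> \<sigma>")
      case False
      then show ?thesis using step by (simp add: w_Suc)
    next
      case True
      let ?h = "h \<sigma> m" and ?w = "w \<sigma> m" and ?x = "X \<sigma> (Suc n) n"
      let ?u = "inv (?w \<circ> ?h) x"
      have "?h (?x ?u) = ?x (?h ?u)"
        using good(5)[of n m \<sigma>] step(1) X_stable[OF step(1), of \<sigma>] by (auto simp: fun_eq_iff)
      moreover have "?w (?h ?u) = x" using G_simps(2)[OF comp_mem[OF wG good(3)]] by simp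
      then have "?h ?u = inv ?w x" using G_simps(1)[OF wG] by metis
      ultimately have "?h (?x ?u) = ?x (inv ?w x)" by simp
      then have "?w (?h (?x ?u)) = w \<sigma> (Suc n) (?x (inv (w \<sigma> (Suc n)) x))"
        using step.IH by (simp only:)
      moreover have "w \<sigma> (Suc m) = ?w \<circ> ?h" using True w_Suc[of \<sigma> m] by (simp only: if_True)
      then have "w \<sigma> (Suc m) (?x (inv (w \<sigma> (Suc m)) x)) = (?w \<circ> ?h) (?x ?u)" by (rule ssubst) (rule refl)
      ultimately show ?thesis by (metis o_apply)
    qed
  qed simp
  have conj: "g \<sigma> (X \<sigma> (Suc n) n (inv (g \<sigma>) x)) = w \<sigma> (Suc n) (X \<sigma> (Suc n) n (inv (w \<sigma> (Suc n)) x))"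
    if x: "x \<in> V" for \<sigma> n x
  proof -
    let ?x = "X \<sigma> (Suc n) n" and ?u = "inv (g \<sigma>) x"
    have xG: "?x \<in> G" by (rule generic_mem[OF conjunct1[OF gen[of "Suc n" \<sigma>]]]) simp
    have u: "?u \<in> V" "?x ?u \<in> V" using x G_simps(4)[OF xG] G_simps(5)[OF gG] by auto
    have ex: "\<exists>m. y \<in> fix_set m (w \<sigma> m)" if "y \<in> V" for y
    proof -
      obtain i where "y = v i" using v \<open>y \<in> V\<close> by auto
      then have "y \<in> fix_set (Suc i) (w \<sigma> (Suc i))" using \<open>y \<in> V\<close> by (auto simp: fix_set_def)
      then show ?thesis ..
    qed
    from ex[OF u(1)] obtain k where k: "?u \<in> fix_set k (w \<sigma> k)" ..
    from ex[OF u(2)] obtain l where l: "?x ?u \<in> fix_set l (w \<sigma> l)" ..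
    \<comment> \<open>Late enough for \<open>g \<sigma>\<close> to agree with
      \<open>w \<sigma> ?m\<close> both at \<open>?u\<close> and at its image under the
      coordinate.\<close>
    let ?m = "max (Suc n) (max k l)"
    have "?u \<in> fix_set ?m (w \<sigma> ?m)" by (rule subsetD[OF fix_mono k]) simp
    then have 2: "g \<sigma> ?u = w \<sigma> ?m ?u" by (rule g)
    have "?x ?u \<in> fix_set ?m (w \<sigma> ?m)" by (rule subsetD[OF fix_mono l]) simp
    then have 1: "g \<sigma> (?x ?u) = w \<sigma> ?m (?x ?u)" by (rule g)
    have "x = g \<sigma> ?u" using G_simps(2)[OF gG] by (rule sym)
    also note 2
    finally have "inv (w \<sigma> ?m) x = inv (w \<sigma> ?m) (w \<sigma> ?m ?u)" by (rule arg_cong)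
    then have "inv (w \<sigma> ?m) x = ?u" unfolding G_simps(1)[OF wG] .
    moreover have "w \<sigma> ?m (?x (inv (w \<sigma> ?m) x)) = w \<sigma> (Suc n) (?x (inv (w \<sigma> (Suc n)) x))"
      by (rule conj_stable) simp
    ultimately show ?thesis using 1 by (simp only:)
  qed
  have same: "st \<sigma> n = st \<tau> n" if "\<And>i. i < n \<Longrightarrow> i \<in> \<sigma> \<longleftrightarrow> i \<in> \<tau>" for \<sigma> \<tau> n
    using that by (induction n) (simp_all add: st_def split: prod.splits)
  \<comment> \<open>Both branches share the product \<open>?w\<close> up to stage \<open>n\<close>.
    Conjugating \<open>?y0\<close> by \<open>g \<sigma>\<close> is conjugating it by
    \<open>?w\<close>; conjugating \<open>?y1\<close> by \<open>g \<tau>\<close> is conjugating it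
    by \<open>?w \<circ> ?h\<close>. As \<open>?h\<close> conjugates \<open>?y1\<close> to
    \<open>?y0\<close>, the results coincide, so \<open>?q\<close> conjugates \<open>?y1\<close> to
    \<open>?y0\<close>; with \<open>?q\<close> in \<open>H\<close> this would put \<open>?y1\<close>
    into \<open>H\<close>.\<close>
  have key: "inv (g \<sigma>) \<circ> g \<tau> \<notin> H" if "n \<notin> \<sigma>" "n \<in> \<tau>" and less: "\<And>i. i < n \<Longrightarrow> i \<in> \<sigma> \<longleftrightarrow> i \<in> \<tau>" for \<sigma> \<tau> n
  proof
    assume q: "inv (g \<sigma>) \<circ> g \<tau> \<in> H" (is "?q \<in> H")
    have eq: "X \<tau> n = X \<sigma> n" "w \<tau> n = w \<sigma> n" using same[OF less] by (simp_all add: X_def w_def)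
    then have eq': "y0 \<tau> n = y0 \<sigma> n" "y1 \<tau> n = y1 \<sigma> n" "h \<tau> n = h \<sigma> n" by (simp_all add: y0_def y1_def h_def)
    let ?w = "w \<sigma> n" and ?h = "h \<sigma> n" and ?y0 = "y0 \<sigma> n" and ?y1 = "y1 \<sigma> n"
    define wh where "wh = ?w \<circ> ?h"
    have at: "X \<sigma> (Suc n) n = ?y0" "w \<sigma> (Suc n) = ?w" "X \<tau> (Suc n) n = ?y1" "w \<tau> (Suc n) = wh"
      using that(1,2) by (simp_all only: X_Suc w_Suc eq eq' wh_def if_True if_False fun_upd_same)
    have wh: "wh z = ?w (?h z)" for z by (simp add: wh_def)
    have whG: "wh \<in> G" unfolding wh_def using wG good(3) by (rule comp_mem)
    have y0G: "?y0 \<in> G" using smallD(1)[OF H good(1)] .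
    have y1G: "?y1 \<in> G" and y1H: "?y1 \<notin> H" using good(2) by auto
    have qG: "?q \<in> G" using gG by (intro comp_mem inv_mem)
    have eqV: "?q (?y1 u) = ?y0 (?q u)" if u: "u \<in> V" for u
    proof -
      let ?x = "g \<tau> u"
      have x: "?x \<in> V" using u G_simps(4)[OF gG] by simp
      let ?s = "inv wh ?x"
      have "?w (?h ?s) = ?x" using G_simps(2)[OF whG] by (simp only: wh)
      then have hs: "?h ?s = inv ?w ?x" using G_simps(1)[OF wG] by metis
      have "g \<tau> (?y1 (inv (g \<tau>) ?x)) = ?w (?h (?y1 ?s))" using conj[OF x, of \<tau> n] unfolding at wh .
      also have "?h (?y1 ?s) = ?y0 (?h ?s)" using fun_cong[OF good(6)[of \<sigma> n], of ?s] by simp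
      also have "?w (?y0 (?h ?s)) = g \<sigma> (?y0 (inv (g \<sigma>) ?x))" unfolding hs
        using conj[OF x, of \<sigma> n, symmetric] unfolding at .
      finally have "g \<tau> (?y1 u) = g \<sigma> (?y0 (inv (g \<sigma>) (g \<tau> u)))" by (simp add: G_simps(1)[OF gG])
      then show ?thesis by (simp add: G_simps(1)[OF gG])
    qed
    have "?q \<circ> ?y1 = ?y0 \<circ> ?q"
    proof
      fix u show "(?q \<circ> ?y1) u = (?y0 \<circ> ?q) u"
      proof (cases "u \<in> V")
        case True
        then show ?thesis using eqV by simp
      next
        case False
        then show ?thesis using outside[OF qG] outside[OF y0G] outside[OF y1G] by simp
      qed
    qed
    moreover have "?y0 \<circ> ?q \<in> H" using good(1) q smallD(3)[OF H] by blast
    ultimately have "?q \<circ> ?y1 \<in> H" by metis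
    then show False using mem_cancel(1)[OF H y1G q] y1H by blast
  qed
  have "inv (g \<sigma>) \<circ> g \<tau> \<notin> H" if "\<sigma> \<noteq> \<tau>" for \<sigma> \<tau>
  proof -
    have "\<exists>n. (n \<in> \<sigma>) \<noteq> (n \<in> \<tau>)" using that by auto
    then obtain n where n: "(n \<in> \<sigma>) \<noteq> (n \<in> \<tau>)" "\<And>i. i < n \<Longrightarrow> (i \<in> \<sigma>) = (i \<in> \<tau>)"
      using exists_least_iff[of "\<lambda>n. (n \<in> \<sigma>) \<noteq> (n \<in> \<tau>)"] by auto
    show ?thesis
    proof (cases "n \<in> \<tau>")
      case True
      then show ?thesis using key[of n \<sigma> \<tau>] n by auto
    next
      case False
      then have no: "inv (g \<tau>) \<circ> g \<sigma> \<notin> H" using key[of n \<tau> \<sigma>] n by auto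
      have G: "inv (g \<tau>) \<circ> g \<sigma> \<in> G" "inv (g \<sigma>) \<circ> g \<tau> \<in> G" using gG by (auto intro: comp_mem inv_mem)
      have "inv (inv (g \<sigma>) \<circ> g \<tau>) = inv (g \<tau>) \<circ> g \<sigma>"
      proof
        fix x
        have "(inv (g \<sigma>) \<circ> g \<tau>) ((inv (g \<tau>) \<circ> g \<sigma>) x) = x" by (simp add: G_simps[OF gG])
        then show "inv (inv (g \<sigma>) \<circ> g \<tau>) x = (inv (g \<tau>) \<circ> g \<sigma>) x" using G_simps(1)[OF G(2)] by metis
      qed
      then show ?thesis using no smallD(4)[OF H, of "inv (g \<sigma>) \<circ> g \<tau>"] by auto
    qed
  qed
  then show False using H gG unfolding small_def by blast
qed

end

section \<open>Henson digraphs\<close>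

text \<open>Total functions that are the identity off the vertices, in place of extensional ones:
  products and inverses are then plain composition and \<open>inv\<close>, as the permutation group
  setting expects.\<close>

definition autos :: "'m digraph \<Rightarrow> ('m \<Rightarrow> 'm) set" where
  "autos M = {f. f permutes vertices M \<and> (\<forall>a b. (a, b) \<in> edges M \<longleftrightarrow> (f a, f b) \<in> edges M)}"

lemma autos_permutes: "f \<in> autos M \<Longrightarrow> f permutes vertices M"
  and autos_edges: "f \<in> autos M \<Longrightarrow> (f a, f b) \<in> edges M \<longleftrightarrow> (a, b) \<in> edges M"
  by (auto simp: autos_def)

lemma edges_in_vertices:
  assumes "is_digraph M" "(a, b) \<in> edges M"
  shows "a \<in> vertices M" "b \<in> vertices M"
  using assms by (auto simp: is_digraph_def)

lemma autosI:
  assumes "is_digraph M" "f permutes vertices M"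
    and "\<And>a b. a \<in> vertices M \<Longrightarrow> b \<in> vertices M \<Longrightarrow> (a, b) \<in> edges M \<longleftrightarrow> (f a, f b) \<in> edges M"
  shows "f \<in> autos M"
proof -
  have "(a, b) \<in> edges M \<longleftrightarrow> (f a, f b) \<in> edges M" for a b
    using assms(3)[of a b] edges_in_vertices[OF assms(1)] permutes_in_image[OF assms(2)] by blast
  then show ?thesis using assms(2) by (simp add: autos_def)
qed

lemma autos_id: "id \<in> autos M"
  by (simp add: autos_def permutes_id)

lemma autos_comp: "f \<in> autos M \<Longrightarrow> g \<in> autos M \<Longrightarrow> f \<circ> g \<in> autos M"
  unfolding autos_def by (simp add: permutes_compose)

lemma autos_inv:
  assumes "f \<in> autos M"
  shows "inv f \<in> autos M"
proof -
  have f: "f permutes vertices M" using assms by (rule autos_permutes)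
  have "(a, b) \<in> edges M \<longleftrightarrow> (inv f a, inv f b) \<in> edges M" for a b
    using autos_edges[OF assms, of "inv f a" "inv f b"] by (simp add: permutes_inverses[OF f])
  then show ?thesis using permutes_inv[OF f] by (simp add: autos_def)
qed

lemma autos_of_automorphism:
  assumes M: "is_digraph M" and f: "f \<in> automorphisms M"
  shows "(\<lambda>x. if x \<in> vertices M then f x else x) \<in> autos M" (is "?g \<in> _")
proof (rule autosI[OF M])
  have "bij_betw ?g (vertices M) (vertices M)"
    using f by (subst bij_betw_cong[of _ _ f]) (auto simp: automorphisms_def Bij_def)
  then show "?g permutes vertices M" by (rule bij_imp_permutes) simp
qed (use f in \<open>auto simp: automorphisms_def is_embedding_def\<close>)

lemma restrict_autos:
  assumes "f \<in> autos M"
  shows "restrict f (vertices M) \<in> automorphisms M"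
  using permutes_imp_bij[OF autos_permutes[OF assms]] autos_edges[OF assms]
  by (auto simp: automorphisms_def Bij_def is_embedding_def bij_betw_def inj_on_def)

lemma homogeneous_autos:
  assumes M: "is_digraph M" "homogeneous M" and X: "finite X" "X \<subseteq> vertices M"
    and k: "is_embedding k (induced M X) M"
  shows "\<exists>g\<in>autos M. \<forall>x\<in>X. g x = k x"
proof -
  let ?p = "\<lambda>x. if x \<in> X then Some (k x) else None"
  have dom: "dom ?p = X" by (auto simp: dom_def)
  have "partial_iso M ?p" unfolding partial_iso_def dom
    using X k by (auto simp: is_embedding_def ran_def inj_on_def image_subset_iff)
  then obtain f where f: "f \<in> automorphisms M" "extends f ?p"
    using M(2) X dom unfolding homogeneous_def by metis
  have "f x = k x" if "x \<in> X" for x using f(2) that unfolding extends_def dom by auto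
  then show ?thesis using autos_of_automorphism[OF M(1) f(1)] X(2)
    by (intro bexI[of _ "\<lambda>x. if x \<in> vertices M then f x else x"]) auto
qed

lemma is_digraph_induced: "is_digraph A \<Longrightarrow> is_digraph (induced A S)"
  by (auto simp: is_digraph_def irrefl_def asym_iff)

lemma is_embedding_comp: "is_embedding f A B \<Longrightarrow> is_embedding g B C \<Longrightarrow> is_embedding (g \<circ> f) A C"
  unfolding is_embedding_def by (auto simp: image_subset_iff inj_on_def)

lemma is_embedding_autos:
  assumes "f \<in> autos M"
  shows "is_embedding f M M"
  using autos_edges[OF assms] permutes_inj_on[OF autos_permutes[OF assms]]
    permutes_image[OF autos_permutes[OF assms]] by (auto simp: is_embedding_def)

lemma henson_free:
  assumes M: "henson_digraph \<F> M" and C: "finite C" "C \<subseteq> vertices M" and T: "T \<in> \<F>"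
  shows "\<not> embeds T (induced M C)"
proof
  assume emb: "embeds T (induced M C)"
  obtain A :: "nat digraph" and h where A: "A \<in> free_class \<F>" and h: "is_embedding h A (induced M C)" "h ` vertices A = C"
    using M C unfolding henson_digraph_def isomorphic_def by (metis vertices_induced)
  have eq: "induced (induced M C) C = induced M C" by (auto simp: induced_def)
  have "embeds (induced M C) (induced A (vertices A))"
    using embeds_induced_image(2)[OF h(1) subset_refl] unfolding h(2) eq .
  then have "embeds T A" by (rule embeds_trans[OF embeds_trans[OF emb] embeds_induced])
  then show False using A T by (auto simp: free_class_def)
qed

text \<open>A copy of \<open>B\<close> exists somewhere in \<open>M\<close>; homogeneity gives an
  automorphism taking \<open>C\<close> to its image in that copy, and its inverse brings the copy
  back over \<open>C\<close>. The detour through \<open>nat\<close> is due to the type over which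
  the class ranges.\<close>

lemma henson_extension:
  fixes M :: "'m digraph" and B :: "'b digraph"
  assumes M: "henson_digraph \<F> M" and C: "finite C" "C \<subseteq> vertices M"
    and B: "is_digraph B" "finite (vertices B)" "\<And>T. T \<in> \<F> \<Longrightarrow> \<not> embeds T B"
    and e: "is_embedding e (induced M C) B"
  shows "\<exists>e'. is_embedding e' B M \<and> (\<forall>x\<in>C. e' (e x) = x)"
proof -
  have dM: "is_digraph M" "homogeneous M" using M by (auto simp: henson_digraph_def)
  obtain i :: "'b \<Rightarrow> nat" where i: "inj_on i (vertices B)"
    using B(2) finite_imp_inj_to_nat_seg by metis
  have "\<not> embeds T (map_digraph i B)" if "T \<in> \<F>" for T
    using B(3)[OF that] embeds_trans[OF _ map_digraph_embeds[OF B(1) i]] by blast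
  then have "map_digraph i B \<in> free_class \<F>"
    using B(2) is_digraph_map_digraph[OF B(1) i] by (simp add: free_class_def)
  then obtain S k where S: "S \<subseteq> vertices M" "is_embedding k (map_digraph i B) (induced M S)"
    using M unfolding henson_digraph_def isomorphic_def by metis
  have kM: "is_embedding k (map_digraph i B) M"
    unfolding is_embedding_def
  proof (intro conjI ballI)
    fix a b assume ab: "a \<in> vertices (map_digraph i B)" "b \<in> vertices (map_digraph i B)"
    then have "k a \<in> S" "k b \<in> S" using S(2) unfolding is_embedding_def by auto
    moreover have "(a, b) \<in> edges (map_digraph i B) \<longleftrightarrow> (k a, k b) \<in> edges (induced M S)"
      using S(2) ab unfolding is_embedding_def by blast
    ultimately show "(a, b) \<in> edges (map_digraph i B) \<longleftrightarrow> (k a, k b) \<in> edges M" by simp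
  qed (use S in \<open>auto simp: is_embedding_def\<close>)
  let ?\<kappa> = "k \<circ> i"
  have \<kappa>: "is_embedding ?\<kappa> B M"
    using is_embedding_comp[OF is_embedding_map_digraph[OF B(1) i] kM] .
  obtain g where g: "g \<in> autos M" "\<forall>x\<in>C. g x = (?\<kappa> \<circ> e) x"
    using homogeneous_autos[OF dM C is_embedding_comp[OF e \<kappa>]] by blast
  have "is_embedding (inv g \<circ> ?\<kappa>) B M"
    by (rule is_embedding_comp[OF \<kappa> is_embedding_autos[OF autos_inv[OF g(1)]]])
  moreover have "(inv g \<circ> ?\<kappa>) (e x) = x" if "x \<in> C" for x
  proof -
    have "(inv g \<circ> ?\<kappa>) (e x) = inv g (g x)" using g(2) that by simp
    then show ?thesis using permutes_inverses(2)[OF autos_permutes[OF g(1)]] by simp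
  qed
  ultimately show ?thesis by blast
qed

text \<open>The finite extension is built on natural numbers, since \<open>'m\<close> is not assumed
  to be infinite. It is then embedded into \<open>M\<close> over \<open>C\<close>, and homogeneity
  extends each of its automorphisms to all of \<open>M\<close>.\<close>

lemma henson_eppa:
  fixes M :: "'m digraph" and \<F> :: "'f digraph set" and X :: "nat \<Rightarrow> 'm \<Rightarrow> 'm"
  assumes M: "henson_digraph \<F> M" and tour: "\<And>T. T \<in> \<F> \<Longrightarrow> is_tournament T"
    and C: "finite C" "C \<subseteq> vertices M" and X: "\<And>i. i < n \<Longrightarrow> X i \<in> autos M"
  shows "\<exists>D Y. finite D \<and> C \<subseteq> D \<and> D \<subseteq> vertices M \<and>
    (\<forall>i<n. Y i \<in> autos M \<and> Y i ` D = D \<and> (\<forall>a\<in>C. X i a \<in> C \<longrightarrow> Y i a = X i a))"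
proof -
  let ?A = "induced M C"
  have dM: "is_digraph M" "homogeneous M" using M by (auto simp: henson_digraph_def)
  obtain j :: "'m \<Rightarrow> nat" where j: "inj_on j C" using C(1) finite_imp_inj_to_nat_seg by metis
  obtain B where B: "is_digraph B" "finite (vertices B)" "is_embedding j ?A B"
    "\<And>T::'f digraph. is_tournament T \<Longrightarrow> embeds T B \<Longrightarrow> embeds T ?A"
    "\<And>p. partial_iso ?A p \<Longrightarrow> \<exists>f\<in>automorphisms B. \<forall>a\<in>dom p. f (j a) = j (the (p a))"
    using eppa[OF is_digraph_induced[OF dM(1), of C], of j, where ?'t = 'f] C(1) j by auto
  have "\<not> embeds T B" if "T \<in> \<F>" for T
    using henson_free[OF M C that] B(4)[OF tour[OF that]] by blast
  then obtain e where e: "is_embedding e B M" "\<forall>x\<in>C. e (j x) = x"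
    using henson_extension[OF M C B(1,2) _ B(3)] by blast
  let ?D = "e ` vertices B"
  have inj: "inj_on e (vertices B)" and DV: "?D \<subseteq> vertices M"
    and edge: "\<And>a b. a \<in> vertices B \<Longrightarrow> b \<in> vertices B \<Longrightarrow> (a, b) \<in> edges B \<longleftrightarrow> (e a, e b) \<in> edges M"
    using e(1) by (auto simp: is_embedding_def)
  have jC: "j x \<in> vertices B" if "x \<in> C" for x using B(3) that by (auto simp: is_embedding_def)
  have "\<exists>y. y \<in> autos M \<and> y ` ?D = ?D \<and> (\<forall>a\<in>C. X i a \<in> C \<longrightarrow> y a = X i a)" if i: "i < n" for i
  proof -
    \<comment> \<open>Only the part of \<open>X i\<close> that stays inside \<open>C\<close> is a
      partial isomorphism of the induced digraph.\<close>
    let ?p = "\<lambda>a. if a \<in> C \<and> X i a \<in> C then Some (X i a) else None"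
    have dom: "dom ?p = {a \<in> C. X i a \<in> C}" by (auto simp: dom_def)
    have "inj (X i)" using permutes_inj[OF autos_permutes[OF X[OF i]]] .
    then have "partial_iso ?A ?p"
      unfolding partial_iso_def dom using autos_edges[OF X[OF i]] by (auto simp: ran_def inj_on_def dest: injD)
    then obtain f where f: "f \<in> automorphisms B" "\<forall>a\<in>dom ?p. f (j a) = j (the (?p a))" using B(5) by blast
    have fB: "f ` vertices B = vertices B" and f_inj: "inj_on f (vertices B)"
      and f_edge: "\<And>a b. a \<in> vertices B \<Longrightarrow> b \<in> vertices B \<Longrightarrow> (a, b) \<in> edges B \<longleftrightarrow> (f a, f b) \<in> edges B"
      using f(1) by (auto simp: automorphisms_def Bij_def bij_betw_def is_embedding_def)
    have fm: "f b \<in> vertices B" if "b \<in> vertices B" for b using fB that by blast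
    let ?z = "e \<circ> f \<circ> inv_into (vertices B) e"
    have z: "?z (e b) = e (f b)" if "b \<in> vertices B" for b using that inj by simp
    have "is_embedding ?z (induced M ?D) M"
      unfolding is_embedding_def
    proof (intro conjI ballI)
      show "inj_on ?z (vertices (induced M ?D))"
      proof (rule inj_onI)
        fix u v assume "u \<in> vertices (induced M ?D)" "v \<in> vertices (induced M ?D)" and eq: "?z u = ?z v"
        then obtain a b where ab: "a \<in> vertices B" "b \<in> vertices B" "u = e a" "v = e b" by auto
        then have "e (f a) = e (f b)" using eq z by metis
        then have "a = b" using ab fm inj f_inj by (meson inj_onD)
        then show "u = v" using ab by simp
      qed
      show "?z ` vertices (induced M ?D) \<subseteq> vertices M" using z fm DV by auto
      fix u v assume uv: "u \<in> vertices (induced M ?D)" "v \<in> vertices (induced M ?D)"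
      then obtain a b where ab: "a \<in> vertices B" "b \<in> vertices B" "u = e a" "v = e b" by auto
      then have "(u, v) \<in> edges M \<longleftrightarrow> (?z u, ?z v) \<in> edges M"
        by (simp only: z edge[symmetric] f_edge[symmetric] fm)
      then show "(u, v) \<in> edges (induced M ?D) \<longleftrightarrow> (?z u, ?z v) \<in> edges M" using uv by simp
    qed
    then obtain y where y: "y \<in> autos M" "\<forall>x\<in>?D. y x = ?z x"
      using homogeneous_autos[OF dM _ DV] B(2) by blast
    have ye: "y (e b) = e (f b)" if "b \<in> vertices B" for b
      using y(2)[rule_format, OF imageI[OF that]] z[OF that] by (rule trans)
    have "y ` ?D = e ` f ` vertices B" unfolding image_image using ye by (rule image_cong[OF refl])
    then have "y ` ?D = ?D" by (simp add: fB)
    moreover have "y a = X i a" if a: "a \<in> C" "X i a \<in> C" for a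
    proof -
      have "a \<in> dom ?p" unfolding dom using a by simp
      then have "f (j a) = j (X i a)" using f(2) a by force
      then show ?thesis using ye[OF jC[OF a(1)]] e(2) a by simp
    qed
    ultimately show ?thesis using y(1) by blast
  qed
  then have "\<forall>i\<in>{..<n}. \<exists>y. y \<in> autos M \<and> y ` ?D = ?D \<and> (\<forall>a\<in>C. X i a \<in> C \<longrightarrow> y a = X i a)" by simp
  from bchoice[OF this] obtain Y where
    "\<forall>i\<in>{..<n}. Y i \<in> autos M \<and> Y i ` ?D = ?D \<and> (\<forall>a\<in>C. X i a \<in> C \<longrightarrow> Y i a = X i a)" ..
  moreover have "C \<subseteq> ?D"
  proof
    fix x assume "x \<in> C"
    then show "x \<in> ?D" using e(2) jC by (metis imageI)
  qed
  ultimately show ?thesis using B(2) DV by (intro exI[of _ ?D] exI[of _ Y]) simp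
qed

section \<open>Free amalgamation\<close>

text \<open>Both maps preserve \<open>C\<close>, hence also \<open>P - C\<close> and
  \<open>Q - C\<close> respectively. Pairs across are nonadjacent before and after, so the union of
  the two maps is a finite partial isomorphism, and homogeneity extends it.\<close>

lemma join_autos:
  assumes M: "is_digraph M" "homogeneous M" and P: "finite P" "P \<subseteq> vertices M" and Q: "finite Q" "Q \<subseteq> vertices M"
    and C: "P \<inter> Q = C"
    and free: "\<And>a b. a \<in> P - C \<Longrightarrow> b \<in> Q - C \<Longrightarrow> (a, b) \<notin> edges M \<and> (b, a) \<notin> edges M"
    and u: "u \<in> autos M" "u ` P = P" "u ` C = C" and v: "v \<in> autos M" "v ` Q = Q" "\<forall>x\<in>C. u x = v x"
  shows "\<exists>w\<in>autos M. (\<forall>x\<in>P. w x = u x) \<and> (\<forall>x\<in>Q. w x = v x)"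
proof -
  let ?w = "\<lambda>x. if x \<in> P then u x else v x"
  have wP: "?w x = u x" if "x \<in> P" for x using that by simp
  have wQ: "?w x = v x" if "x \<in> Q" for x using that v(3) C by auto
  have inj: "inj u" "inj v" using permutes_inj[OF autos_permutes] u v by blast+
  have "v ` C = C" using u(3) v(3) by (metis image_cong)
  then have vC: "v x \<in> C \<longleftrightarrow> x \<in> C" for x using inj(2) by (metis imageE image_eqI injD)
  have uC: "u x \<in> C \<longleftrightarrow> x \<in> C" for x using u(3) inj(1) by (metis imageE image_eqI injD)
  have uP: "u x \<in> P" if "x \<in> P" for x using u(2) that by blast
  have vQ: "v x \<in> Q" if "x \<in> Q" for x using v(2) that by blast
  have cross: "u x \<noteq> v y" if "x \<in> P" "y \<in> Q - C" for x y
    using uP[of x] vQ[of y] vC[of y] C that by auto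
  have "is_embedding ?w (induced M (P \<union> Q)) M"
    unfolding is_embedding_def
  proof (intro conjI ballI)
    show "inj_on ?w (vertices (induced M (P \<union> Q)))"
    proof (rule inj_onI)
      fix x y assume xy: "x \<in> vertices (induced M (P \<union> Q))" "y \<in> vertices (induced M (P \<union> Q))" "?w x = ?w y"
      then have "x \<in> P \<or> x \<in> Q - C" "y \<in> P \<or> y \<in> Q - C" using C by auto
      then consider "x \<in> P" "y \<in> P" | "x \<in> P" "y \<in> Q - C" | "x \<in> Q - C" "y \<in> P" | "x \<in> Q" "y \<in> Q" by auto
      then show "x = y"
        using xy(3) wP wQ cross injD[OF inj(1)] injD[OF inj(2)] by cases (metis DiffD1)+
    qed
    show "?w ` vertices (induced M (P \<union> Q)) \<subseteq> vertices M" using uP vQ P(2) Q(2) by auto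
    fix x y assume xy: "x \<in> vertices (induced M (P \<union> Q))" "y \<in> vertices (induced M (P \<union> Q))"
    then consider "x \<in> P" "y \<in> P" | "x \<in> Q" "y \<in> Q" | "x \<in> P - C" "y \<in> Q - C" | "x \<in> Q - C" "y \<in> P - C"
      using C by auto
    then have "(x, y) \<in> edges M \<longleftrightarrow> (?w x, ?w y) \<in> edges M"
    proof cases
      case 1
      then show ?thesis using autos_edges[OF u(1)] by simp
    next
      case 2
      show ?thesis unfolding wQ[OF 2(1)] wQ[OF 2(2)] autos_edges[OF v(1)] by (rule refl)
    next
      case 3
      then have "u x \<in> P - C" "v y \<in> Q - C" using uP uC vQ vC by simp_all
      moreover have "?w x = u x" by (rule wP) (use 3 in simp)
      moreover have "?w y = v y" by (rule wQ) (use 3 in simp)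
      ultimately show ?thesis using free[of x y] free[of "u x" "v y"] 3 by simp
    next
      case 4
      then have "v x \<in> Q - C" "u y \<in> P - C" using uP uC vQ vC by simp_all
      moreover have "?w x = v x" by (rule wQ) (use 4 in simp)
      moreover have "?w y = u y" by (rule wP) (use 4 in simp)
      ultimately show ?thesis using free[of y x] free[of "u y" "v x"] 4 by simp
    qed
    then show "(x, y) \<in> edges (induced M (P \<union> Q)) \<longleftrightarrow> (?w x, ?w y) \<in> edges M" using xy by simp
  qed
  from homogeneous_autos[OF M _ _ this] P Q
  obtain w where w: "w \<in> autos M" "\<forall>x\<in>P \<union> Q. w x = ?w x" by blast
  have "w x = u x" if "x \<in> P" for x using w(2)[rule_format, of x] that by simp
  moreover have "w x = v x" if "x \<in> Q" for x
    using w(2)[rule_format, OF UnI2[OF that]] wQ[OF that] by (rule trans)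
  ultimately show ?thesis using w(1) by blast
qed

text \<open>Inside \<open>M\<close> the sets \<open>P\<close> and \<open>D\<close> may overlap
  outside \<open>C\<close> and be joined by edges. The tags pull them apart: only the points of
  \<open>C\<close> are shared, and these carry the tag of \<open>P\<close>.\<close>

definition free_amalgam :: "'m digraph \<Rightarrow> 'm set \<Rightarrow> 'm set \<Rightarrow> 'm set \<Rightarrow> ('m \<times> bool) digraph" where
  "free_amalgam M C P D = \<lparr>vertices = P \<times> {False} \<union> (D - C) \<times> {True},
     edges = {((a, s), (b, t)). (a, b) \<in> edges M \<and>
       (a \<in> P \<and> b \<in> P \<and> \<not> s \<and> \<not> t \<or> a \<in> D \<and> b \<in> D \<and> s = (a \<notin> C) \<and> t = (b \<notin> C))}\<rparr>"

lemma is_digraph_free_amalgam: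
  assumes "is_digraph M" "C \<subseteq> P"
  shows "is_digraph (free_amalgam M C P D)"
  unfolding is_digraph_def irrefl_def asym_iff
  using assms(2) is_digraph_asym[OF assms(1)] is_digraph_irrefl[OF assms(1)]
  by (auto simp: free_amalgam_def)

lemma is_embedding_free_amalgam:
  assumes "C \<subseteq> P"
  shows "is_embedding (\<lambda>a. (a, False)) (induced M P) (free_amalgam M C P D)"
    and "is_embedding (\<lambda>a. (a, a \<notin> C)) (induced M D) (free_amalgam M C P D)"
  using assms by (auto simp: is_embedding_def free_amalgam_def inj_on_def)

lemma embeds_of_image_subset:
  assumes h: "is_embedding h T B" and k: "is_embedding k A B" "h ` vertices T \<subseteq> k ` vertices A"
  shows "embeds T A"
proof -
  have "is_embedding h T (induced B (k ` vertices A))"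
    using h k(2) by (auto simp: is_embedding_def)
  then have "embeds T (induced B (k ` vertices A))" by (auto simp: embeds_def)
  then show ?thesis
    by (rule embeds_trans[OF embeds_trans[OF _ embeds_induced_image(2)[OF k(1) subset_refl]] embeds_induced])
qed

text \<open>A point outside the copy of \<open>P\<close> and a point outside the copy of
  \<open>D\<close> are nonadjacent, so no tournament contains both.\<close>

lemma tournament_embeds_free_amalgam:
  fixes M :: "'m digraph" and T :: "'t digraph"
  assumes C: "C \<subseteq> P" "C \<subseteq> D" and T: "is_tournament T" "embeds T (free_amalgam M C P D)"
  shows "embeds T (induced M P) \<or> embeds T (induced M D)"
proof -
  let ?B = "free_amalgam M C P D" and ?i = "\<lambda>a. (a, False)" and ?j = "\<lambda>a. (a, a \<notin> C)"
  obtain h where h: "is_embedding h T ?B" using T by (auto simp: embeds_def)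
  have one_side: "h ` vertices T \<subseteq> ?i ` P \<or> h ` vertices T \<subseteq> ?j ` D"
  proof (rule ccontr)
    assume "\<not> ?thesis"
    then obtain s t where st: "s \<in> vertices T" "h s \<notin> ?i ` P" "t \<in> vertices T" "h t \<notin> ?j ` D" by blast
    have "h s \<in> vertices ?B" "h t \<in> vertices ?B" using h st by (auto simp: is_embedding_def)
    then have hs: "\<exists>b. h s = (b, True) \<and> b \<in> D - C" and ht: "\<exists>a. h t = (a, False) \<and> a \<notin> C"
      using st C by (auto simp: free_amalgam_def image_iff)
    then have "s \<noteq> t" by auto
    then have "(s, t) \<in> edges T \<or> (t, s) \<in> edges T" using T(1) st by (auto simp: is_tournament_def)
    then have "(h s, h t) \<in> edges ?B \<or> (h t, h s) \<in> edges ?B" using h st by (auto simp: is_embedding_def)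
    then show False using hs ht by (auto simp: free_amalgam_def)
  qed
  show ?thesis
    using one_side embeds_of_image_subset[OF h is_embedding_free_amalgam(1)[OF C(1), of M D]]
      embeds_of_image_subset[OF h is_embedding_free_amalgam(2)[OF C(1), of M D]]
    by auto
qed

text \<open>The free amalgam omits the forbidden tournaments, so it embeds into \<open>M\<close>
  over \<open>P\<close>. By homogeneity some \<open>g\<close> moves \<open>D\<close> onto its copy
  there. The image meets \<open>P\<close> in \<open>C\<close> only, with no edges across, which is
  the situation of \<open>join_autos\<close>.\<close>

lemma henson_amalgamation:
  fixes M :: "'m digraph" and \<F> :: "'f digraph set"
  assumes M: "henson_digraph \<F> M" and tour: "\<And>T. T \<in> \<F> \<Longrightarrow> is_tournament T"
    and fin: "finite P" "finite D" "P \<subseteq> vertices M" "D \<subseteq> vertices M" and C: "C \<subseteq> P" "C \<subseteq> D"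
  shows "\<exists>g\<in>autos M. (\<forall>x\<in>C. g x = x) \<and>
    (\<forall>u\<in>autos M. \<forall>v\<in>autos M. u ` P = P \<longrightarrow> v ` g ` D = g ` D \<longrightarrow> u ` C = C \<longrightarrow> (\<forall>x\<in>C. u x = v x) \<longrightarrow>
      (\<exists>w\<in>autos M. (\<forall>x\<in>P. w x = u x) \<and> (\<forall>x\<in>g ` D. w x = v x)))"
proof -
  have dM: "is_digraph M" "homogeneous M" using M by (auto simp: henson_digraph_def)
  let ?B = "free_amalgam M C P D" and ?j = "\<lambda>a. (a, a \<notin> C)"
  have finB: "finite (vertices ?B)" using fin by (simp add: free_amalgam_def)
  have "\<not> embeds T ?B" if "T \<in> \<F>" for T
    using tournament_embeds_free_amalgam[OF C tour[OF that]] henson_free[OF M fin(1,3) that]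
      henson_free[OF M fin(2,4) that] by blast
  then obtain e where e: "is_embedding e ?B M" "\<forall>x\<in>P. e (x, False) = x"
    using henson_extension[OF M fin(1,3) is_digraph_free_amalgam[OF dM(1) C(1)] finB _ is_embedding_free_amalgam(1)[OF C(1)]]
    by blast
  obtain g where g: "g \<in> autos M" "\<forall>x\<in>D. g x = (e \<circ> ?j) x"
    using homogeneous_autos[OF dM fin(2,4) is_embedding_comp[OF is_embedding_free_amalgam(2)[OF C(1)] e(1)]] by blast
  have gC: "g x = x" if "x \<in> C" for x
  proof -
    have "x \<in> D" "x \<in> P" using that C by auto
    then show ?thesis using g(2) e(2) that by simp
  qed
  have gD: "g x = e (x, True)" if "x \<in> D - C" for x using g(2)[rule_format, of x] that by simp
  have B: "(x, False) \<in> vertices ?B" if "x \<in> P" for x using that by (simp add: free_amalgam_def)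
  have B': "(x, True) \<in> vertices ?B" if "x \<in> D - C" for x using that by (simp add: free_amalgam_def)
  have disj: "g x \<notin> P" if "x \<in> D - C" for x
  proof
    assume "g x \<in> P"
    then have "e (g x, False) = e (x, True)" using e(2) gD[OF that] by simp
    then have "(g x, False) = (x, True)"
      using e(1) B[OF \<open>g x \<in> P\<close>] B'[OF that] unfolding is_embedding_def by (meson inj_onD)
    then show False by simp
  qed
  have "g ` D = g ` C \<union> g ` (D - C)" using C by auto
  moreover have "g ` C = C" using gC by simp
  ultimately have gD_eq: "g ` D = C \<union> g ` (D - C)" by simp
  then have int: "P \<inter> g ` D = C" using C disj by auto
  have free: "(a, b) \<notin> edges M \<and> (b, a) \<notin> edges M" if a: "a \<in> P - C" and b: "b \<in> g ` D - C" for a b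
  proof -
    obtain d where d: "d \<in> D - C" "b = g d" using b gD_eq by auto
    have ea: "e (a, False) = a" "e (d, True) = b" using e(2) a gD[OF d(1)] d(2) by auto
    have "((a, False), (d, True)) \<notin> edges ?B" "((d, True), (a, False)) \<notin> edges ?B"
      using a by (auto simp: free_amalgam_def)
    then have "(e (a, False), e (d, True)) \<notin> edges M" "(e (d, True), e (a, False)) \<notin> edges M"
      using e(1) B[of a] B'[OF d(1)] a unfolding is_embedding_def by blast+
    then show ?thesis by (simp add: ea)
  qed
  have fgD: "finite (g ` D)" "g ` D \<subseteq> vertices M"
    using fin permutes_image[OF autos_permutes[OF g(1)]] by auto
  show ?thesis
  proof (rule bexI[of _ g], intro conjI ballI impI)
    fix u v assume "u \<in> autos M" "v \<in> autos M" "u ` P = P" "v ` g ` D = g ` D" "u ` C = C" "\<forall>x\<in>C. u x = v x"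
    then show "\<exists>w\<in>autos M. (\<forall>x\<in>P. w x = u x) \<and> (\<forall>x\<in>g ` D. w x = v x)"
      by (intro join_autos[OF dM fin(1,3) fgD int free])
  qed (use g gC in auto)
qed

lemma generic_perm_group_henson:
  fixes M :: "'m digraph" and \<F> :: "'f digraph set"
  assumes M: "henson_digraph \<F> M" and tour: "\<And>T. T \<in> \<F> \<Longrightarrow> is_tournament T"
  shows "generic_perm_group (vertices M) (autos M)"
proof
  have dM: "is_digraph M" using M by (auto simp: henson_digraph_def)
  show "countable (vertices M)" using M by (simp add: henson_digraph_def)
  show "g permutes vertices M" if "g \<in> autos M" for g using that by (rule autos_permutes)
  show "id \<in> autos M" by (rule autos_id)
  show "g \<circ> h \<in> autos M" if "g \<in> autos M" "h \<in> autos M" for g h using that by (rule autos_comp)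
  show "inv g \<in> autos M" if "g \<in> autos M" for g using that by (rule autos_inv)
  fix f assume f: "f permutes vertices M"
    and lim: "\<And>E. finite E \<Longrightarrow> E \<subseteq> vertices M \<Longrightarrow> \<exists>g\<in>autos M. \<forall>x\<in>E. g x = f x"
  show "f \<in> autos M"
  proof (rule autosI[OF dM f])
    fix a b assume "a \<in> vertices M" "b \<in> vertices M"
    then have "\<exists>g\<in>autos M. \<forall>x\<in>{a, b}. g x = f x" by (intro lim) simp_all
    then obtain g where "g \<in> autos M" "\<forall>x\<in>{a, b}. g x = f x" ..
    then show "(a, b) \<in> edges M \<longleftrightarrow> (f a, f b) \<in> edges M" using autos_edges[of g M a b] by simp
  qed
qed (rule henson_eppa[OF M tour] henson_amalgamation[OF M tour]; assumption)+

section \<open>Transfer to the group of extensional automorphisms\<close>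

lemma Aut_simps:
  "carrier (Aut M) = automorphisms M"
  "f \<in> Bij (vertices M) \<Longrightarrow> g \<in> Bij (vertices M) \<Longrightarrow> f \<otimes>\<^bsub>Aut M\<^esub> g = compose (vertices M) f g"
  "\<one>\<^bsub>Aut M\<^esub> = (\<lambda>x\<in>vertices M. x)"
  by (simp_all add: Aut_def BijGroup_def)

lemma restrict_comp:
  assumes "f \<in> autos M" "g \<in> autos M"
  shows "restrict (f \<circ> g) (vertices M) = restrict f (vertices M) \<otimes>\<^bsub>Aut M\<^esub> restrict g (vertices M)"
proof -
  have "restrict f (vertices M) \<in> Bij (vertices M)" "restrict g (vertices M) \<in> Bij (vertices M)"
    using restrict_autos assms by (auto simp: automorphisms_def)
  then show ?thesis using permutes_in_image[OF autos_permutes[OF assms(2)]]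
    by (auto simp: Aut_simps compose_def fun_eq_iff)
qed

lemma restrict_id: "restrict id (vertices M) = \<one>\<^bsub>Aut M\<^esub>"
  unfolding Aut_simps(3) by (rule restrict_ext) simp

lemma restrict_inv:
  assumes "f \<in> autos M"
  shows "restrict (inv f) (vertices M) = m_inv (Aut M) (restrict f (vertices M))"
proof -
  have "inv f \<circ> f = id" using permutes_inv_o(2)[OF autos_permutes[OF assms]] .
  then have "restrict (inv f) (vertices M) \<otimes>\<^bsub>Aut M\<^esub> restrict f (vertices M) = \<one>\<^bsub>Aut M\<^esub>"
    by (simp only: restrict_comp[OF autos_inv[OF assms] assms, symmetric] restrict_id)
  then have "m_inv (Aut M) (restrict f (vertices M)) = restrict (inv f) (vertices M)"
    by (rule group.inv_equality[OF group_Aut])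
      (simp_all only: Aut_simps(1) restrict_autos assms autos_inv)
  then show ?thesis by (rule sym)
qed

theorem henson_small_index:
  fixes M :: "'m digraph" and \<F> :: "'f digraph set"
  assumes M: "henson_digraph \<F> M" and tour: "\<And>T. T \<in> \<F> \<Longrightarrow> is_tournament T"
  shows "small_index_property M"
  unfolding small_index_property_def
proof (intro allI impI, elim conjE)
  fix H assume H: "subgroup H (Aut M)" and few: "rcosets\<^bsub>Aut M\<^esub> H \<prec> (UNIV :: nat set set)"
  let ?V = "vertices M"
  have dM: "is_digraph M" using M by (auto simp: henson_digraph_def)
  interpret generic_perm_group ?V "autos M" by (rule generic_perm_group_henson[OF M tour])
  interpret A: group "Aut M" by (rule group_Aut)
  let ?K = "{g \<in> autos M. restrict g ?V \<in> H}"
  have "\<not> (\<exists>g :: nat set \<Rightarrow> 'm \<Rightarrow> 'm. (\<forall>\<sigma>. g \<sigma> \<in> autos M) \<and> (\<forall>\<sigma> \<tau>. \<sigma> \<noteq> \<tau> \<longrightarrow> inv (g \<sigma>) \<circ> g \<tau> \<notin> ?K))"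
  proof (rule notI, elim exE conjE)
    fix g :: "nat set \<Rightarrow> 'm \<Rightarrow> 'm"
    assume g: "\<forall>\<sigma>. g \<sigma> \<in> autos M" and sep: "\<forall>\<sigma> \<tau>. \<sigma> \<noteq> \<tau> \<longrightarrow> inv (g \<sigma>) \<circ> g \<tau> \<notin> ?K"
    \<comment> \<open>Smallness separates left cosets while \<open>rcosets\<close> collects right
      ones; inverting the representatives exchanges the two.\<close>
    define a where "a \<sigma> = restrict (inv (g \<sigma>)) ?V" for \<sigma>
    have aG: "a \<sigma> \<in> carrier (Aut M)" for \<sigma>
      using restrict_autos[OF autos_inv[OF g[rule_format]]] by (simp add: a_def Aut_simps)
    have "inj (\<lambda>\<sigma>. H #>\<^bsub>Aut M\<^esub> a \<sigma>)"
    proof (rule injI, rule ccontr)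
      fix \<sigma> \<tau> assume eq: "H #>\<^bsub>Aut M\<^esub> a \<sigma> = H #>\<^bsub>Aut M\<^esub> a \<tau>" and ne: "\<sigma> \<noteq> \<tau>"
      have "a \<sigma> \<in> H #>\<^bsub>Aut M\<^esub> a \<tau>" using A.rcos_self[OF aG H, of \<sigma>] eq by simp
      then obtain k where k: "k \<in> H" "a \<sigma> = k \<otimes>\<^bsub>Aut M\<^esub> a \<tau>" by (auto simp: r_coset_def)
      have "restrict (inv (g \<sigma>) \<circ> g \<tau>) ?V = a \<sigma> \<otimes>\<^bsub>Aut M\<^esub> restrict (g \<tau>) ?V"
        using restrict_comp[OF autos_inv[OF g[rule_format]] g[rule_format]] by (simp add: a_def)
      also have "restrict (g \<tau>) ?V = m_inv (Aut M) (a \<tau>)"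
        using restrict_inv[OF autos_inv[OF g[rule_format, of \<tau>]]] G_simps(8)[OF g[rule_format, of \<tau>]]
        by (simp add: a_def)
      also have "a \<sigma> \<otimes>\<^bsub>Aut M\<^esub> m_inv (Aut M) (a \<tau>) = k"
        using k aG subgroup.mem_carrier[OF H k(1)] by (simp add: A.m_assoc)
      finally have eqk: "restrict (inv (g \<sigma>) \<circ> g \<tau>) ?V = k" .
      have "inv (g \<sigma>) \<circ> g \<tau> \<in> ?K"
        unfolding mem_Collect_eq eqk
        by (intro conjI k(1) autos_comp[OF autos_inv[OF g[rule_format]] g[rule_format]])
      then show False using sep ne by blast
    qed
    moreover have "range (\<lambda>\<sigma>. H #>\<^bsub>Aut M\<^esub> a \<sigma>) \<subseteq> rcosets\<^bsub>Aut M\<^esub> H"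
      using aG by (auto simp: RCOSETS_def)
    ultimately have "(UNIV :: nat set set) \<lesssim> rcosets\<^bsub>Aut M\<^esub> H" unfolding lepoll_def by blast
    then show False using few lesspoll_trans2 by blast
  qed
  moreover have "id \<in> ?K"
    unfolding mem_Collect_eq restrict_id by (intro conjI autos_id subgroup.one_closed[OF H])
  moreover have "\<forall>f\<in>?K. \<forall>g\<in>?K. f \<circ> g \<in> ?K"
  proof (intro ballI)
    fix f g assume "f \<in> ?K" "g \<in> ?K"
    then have "f \<in> autos M" "g \<in> autos M" "restrict f ?V \<in> H" "restrict g ?V \<in> H" by simp_all
    then show "f \<circ> g \<in> ?K" unfolding mem_Collect_eq
      by (simp only: autos_comp restrict_comp subgroup.m_closed[OF H])
  qed
  moreover have "\<forall>f\<in>?K. inv f \<in> ?K"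
    using restrict_inv subgroup.m_inv_closed[OF H] autos_inv by (metis (mono_tags, lifting) mem_Collect_eq)
  ultimately have "small ?K"
    unfolding small_def by (intro conjI) (blast, assumption+)
  from small_is_open[OF this] obtain S where
    S: "finite S" "S \<subseteq> ?V" "\<forall>g\<in>autos M. (\<forall>x\<in>S. g x = x) \<longrightarrow> g \<in> ?K" by (elim exE conjE)
  have "f \<in> H" if f: "f \<in> pointwise_stabilizer M S" for f
  proof -
    let ?g = "\<lambda>x. if x \<in> ?V then f x else x"
    have fA: "f \<in> automorphisms M" "\<forall>x\<in>S. f x = x" using f by (auto simp: pointwise_stabilizer_def)
    have "?g \<in> ?K"
      by (rule S(3)[rule_format, OF autos_of_automorphism[OF dM fA(1)]]) (use fA(2) in simp)
    moreover have "restrict ?g ?V = f"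
      using fA(1) by (auto simp: automorphisms_def Bij_def fun_eq_iff extensional_def)
    ultimately show ?thesis by simp
  qed
  then show "\<exists>S. S \<subseteq> ?V \<and> finite S \<and> pointwise_stabilizer M S \<subseteq> H" using S by blast
qed

theorem theorem4:
  fixes \<F> :: "'f digraph set"
  assumes "\<And>T. T \<in> \<F> \<Longrightarrow> is_tournament T \<and> finite (vertices T) \<and> vertices T \<noteq> {}"
  shows "(\<forall>(A :: 'a::infinite digraph) (n :: nat) (p :: nat \<Rightarrow> 'a \<rightharpoonup> 'a).
            A \<in> free_class \<F> \<and> (\<forall>i\<in>{1..n}. partial_iso A (p i)) \<longrightarrow>
            (\<exists>B \<in> free_class \<F>. substructure A B \<and>
               (\<exists>f :: nat \<Rightarrow> 'a \<Rightarrow> 'a.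
                  \<forall>i\<in>{1..n}. f i \<in> automorphisms B \<and> extends (f i) (p i))))
       \<and> (\<forall>M :: 'm digraph. henson_digraph \<F> M \<longrightarrow> small_index_property M)"
proof (intro conjI allI impI)
  have tour: "is_tournament T" if "T \<in> \<F>" for T using assms[OF that] by blast
  show "small_index_property M" if "henson_digraph \<F> M" for M :: "'m digraph"
    using henson_small_index[OF that tour] .
  fix A :: "'a digraph" and n :: nat and p :: "nat \<Rightarrow> 'a \<rightharpoonup> 'a"
  assume A: "A \<in> free_class \<F> \<and> (\<forall>i\<in>{1..n}. partial_iso A (p i))"
  obtain B where B: "B \<in> free_class \<F>" "substructure A B"
    "\<And>p. partial_iso A p \<Longrightarrow> \<exists>f\<in>automorphisms B. extends f p"
    using free_class_eppa[OF tour] A by blast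
  have "\<forall>i\<in>{1..n}. \<exists>f. f \<in> automorphisms B \<and> extends f (p i)" using B(3) A by blast
  from bchoice[OF this] show "\<exists>B \<in> free_class \<F>. substructure A B \<and>
      (\<exists>f :: nat \<Rightarrow> 'a \<Rightarrow> 'a. \<forall>i\<in>{1..n}. f i \<in> automorphisms B \<and> extends (f i) (p i))"
    using B(1,2) by blast
qed

end
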